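(* Let $\beta>0$, $1\le p,q\le\infty$ and $f:\mathbb{Z}\to\mathbb{R}$. (i) Suppose that $\frac{f}{1+|\cdot|^\alpha}\in\ell^q(\mathbb{Z},\mu)$ for some $\alpha>0$, and let $m,l\in\mathbb{N}_0$ be such that $\frac m2+l>\frac\alpha2$. • If $l\in\mathbb{N}$, there is $C>0$ such that $$\|t^{\beta+\frac12}\partial_t^l\delta_{right}^me^{t\Delta_d}f\|_{p,q}\le C\,\|t^\beta\partial_t^{l-1}\delta_{right}^{m+1}e^{t\Delta_d}f\|_{p,q}.$$ • If $m\in\mathbb{N}$, there is $C>0$ such that $$\|t^{\beta}\partial_t^l\delta_{right}^me^{t\Delta_d}f\|_{p,q}\le C\,\|t^{\beta+\frac12}\partial_t^{l+1}\delta_{right}^{m-1}e^{t\Delta_d}f\|_{p,q}.$$ (ii) Suppose that $f$ satisfies $\sum_{j\in\mathbb{Z}}\frac{|f(j)|}{1+|j|^2}<\infty$, and let $m,l\in\mathbb{N}_0$. • If $l\in\mathbb{N}$, there is $C>0$ such that $$\|y^{\beta}\partial_y^l\delta_{right}^me^{-y\sqrt{-\Delta_d}}f\|_{p,q}\le C\,\|y^\beta\partial_y^{l-1}\delta_{right}^{m+1}e^{-y\sqrt{-\Delta_d}}f\|_{p,q}.$$ • If $m\in\mathbb{N}$, there is $C>0$ such that $$\|y^{\beta}\partial_y^l\delta_{right}^me^{-y\sqrt{-\Delta_d}}f\|_{p,q}\le C\,\|y^{\beta}\partial_y^{l+1}\delta_{right}^{m-1}e^{-y\sqrt{-\Delt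a_d}}f\|_{p,q}.$$
   Context: $\mathbb{N}=\{1,2,\dots\}$, $\mathbb{N}_0=\mathbb{N}\cup\{0\}$; $\|\cdot\|_p$ is the norm of $\ell^p(\mathbb{Z})$. For $f:\mathbb{Z}\to\mathbb{R}$, $\delta_{right}f(n)=f(n)-f(n+1)$ and $\delta_{right}^m$ is its $m$-fold composition ($\delta_{right}^0f=f$). Weighted space: $\mu=\sum_{n\in\mathbb{Z}}\frac{1}{1+|n|}\delta_n$ ($\delta_n$ the Dirac measure at $n$); $g\in\ell^q(\mathbb{Z},\mu)$ means $\sum_n|g(n)|^q\frac1{1+|n|}<\infty$ if $1\le q<\infty$, and $\ell^\infty(\mathbb{Z},\mu)=\ell^\infty(\mathbb{Z})$. The expression $\frac{f}{1+|\cdot|^\alpha}$ is the sequence $n\mapsto\frac{f(n)}{1+|n|^\alpha}$. Discrete Laplacian: $\Delta_df(n)=f(n+1)-2f(n)+f(n-1)$. Heat semigroup: $e^{t\Delta_d}f(n)=\sum_{j\in\mathbb{Z}}G(t,n-j)f(j)$, with $G(t,n)=e^{-2t}I_n(2t)$, $t>0$, $n\in\mathbb{Z}$, and $I_n$ the modified Bessel function of the first kind of order $n$. Poisson semigroup: $e^{-y\sqrt{-\Delta_d}}f(n)=\frac{y}{2\sqrt\pi}\int_0^\infty\frac{e^{-y^2/(4t)}}{t^{3/2}}e^{t\Delta_d}f(n)\,dt$, $y>0$. Mixed norms (values in $[0,\infty]$): for a function $F$ of $t>0$ with values in sequences on $\mathbb{Z}$, $\|F\|_{p,q}=\left(\int_0^\infty\|F(t)\|_p^q\frac{dt}{t}\right)^{1/q}$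 for $1\le q<\infty$ and $\|F\|_{p,\infty}=\operatorname{ess\,sup}_{t>0}\|F(t)\|_p$; in (ii) the variable is $y>0$. *)

theory Defs
  imports "HOL-Analysis.Analysis" "HOL-Probability.Essential_Supremum"
begin

definition delta_right :: "(int \<Rightarrow> real) \<Rightarrow> int \<Rightarrow> real" where
  "delta_right f n = f n - f (n + 1)"

text \<open>The reciprocal Gamma function vanishes at the non-positive integers, so for negative order
  the terms with \<open>n + k < 0\<close> disappear and \<open>bessel_I (- n) = bessel_I n\<close>.\<close>

definition bessel_I :: "int \<Rightarrow> real \<Rightarrow> real" where
  "bessel_I n x = (\<Sum>k. rGamma (of_int (n + int k + 1)) / fact k * (x / 2) powi (n + 2 * int k))"

definition heat_kernel :: "real \<Rightarrow> int \<Rightarrow> real" where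
  "heat_kernel t n = exp (- 2 * t) * bessel_I n (2 * t)"

definition heat_semigroup :: "real \<Rightarrow> (int \<Rightarrow> real) \<Rightarrow> int \<Rightarrow> real" where
  "heat_semigroup t f n = (\<Sum>\<^sub>\<infinity>j. heat_kernel t (n - j) * f j)"

definition poisson_semigroup :: "real \<Rightarrow> (int \<Rightarrow> real) \<Rightarrow> int \<Rightarrow> real" where
  "poisson_semigroup y f n = y / (2 * sqrt pi) *
     (LBINT t:{0<..}. exp (- (y\<^sup>2 / (4 * t))) / t powr (3 / 2) * heat_semigroup t f n)"

text \<open>Exponents in \<open>[1, \<infinity>]\<close> are taken in \<^typ>\<open>ennreal\<close>, and norms may be infinite. The real power of an
  extended nonnegative real below is meant for positive exponents \<open>r\<close> only, where
  \<open>\<infinity>\<close> to the power \<open>r\<close> is \<open>\<infinity>\<close>.\<close>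

definition ennreal_powr :: "ennreal \<Rightarrow> real \<Rightarrow> ennreal" where
  "ennreal_powr x r = (if x = \<infinity> then \<infinity> else ennreal (enn2real x powr r))"

definition lp_norm :: "ennreal \<Rightarrow> (int \<Rightarrow> real) \<Rightarrow> ennreal" where
  "lp_norm p g =
     (if p = \<infinity> then (SUP n. ennreal \<bar>g n\<bar>)
      else ennreal_powr (\<integral>\<^sup>+ n. ennreal (\<bar>g n\<bar> powr enn2real p) \<partial>count_space UNIV)
             (1 / enn2real p))"

definition mixed_norm :: "ennreal \<Rightarrow> ennreal \<Rightarrow> (real \<Rightarrow> int \<Rightarrow> real) \<Rightarrow> ennreal" where
  "mixed_norm p q F =
     (if q = \<infinity> then esssup (restrict_space lborel {0<..}) (\<lambda>t. lp_norm p (F t))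
      else ennreal_powr
             (\<integral>\<^sup>+ t \<in> {0<..}. ennreal_powr (lp_norm p (F t)) (enn2real q) * ennreal (1 / t) \<partial>lborel)
             (1 / enn2real q))"

definition in_lq_mu :: "ennreal \<Rightarrow> (int \<Rightarrow> real) \<Rightarrow> bool" where
  "in_lq_mu q g \<longleftrightarrow>
     (if q = \<infinity> then bounded (range g)
      else (\<lambda>n. \<bar>g n\<bar> powr enn2real q * (1 / (1 + \<bar>real_of_int n\<bar>))) summable_on UNIV)"

definition heat_deriv :: "nat \<Rightarrow> nat \<Rightarrow> (int \<Rightarrow> real) \<Rightarrow> real \<Rightarrow> int \<Rightarrow> real" where
  "heat_deriv l m f t n = (deriv ^^ l) (\<lambda>s. (delta_right ^^ m) (heat_semigroup s f) n) t"

definition poisson_deriv :: "nat \<Rightarrow> nat \<Rightarrow> (int \<Rightarrow> real) \<Rightarrow> real \<Rightarrow> int \<Rightarrow> real" where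
  "poisson_deriv l m f y n = (deriv ^^ l) (\<lambda>s. (delta_right ^^ m) (poisson_semigroup s f) n) y"

end

(* Both inequalities of each part compare u = D K_t f, with D a finite difference operator and K_t a
   convolution semigroup, with a function U for which |D' u| = |delta U| up to a shift, where D' is the
   identity or d/dt.  From U(t) = K_(t/2) * U(t/2) and Young's inequality,
   ||delta U(t)||_p <= ||delta K_(t/2)||_1 ||U(t/2)||_p, and ||delta K_t||_1 is O(t^(-1/2)) for the heat
   kernel and O(1/t) for the Poisson kernel.  When D' = d/dt, u is recovered by integrating u' from
   infinity, where u vanishes by the growth condition on f, and Minkowski's and Hardy's inequalities apply.

   The heat kernel is the law of the difference of two independent Poisson(t) variables.  This gives the
   l^1 bound of its differences from the Poisson variance, and, with exponential weights, all the decay.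
   The Poisson kernel is the subordinated kernel, with Fourier transform exp(- 2 y |sin(x/2)|). *)

theory Submission
  imports Defs "HOL-Probability.Distributions"
begin

text \<open>The obstacle is that \<open>f\<close> is only known to grow polynomially, so no norm of
  \<open>f\<close> is available and either side may be infinite. Growth and decay are measured
  against the weight (1 + |n|)^(-a). In the heat part \<open>a\<close> must exceed \<alpha> + 1 to
  make \<open>f\<close> summable against the weight, while m + 2l differences of the heat kernel are
  bounded by t^((a - m - 2l - 1)/2) times the weight and so vanish at infinity if a < m + 2l + 1.
  Such an \<open>a\<close> exists exactly when m/2 + l > \<alpha>/2. In the Poisson part a = 2: one
  difference or one derivative of the kernel is bounded by this weight uniformly in y. The bound for
  the kernel itself grows with y, but every function recovered from infinity carries at least one
  difference or derivative. The heat kernel is localised at the scale sqrt t by tilting with w^i, w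
  = 1 + 1/sqrt t: the tilt multiplies the mass by at most exp(t (w - 1)^2 / w), which stays bounded.
  Passing from t to t/2 costs only a power of 2, because dt/t is invariant under dilations. All
  constants are explicit and independent of \<open>f\<close>.\<close>

section \<open>Minkowski's integral inequality\<close>

lemma ennreal_powr_ennreal: "x \<ge> 0 \<Longrightarrow> ennreal_powr (ennreal x) r = ennreal (x powr r)"
  by (simp add: ennreal_powr_def)

lemma ennreal_powr_top [simp]: "ennreal_powr top r = top"
  by (simp add: ennreal_powr_def)

lemma ennreal_powr_zero [simp]: "ennreal_powr 0 r = 0"
  by (simp add: ennreal_powr_def)

lemma ennreal_powr_mono: "x \<le> y \<Longrightarrow> 0 \<le> r \<Longrightarrow> ennreal_powr x r \<le> ennreal_powr y r"
  by (cases x; cases y) (auto simp: ennreal_powr_ennreal top_unique intro!: powr_mono2)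

text \<open>True for every real \<open>r\<close>, negative ones included: \<open>0 * top = 0\<close>
  is compatible with powers because \<open>0 powr r = 0\<close>. Negative exponents do occur, as
  \<open>1 - q\<close> in Jensen's inequality.\<close>

lemma ennreal_powr_mult: "ennreal_powr (x * y) r = ennreal_powr x r * ennreal_powr y r"
proof (cases x; cases y)
  fix a b assume "x = ennreal a" "y = ennreal b" "0 \<le> a" "0 \<le> b"
  then show ?thesis
    by (simp add: ennreal_powr_ennreal powr_mult flip: ennreal_mult)
next
  fix a assume a: "x = ennreal a" "0 \<le> a" "y = top"
  show ?thesis
  proof (cases "a = 0")
    case True then show ?thesis using a by simp
  next
    case False
    then have "x * y = top" "ennreal_powr x r \<noteq> 0"
      using a by (auto simp: ennreal_mult_top ennreal_powr_ennreal)
    then show ?thesis using a by (simp add: ennreal_mult_top)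
  qed
next
  fix b assume a: "y = ennreal b" "0 \<le> b" "x = top"
  show ?thesis
  proof (cases "b = 0")
    case True then show ?thesis using a by simp
  next
    case False
    then have "x * y = top" "ennreal_powr y r \<noteq> 0"
      using a by (auto simp: ennreal_top_mult ennreal_powr_ennreal)
    then show ?thesis using a by (simp add: ennreal_top_mult)
  qed
qed simp

lemma ennreal_powr_powr: "ennreal_powr (ennreal_powr x r) s = ennreal_powr x (r * s)"
  by (cases x) (simp_all add: ennreal_powr_ennreal powr_powr)

lemma ennreal_powr_one [simp]: "ennreal_powr x 1 = x"
  by (cases x) (simp_all add: ennreal_powr_ennreal)

lemma ennreal_powr_eq_0_iff: "ennreal_powr x r = 0 \<longleftrightarrow> x = 0"
  by (cases x) (simp_all add: ennreal_powr_ennreal)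

lemma ennreal_powr_measurable [measurable]:
  "f \<in> borel_measurable M \<Longrightarrow> (\<lambda>x. ennreal_powr (f x) r) \<in> borel_measurable M"
proof -
  have "(\<lambda>x::ennreal. ennreal_powr x r) \<in> borel_measurable borel"
    unfolding ennreal_powr_def by (intro measurable_If) (auto simp: pred_def)
  then show "f \<in> borel_measurable M \<Longrightarrow> (\<lambda>x. ennreal_powr (f x) r) \<in> borel_measurable M"
    by (rule measurable_compose[rotated])
qed

lemma ennreal_powr_le_iff:
  assumes "r > 0" shows "ennreal_powr x r \<le> y \<longleftrightarrow> x \<le> ennreal_powr y (1 / r)"
proof
  assume "ennreal_powr x r \<le> y"
  then have "ennreal_powr (ennreal_powr x r) (1/r) \<le> ennreal_powr y (1/r)"
    using assms by (intro ennreal_powr_mono) auto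
  then show "x \<le> ennreal_powr y (1/r)" using assms by (simp add: ennreal_powr_powr)
next
  assume "x \<le> ennreal_powr y (1/r)"
  then have "ennreal_powr x r \<le> ennreal_powr (ennreal_powr y (1/r)) r"
    using assms by (intro ennreal_powr_mono) auto
  then show "ennreal_powr x r \<le> y" using assms by (simp add: ennreal_powr_powr)
qed

text \<open>The tangent line to \<open>x\<^sup>q\<close> at \<open>c\<close>, scaled by the weight \<open>w\<close>.\<close>

lemma powr_tangent_line:
  fixes x c q w :: real
  assumes "x \<ge> 0" "c > 0" "q \<ge> 1" "w > 0"
  shows "q * c powr (q - 1) * x \<le> x powr q * w powr (1 - q) + (q - 1) * c powr q * w"
proof (cases "x = 0")
  case True
  then show ?thesis using assms by simp
next
  case False
  then have "x > 0" using assms by simp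
  \<comment> \<open>Weighted arithmetic-geometric mean with weights 1/q and 1 - 1/q; the two
    summands are scaled so that the powers of \<open>w\<close> cancel in the product.\<close>
  have "(x powr q * w powr (1 - q)) powr (1/q) * (c powr q * w) powr (1 - 1/q)
     \<le> (1/q) * (x powr q * w powr (1 - q)) + (1 - 1/q) * (c powr q * w)"
    using assms \<open>x > 0\<close> by (intro Youngs_inequality_0) auto
  also have "(x powr q * w powr (1 - q)) powr (1/q) = x * w powr ((1 - q)/q)"
    using assms by (simp add: powr_mult powr_powr)
  also have "(c powr q * w) powr (1 - 1/q) = c powr (q - 1) * w powr (1 - 1/q)"
    using assms by (simp add: powr_mult powr_powr algebra_simps)
  also have "x * w powr ((1 - q)/q) * (c powr (q - 1) * w powr (1 - 1/q))
      = x * c powr (q - 1) * w powr ((1 - q)/q + (1 - 1/q))"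
    by (simp add: powr_add)
  also have "(1 - q)/q + (1 - 1/q) = 0" using assms by (simp add: field_simps)
  finally have "x * c powr (q - 1)
      \<le> (1/q) * (x powr q * w powr (1 - q)) + (1 - 1/q) * (c powr q * w)" using assms by simp
  then have "q * (x * c powr (q - 1))
      \<le> q * ((1/q) * (x powr q * w powr (1 - q)) + (1 - 1/q) * (c powr q * w))"
    using assms by (intro mult_left_mono) auto
  also have "\<dots> = x powr q * w powr (1 - q) + (q - 1) * c powr q * w"
    using assms by (simp add: field_simps)
  finally show ?thesis by (simp add: mult_ac)
qed

text \<open>Jensen's inequality for the power \<open>q\<close> and the measure with density \<open>A\<close>, applied to \<open>f / A\<close>.\<close>

lemma nn_integral_powr_le:
  fixes f A :: "'a \<Rightarrow> ennreal" and q :: real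
  assumes [measurable]: "f \<in> borel_measurable N" "A \<in> borel_measurable N" and q: "q \<ge> 1"
    and A0: "AE s in N. A s \<noteq> 0" and Afin: "(\<integral>\<^sup>+s. A s \<partial>N) \<noteq> top"
  shows "ennreal_powr (\<integral>\<^sup>+s. f s \<partial>N) q
    \<le> ennreal_powr (\<integral>\<^sup>+s. A s \<partial>N) (q - 1)
        * (\<integral>\<^sup>+s. ennreal_powr (f s) q * ennreal_powr (A s) (1 - q) \<partial>N)"
    (is "_ \<le> _ * ?R")
proof -
  obtain S where S: "(\<integral>\<^sup>+s. A s \<partial>N) = ennreal S" "S \<ge> 0"
    using Afin by (metis ennreal_cases)
  \<comment> \<open>Where \<open>A\<close> is neither 0 nor infinite, its power with the exponent
    \<open>1 - q\<close> is the ordinary real one; elsewhere \<open>ennreal_powr\<close> with such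
    an exponent has no analytic meaning.\<close>
  have AEfin: "AE s in N. A s \<noteq> top"
    using nn_integral_PInf_AE[of A N] Afin by simp
  \<comment> \<open>For fixed \<open>c\<close> the tangent line is linear in \<open>f\<close> and
    can be integrated. The choice of \<open>c\<close> is postponed until both integrals are known to
    be finite.\<close>
  have tangent: "ennreal (q * c powr (q - 1)) * (\<integral>\<^sup>+s. f s \<partial>N) \<le> ?R + ennreal ((q - 1) * c powr q * S)"
    if c: "c > 0" for c
  proof -
    have "ennreal (q * c powr (q - 1)) * (\<integral>\<^sup>+s. f s \<partial>N) = (\<integral>\<^sup>+s. ennreal (q * c powr (q - 1)) * f s \<partial>N)"
      by (simp add: nn_integral_cmult)
    also have "\<dots> \<le> (\<integral>\<^sup>+s. ennreal_powr (f s) q * ennreal_powr (A s) (1 - q) + ennreal ((q - 1) * c powr q) * A s \<partial>N)"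
    proof (intro nn_integral_mono_AE)
      show "AE s in N. ennreal (q * c powr (q - 1)) * f s
         \<le> ennreal_powr (f s) q * ennreal_powr (A s) (1 - q) + ennreal ((q - 1) * c powr q) * A s"
        using A0 AEfin
      proof eventually_elim
        case (elim s)
        obtain w where w: "A s = ennreal w" "w > 0"
          using elim by (metis ennreal_cases ennreal_eq_0_iff linorder_not_le)
        show ?case
        proof (cases "f s")
          case (real x)
          show ?thesis
            using powr_tangent_line[of x c q w] real w c q
            by (simp add: ennreal_powr_ennreal flip: ennreal_mult ennreal_plus)
        next
          case top
          have "ennreal_powr (A s) (1 - q) \<noteq> 0" using elim by (simp add: ennreal_powr_eq_0_iff)
          then show ?thesis using top by (simp add: ennreal_top_mult)
        qed
      qed
    qed
    also have "\<dots> = ?R + ennreal ((q - 1) * c powr q) * ennreal S"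
      by (subst nn_integral_add) (auto simp: nn_integral_cmult S)
    finally show ?thesis using S q c by (simp add: ennreal_mult)
  qed
  show ?thesis
  proof (cases "S = 0")
    case True
    \<comment> \<open>An almost everywhere nonzero density of mass 0 forces the measure itself to be
      null.\<close>
    then have "AE s in N. A s = 0" using S by (simp add: nn_integral_0_iff_AE)
    then have "AE s in N. False" using A0 by eventually_elim auto
    then have "(\<integral>\<^sup>+s. f s \<partial>N) = 0"
      by (subst nn_integral_0_iff_AE) (auto elim: eventually_mono)
    then show ?thesis by simp
  next
    case False
    then have S0: "S > 0" using S by simp
    show ?thesis
    proof (cases "\<integral>\<^sup>+s. f s \<partial>N")
      case top
      \<comment> \<open>Any fixed slope shows that an infinite integral of \<open>f\<close> makes
        the right-hand side infinite.\<close>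
      have "?R = top" using tangent[of 1] top q by (auto simp: ennreal_mult_top top_unique)
      then show ?thesis using S S0 by (simp add: ennreal_powr_ennreal ennreal_mult_top)
    next
      case (real I)
      show ?thesis
      proof (cases "I = 0")
        case True then show ?thesis using real by simp
      next
        case False
        then have I: "I > 0" using real by simp
        show ?thesis
        proof (cases ?R)
          case top
          then show ?thesis using S S0 by (simp add: ennreal_powr_ennreal ennreal_mult_top)
        next
          case R: (real R)
          \<comment> \<open>The mean of \<open>f / A\<close> with respect to \<open>A\<close>, where
            the tangent line must touch to give Jensen's inequality.\<close>
          define c where "c = I / S"
          have c: "c > 0" using I S0 by (simp add: c_def)
          have "ennreal (q * c powr (q - 1) * I) \<le> ennreal (R + (q - 1) * c powr q * S)"
            using tangent[OF c] real R q c S by (simp add: ennreal_mult ennreal_plus)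
          then have *: "q * c powr (q - 1) * I \<le> R + (q - 1) * c powr q * S"
            using R q c S by (subst (asm) ennreal_le_iff) auto
          have "c powr q * S = c powr (q - 1) * I"
            using c S0 I by (simp add: powr_diff c_def)
          then have "(q - 1) * c powr q * S = (q - 1) * (c powr (q - 1) * I)" by simp
          with * have "c powr (q - 1) * I \<le> R" by (simp add: algebra_simps)
          then have "S powr (q - 1) * (c powr (q - 1) * I) \<le> S powr (q - 1) * R"
            by (intro mult_left_mono) auto
          moreover have "S powr (q - 1) * (c powr (q - 1) * I) = I powr q"
            using S0 I by (simp add: c_def powr_divide powr_diff)
          ultimately show ?thesis using real R S S0
            by (simp add: ennreal_powr_ennreal flip: ennreal_mult)
        qed
      qed
    qed
  qed
qed

text \<open>Jensen's inequality is applied with the weight \<open>\<lambda>s. (\<integral> F(\<cdot>,s)\<^sup>q)\<^bsup>1/q\<^esup>\<close>, perturbed by a small positive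
  integrable function so that it does not vanish.\<close>

lemma minkowski_nn_integral:
  fixes F :: "'a \<Rightarrow> 'b \<Rightarrow> ennreal" and q :: real
  assumes M: "sigma_finite_measure M" and N: "sigma_finite_measure N" and q: "q \<ge> 1"
    and F [measurable]: "case_prod F \<in> borel_measurable (M \<Otimes>\<^sub>M N)"
  shows "ennreal_powr (\<integral>\<^sup>+x. ennreal_powr (\<integral>\<^sup>+s. F x s \<partial>N) q \<partial>M) (1 / q)
    \<le> (\<integral>\<^sup>+s. ennreal_powr (\<integral>\<^sup>+x. ennreal_powr (F x s) q \<partial>M) (1 / q) \<partial>N)" (is "_ \<le> ?S")
proof -
  interpret M: sigma_finite_measure M by fact
  interpret N: sigma_finite_measure N by fact
  interpret P: pair_sigma_finite M N ..
  define A where "A s = ennreal_powr (\<integral>\<^sup>+x. ennreal_powr (F x s) q \<partial>M) (1 / q)" for s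
  have [measurable]: "(\<lambda>(s, x). F x s) \<in> borel_measurable (N \<Otimes>\<^sub>M M)"
    using F by (subst measurable_pair_swap_iff) (simp add: case_prod_beta')
  have [measurable]: "A \<in> borel_measurable N" unfolding A_def by measurable
  obtain b :: "'b \<Rightarrow> real" where b: "b \<in> borel_measurable N" "\<And>x. b x > 0" "integrable N b"
    using N.obtain_positive_integrable_function by (metis)
  note b(1)[measurable]
  obtain B where B: "(\<integral>\<^sup>+s. ennreal (b s) \<partial>N) = ennreal B" "B \<ge> 0"
    using b(2,3) by (metis ennreal_cases integrableD(2) less_imp_le nn_integral_cong real_norm_def
       abs_of_pos integrable_iff_bounded infinity_ennreal_def less_irrefl)
  show ?thesis
  proof (cases "?S = top")
    case True then show ?thesis by simp
  next
    case False
    have SA: "?S = (\<integral>\<^sup>+s. A s \<partial>N)" by (simp add: A_def)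
    show ?thesis
    proof (rule ennreal_le_epsilon)
      fix e :: real assume e: "e > 0"
      \<comment> \<open>The perturbation then adds \<open>d * B\<close>, which is at most
        \<open>e\<close>, to the total weight; the \<open>+ 1\<close> covers
        \<open>B = 0\<close>.\<close>
      define d where "d = e / (B + 1)"
      have d: "d > 0" using e B by (simp add: d_def)
      define A' where "A' s = A s + ennreal (d * b s)" for s
      have [measurable]: "A' \<in> borel_measurable N" unfolding A'_def by measurable
      have IA': "(\<integral>\<^sup>+s. A' s \<partial>N) = ?S + ennreal (d * B)"
        unfolding A'_def SA using d b(2) B
        by (subst nn_integral_add) (auto simp: ennreal_mult less_imp_le nn_integral_cmult)
      have fin: "(\<integral>\<^sup>+s. A' s \<partial>N) \<noteq> top" unfolding IA' using False by simp
      have pos: "A' s \<noteq> 0" for s unfolding A'_def using d b(2)[of s] by (simp add: zero_less_mult_iff not_le)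
      have AEfin: "AE s in N. A' s \<noteq> top"
        using nn_integral_PInf_AE[of A' N] fin by simp
      let ?SS = "\<integral>\<^sup>+s. A' s \<partial>N"
      have "(\<integral>\<^sup>+x. ennreal_powr (\<integral>\<^sup>+s. F x s \<partial>N) q \<partial>M)
         \<le> (\<integral>\<^sup>+x. ennreal_powr ?SS (q - 1) * (\<integral>\<^sup>+s. ennreal_powr (F x s) q * ennreal_powr (A' s) (1 - q) \<partial>N) \<partial>M)"
        by (intro nn_integral_mono nn_integral_powr_le q fin) (auto simp: pos)
      also have "\<dots> = ennreal_powr ?SS (q - 1) * (\<integral>\<^sup>+x. (\<integral>\<^sup>+s. ennreal_powr (F x s) q * ennreal_powr (A' s) (1 - q) \<partial>N) \<partial>M)"
        by (simp add: nn_integral_cmult)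
      also have "(\<integral>\<^sup>+x. (\<integral>\<^sup>+s. ennreal_powr (F x s) q * ennreal_powr (A' s) (1 - q) \<partial>N) \<partial>M)
          = (\<integral>\<^sup>+s. (\<integral>\<^sup>+x. ennreal_powr (F x s) q * ennreal_powr (A' s) (1 - q) \<partial>M) \<partial>N)"
        by (subst P.Fubini') auto
      also have "\<dots> = (\<integral>\<^sup>+s. (\<integral>\<^sup>+x. ennreal_powr (F x s) q \<partial>M) * ennreal_powr (A' s) (1 - q) \<partial>N)"
        by (intro nn_integral_cong nn_integral_multc) measurable
      \<comment> \<open>The choice of the weight pays off here: the inner integral over
        \<open>x\<close> equals \<open>A s\<close> to the power \<open>q\<close>, so the integrand
        is at most A'^q A'^(1 - q) = A'.\<close>
      also have "\<dots> \<le> (\<integral>\<^sup>+s. A' s \<partial>N)"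
      proof (intro nn_integral_mono_AE, use AEfin in eventually_elim)
        fix s assume fin': "A' s \<noteq> top"
        obtain w where w: "A' s = ennreal w" "w > 0"
          using pos[of s] fin' by (metis ennreal_cases ennreal_eq_0_iff linorder_not_le)
        have "(\<integral>\<^sup>+x. ennreal_powr (F x s) q \<partial>M) = ennreal_powr (A s) q"
          using q by (simp add: A_def ennreal_powr_powr)
        also have "\<dots> \<le> ennreal_powr (A' s) q"
          using q by (intro ennreal_powr_mono) (auto simp: A'_def)
        finally have "(\<integral>\<^sup>+x. ennreal_powr (F x s) q \<partial>M) * ennreal_powr (A' s) (1 - q)
           \<le> ennreal_powr (A' s) q * ennreal_powr (A' s) (1 - q)"
          by (rule mult_right_mono) simp
        also have "\<dots> = A' s"
          using w by (simp add: ennreal_powr_ennreal flip: ennreal_mult powr_add)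
        finally show "(\<integral>\<^sup>+x. ennreal_powr (F x s) q \<partial>M) * ennreal_powr (A' s) (1 - q) \<le> A' s" .
      qed
      finally have "(\<integral>\<^sup>+x. ennreal_powr (\<integral>\<^sup>+s. F x s \<partial>N) q \<partial>M) \<le> ennreal_powr ?SS (q - 1) * ?SS"
        by (simp add: mult_left_mono)
      also have "\<dots> = ennreal_powr ?SS q"
      proof (cases ?SS)
        case (real r)
        then show ?thesis by (cases "r = 0") (simp_all add: ennreal_powr_ennreal powr_diff flip: ennreal_mult)
      qed (use fin in simp)
      finally have "ennreal_powr (\<integral>\<^sup>+x. ennreal_powr (\<integral>\<^sup>+s. F x s \<partial>N) q \<partial>M) (1/q) \<le> ?SS"
        using q by (subst ennreal_powr_le_iff) auto
      also have "\<dots> \<le> ?S + ennreal e"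
      proof -
        have "d * B \<le> d * (B + 1)" using d by simp
        also have "\<dots> = e" using B by (simp add: d_def)
        finally show ?thesis unfolding IA' by (intro add_left_mono ennreal_leI)
      qed
      finally show "ennreal_powr (\<integral>\<^sup>+x. ennreal_powr (\<integral>\<^sup>+s. F x s \<partial>N) q \<partial>M) (1/q) \<le> ?S + ennreal e" .
    qed
  qed
qed

section \<open>Mixed norms and Hardy's inequality\<close>

definition lp_ennnorm :: "ennreal \<Rightarrow> (int \<Rightarrow> ennreal) \<Rightarrow> ennreal" where
  "lp_ennnorm p g =
     (if p = \<infinity> then (SUP n. g n)
      else ennreal_powr (\<integral>\<^sup>+ n. ennreal_powr (g n) (enn2real p) \<partial>count_space UNIV) (1 / enn2real p))"

lemma lp_norm_eq_lp_ennnorm: "lp_norm p g = lp_ennnorm p (\<lambda>n. ennreal \<bar>g n\<bar>)"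
  by (simp add: lp_norm_def lp_ennnorm_def ennreal_powr_ennreal)

lemma enn2real_ge_1: "1 \<le> p \<Longrightarrow> p \<noteq> \<infinity> \<Longrightarrow> 1 \<le> enn2real p"
  by (cases p) auto

lemma lp_ennnorm_mono:
  assumes "\<And>n. f n \<le> g n" shows "lp_ennnorm p f \<le> lp_ennnorm p g"
  unfolding lp_ennnorm_def
  by (auto intro!: SUP_mono' ennreal_powr_mono nn_integral_mono assms)

lemma lp_ennnorm_cmult:
  assumes "1 \<le> p" shows "lp_ennnorm p (\<lambda>n. c * g n) = c * lp_ennnorm p g"
proof (cases "p = \<infinity>")
  case True then show ?thesis by (simp add: lp_ennnorm_def SUP_mult_left_ennreal)
next
  case False
  then show ?thesis using enn2real_ge_1[OF assms False]
    by (simp add: lp_ennnorm_def ennreal_powr_mult nn_integral_cmult ennreal_powr_powr)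
qed

lemma lp_ennnorm_shift: "lp_ennnorm p (\<lambda>n. g (n + c)) = lp_ennnorm p g"
proof -
  have b: "bij (\<lambda>n::int. n + c)" by (intro bij_betwI[where g="\<lambda>n. n - c"]) auto
  have "(SUP n. g (n + c)) = (SUP n. g n)"
    using bij_is_surj[OF b] by (metis image_image)
  then show ?thesis
    unfolding lp_ennnorm_def
    using nn_integral_bij_count_space[OF b, of "\<lambda>n. ennreal_powr (g n) (enn2real p)"] by simp
qed

lemma lp_norm_shift: "lp_norm p (\<lambda>n. g (n + c)) = lp_norm p g"
  unfolding lp_norm_eq_lp_ennnorm by (rule lp_ennnorm_shift)

lemma lp_norm_minus: "lp_norm p (\<lambda>n. - g n) = lp_norm p g"
  by (simp add: lp_norm_def)

lemma lp_norm_cmult: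
  assumes "1 \<le> p" shows "lp_norm p (\<lambda>n. c * g n) = ennreal \<bar>c\<bar> * lp_norm p g"
  unfolding lp_norm_eq_lp_ennnorm using assms
  by (simp add: abs_mult ennreal_mult lp_ennnorm_cmult)

lemma measurable_lp_ennnorm:
  assumes [measurable]: "\<And>n. (\<lambda>s. F s n) \<in> borel_measurable N"
  shows "(\<lambda>s. lp_ennnorm p (F s)) \<in> borel_measurable N"
proof (cases "p = \<infinity>")
  case True then show ?thesis by (simp add: lp_ennnorm_def)
next
  case False
  have "(\<lambda>s. \<integral>\<^sup>+ n. ennreal_powr (F s n) (enn2real p) \<partial>count_space UNIV) \<in> borel_measurable N"
    by (intro sigma_finite_measure.borel_measurable_nn_integral sigma_finite_measure_count_space)
       (auto intro!: measurable_pair_swap_iff[THEN iffD2] measurable_pair_measure_countable1 simp: case_prod_beta')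
  then show ?thesis using False by (simp add: lp_ennnorm_def)
qed

text \<open>Minkowski's inequality with counting measure outside; for infinite \<open>p\<close> it
  says that a supremum of integrals is at most the integral of the supremum.\<close>

lemma lp_ennnorm_nn_integral_le:
  assumes N: "sigma_finite_measure N" and p: "1 \<le> p"
    and [measurable]: "\<And>n. (\<lambda>s. F n s) \<in> borel_measurable N"
  shows "lp_ennnorm p (\<lambda>n. \<integral>\<^sup>+s. F n s \<partial>N) \<le> (\<integral>\<^sup>+s. lp_ennnorm p (\<lambda>n. F n s) \<partial>N)"
proof (cases "p = \<infinity>")
  case True then show ?thesis
    by (auto simp: lp_ennnorm_def intro!: SUP_least nn_integral_mono SUP_upper)
next
  case False
  have "case_prod F \<in> borel_measurable (count_space UNIV \<Otimes>\<^sub>M N)"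
    by (intro measurable_pair_measure_countable1) auto
  from minkowski_nn_integral[OF sigma_finite_measure_count_space N enn2real_ge_1[OF p False] this]
  show ?thesis using False by (simp add: lp_ennnorm_def)
qed

text \<open>A convolution is a superposition of translates of \<open>g\<close>, all of the same
  norm, so Minkowski's inequality with the counting measure gives Young's inequality for an l^1
  kernel.\<close>

lemma young_lp_ennnorm:
  assumes "1 \<le> p"
  shows "lp_ennnorm p (\<lambda>n. \<integral>\<^sup>+j. k j * g (n - j) \<partial>count_space UNIV)
    \<le> (\<integral>\<^sup>+j. k j \<partial>count_space UNIV) * lp_ennnorm p g"
proof -
  have "lp_ennnorm p (\<lambda>n. \<integral>\<^sup>+j. k j * g (n - j) \<partial>count_space UNIV)
     \<le> (\<integral>\<^sup>+j. lp_ennnorm p (\<lambda>n. k j * g (n - j)) \<partial>count_space UNIV)"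
    by (intro lp_ennnorm_nn_integral_le sigma_finite_measure_count_space assms) auto
  also have "\<dots> = (\<integral>\<^sup>+j. k j * lp_ennnorm p g \<partial>count_space UNIV)"
    using lp_ennnorm_shift[of p g "- j" for j]
    by (intro nn_integral_cong) (simp add: lp_ennnorm_cmult assms)
  finally show ?thesis by (simp add: nn_integral_multc)
qed

text \<open>The outer half of \<open>mixed_norm\<close>: the norm of L^q of the half-line for dt/t,
  the invariant measure of the multiplicative group.\<close>

definition time_norm :: "ennreal \<Rightarrow> (real \<Rightarrow> ennreal) \<Rightarrow> ennreal" where
  "time_norm q h =
     (if q = \<infinity> then esssup (restrict_space lborel {0<..}) h
      else ennreal_powr (\<integral>\<^sup>+ t \<in> {0<..}. ennreal_powr (h t) (enn2real q) * ennreal (1 / t) \<partial>lborel)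
             (1 / enn2real q))"

lemma mixed_norm_eq_time_norm: "mixed_norm p q F = time_norm q (\<lambda>t. lp_norm p (F t))"
  by (simp add: mixed_norm_def time_norm_def)

abbreviation halfline :: "real measure" where "halfline \<equiv> restrict_space borel {0<..}"

lemma measurable_halfline_iff:
  fixes h :: "real \<Rightarrow> ennreal"
  shows "h \<in> borel_measurable (restrict_space lborel {0<..}) \<longleftrightarrow> h \<in> borel_measurable halfline"
  by (intro arg_cong[where f="\<lambda>S. h \<in> S"] measurable_cong_sets sets_restrict_space_cong) auto

lemma measurable_halfline_indicator:
  fixes h :: "real \<Rightarrow> ennreal"
  shows "h \<in> borel_measurable halfline \<longleftrightarrow> (\<lambda>t. h t * indicator {0<..} t) \<in> borel_measurable borel"
  by (intro borel_measurable_restrict_space_iff_ennreal) auto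

lemma AE_halfline_iff: "(AE t in restrict_space lborel {0<..}. P t) \<longleftrightarrow> (AE t in lborel. t > 0 \<longrightarrow> P (t::real))"
  by (subst AE_restrict_space_iff) auto

text \<open>The smaller function has to be measurable because \<open>esssup\<close> of a
  non-measurable function is \<open>top\<close>.\<close>

lemma time_norm_mono:
  assumes "f \<in> borel_measurable halfline" "\<And>t. t > 0 \<Longrightarrow> f t \<le> g t"
  shows "time_norm q f \<le> time_norm q g"
proof (cases "q = \<infinity>")
  case True
  then show ?thesis using assms
    by (auto simp: time_norm_def AE_halfline_iff measurable_halfline_iff intro!: esssup_AE_mono)
next
  case False
  have "ennreal_powr (f t) (enn2real q) * ennreal (1 / t) * indicator {0<..} t
     \<le> ennreal_powr (g t) (enn2real q) * ennreal (1 / t) * indicator {0<..} t" for t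
    using assms(2)[of t] by (cases "t > 0") (auto intro!: ennreal_powr_mono mult_right_mono)
  then show ?thesis using False
    by (auto simp: time_norm_def intro!: ennreal_powr_mono nn_integral_mono)
qed

lemma time_norm_cmult_le:
  assumes "c > 0" "1 \<le> q" "h \<in> borel_measurable halfline"
  shows "time_norm q (\<lambda>t. ennreal c * h t) \<le> ennreal c * time_norm q h"
proof (cases "q = \<infinity>")
  case True
  have "AE t in restrict_space lborel {0<..}. h t \<le> esssup (restrict_space lborel {0<..}) h"
    by (rule esssup_AE)
  then have "AE t in restrict_space lborel {0<..}. ennreal c * h t \<le> ennreal c * esssup (restrict_space lborel {0<..}) h"
    by eventually_elim (rule mult_left_mono, auto)
  then show ?thesis using True assms
    by (auto simp: time_norm_def measurable_halfline_iff intro!: esssup_I)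
next
  case False
  define r where "r = enn2real q"
  have r: "r \<ge> 1" using False assms enn2real_ge_1 by (auto simp: r_def)
  have [measurable]: "(\<lambda>t. h t * indicator {0<..} t) \<in> borel_measurable borel"
    using assms(3) by (simp add: measurable_halfline_indicator)
  have "(\<integral>\<^sup>+ t \<in> {0<..}. ennreal_powr (ennreal c * h t) r * ennreal (1 / t) \<partial>lborel)
     = (\<integral>\<^sup>+ t. ennreal_powr (ennreal c) r * (ennreal_powr (h t * indicator {0<..} t) r * ennreal (1 / t)) \<partial>lborel)"
    by (intro nn_integral_cong) (auto simp: ennreal_powr_mult[of _ "h _"] mult_ac split: split_indicator)
  also have "\<dots> = ennreal_powr (ennreal c) r * (\<integral>\<^sup>+ t. ennreal_powr (h t * indicator {0<..} t) r * ennreal (1 / t) \<partial>lborel)"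
    by (intro nn_integral_cmult) measurable
  also have "(\<integral>\<^sup>+ t. ennreal_powr (h t * indicator {0<..} t) r * ennreal (1 / t) \<partial>lborel)
     = (\<integral>\<^sup>+ t \<in> {0<..}. ennreal_powr (h t) r * ennreal (1 / t) \<partial>lborel)"
    by (intro nn_integral_cong) (auto split: split_indicator)
  finally show ?thesis using False r by (simp add: time_norm_def r_def ennreal_powr_mult ennreal_powr_powr)
qed

text \<open>Substitution: dt/t is dilation invariant, and for infinite \<open>q\<close> dilations
  preserve null sets.\<close>

lemma time_norm_dilate_le:
  assumes c: "c > 0" and h: "h \<in> borel_measurable halfline"
  shows "time_norm q (\<lambda>t. h (c * t)) \<le> time_norm q h"
proof -
  have hm [measurable]: "(\<lambda>t. h t * indicator {0<..} t) \<in> borel_measurable borel"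
    using h by (simp add: measurable_halfline_indicator)
  have "(\<lambda>t. h (c * t) * indicator {0<..} (c * t)) \<in> borel_measurable borel"
    by (rule measurable_compose[OF _ hm]) measurable
  also have "(\<lambda>t. h (c * t) * indicator {0<..} (c * t)) = (\<lambda>t. h (c * t) * indicator {0<..} t)"
    using c by (auto simp: fun_eq_iff zero_less_mult_iff split: split_indicator)
  finally have hc: "(\<lambda>t. h (c * t)) \<in> borel_measurable halfline"
    by (simp add: measurable_halfline_indicator)
  show ?thesis
  proof (cases "q = \<infinity>")
    case True
    define E where "E = esssup (restrict_space lborel {0<..}) h"
    have "AE t in restrict_space lborel {0<..}. h t \<le> E"
      unfolding E_def by (rule esssup_AE)
    then have "AE t in lborel. h t * indicator {0<..} t \<le> E"
      unfolding AE_halfline_iff by eventually_elim (auto split: split_indicator)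
    then have "AE t in lborel. h (0 + c * t) * indicator {0<..} (0 + c * t) \<le> E"
      using c by (intro AE_borel_affine) auto
    then have "AE t in restrict_space lborel {0<..}. h (c * t) \<le> E"
      unfolding AE_halfline_iff by eventually_elim (auto dest: mult_pos_pos[OF c] split: split_indicator_asm)
    then show ?thesis using True hc
      by (auto simp: time_norm_def measurable_halfline_iff E_def intro!: esssup_I)
  next
    case False
    define r where "r = enn2real q"
    have "(\<integral>\<^sup>+ t \<in> {0<..}. ennreal_powr (h t) r * ennreal (1 / t) \<partial>lborel)
      = (\<integral>\<^sup>+ t. ennreal_powr (h t * indicator {0<..} t) r * ennreal (1 / t) \<partial>lborel)"
      by (intro nn_integral_cong) (auto split: split_indicator)
    also have "\<dots> = ennreal \<bar>c\<bar> * (\<integral>\<^sup>+ t. ennreal_powr (h (0 + c * t) * indicator {0<..} (0 + c * t)) r * ennreal (1 / (0 + c * t)) \<partial>lborel)"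
      using c by (intro nn_integral_real_affine) auto
    also have "\<dots> = (\<integral>\<^sup>+ t. ennreal \<bar>c\<bar> * (ennreal_powr (h (0 + c * t) * indicator {0<..} (0 + c * t)) r * ennreal (1 / (0 + c * t))) \<partial>lborel)"
    proof (rule nn_integral_cmult[symmetric])
      have "(\<lambda>t. h (0 + c * t) * indicator {0<..} (0 + c * t)) \<in> borel_measurable borel"
        by (rule measurable_compose[OF _ hm]) measurable
      then show "(\<lambda>t. ennreal_powr (h (0 + c * t) * indicator {0<..} (0 + c * t)) r * ennreal (1 / (0 + c * t))) \<in> borel_measurable lborel"
        by measurable
    qed
    also have "\<dots> = (\<integral>\<^sup>+ t \<in> {0<..}. ennreal_powr (h (c * t)) r * ennreal (1 / t) \<partial>lborel)"
    proof (intro nn_integral_cong)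
      fix t :: real
      have "ennreal c * ennreal (1 / (c * t)) = ennreal (1 / t)" if "t > 0"
        using c that by (subst ennreal_mult[symmetric]) auto
      then show "ennreal \<bar>c\<bar> * (ennreal_powr (h (0 + c * t) * indicator {0<..} (0 + c * t)) r * ennreal (1 / (0 + c * t)))
         = ennreal_powr (h (c * t)) r * ennreal (1 / t) * indicator {0<..} t"
        using c by (cases "t > 0")
          (auto simp: zero_less_mult_iff mult.left_commute[of "ennreal c"] mult.commute)
    qed
    finally show ?thesis using False by (simp add: time_norm_def r_def)
  qed
qed

section \<open>Hardy's inequality for the measure dt/t\<close>

lemma nn_integral_powr_to_inf:
  assumes "t > 0" "b > (0::real)"
  shows "(\<integral>\<^sup>+s\<in>{t..}. ennreal (s powr (- b - 1)) \<partial>lborel) = ennreal (t powr (- b) / b)"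
proof -
  have "((\<lambda>x. x powr (- b - 1)) has_integral -(t powr ((- b - 1) + 1)) / ((- b - 1) + 1)) {t..}"
    using assms by (intro has_integral_powr_to_inf) auto
  then show ?thesis using nn_integral_has_integral_lebesgue'[of "{t..}" "\<lambda>x. x powr (- b - 1)"]
    by simp
qed

lemma nn_integral_powr_from_0:
  assumes "c > 0" "b > (0::real)"
  shows "(\<integral>\<^sup>+s\<in>{0..c}. ennreal (s powr (b - 1)) \<partial>lborel) = ennreal (c powr b / b)"
proof -
  have "((\<lambda>x. x powr (b - 1)) has_integral (c powr ((b - 1) + 1)) / ((b - 1) + 1)) {0..c}"
    using assms by (intro has_integral_powr_from_0) auto
  then show ?thesis using nn_integral_has_integral_lebesgue'[of "{0..c}" "\<lambda>x. x powr (b - 1)"]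
    by simp
qed

text \<open>Hardy's inequality; for finite \<open>q\<close> it follows from Jensen's inequality with respect to the
  weight \<open>s powr (- b - 1)\<close> on \<open>{t..}\<close>, and Tonelli.\<close>

lemma hardy_time_norm:
  fixes b :: real and H :: "real \<Rightarrow> ennreal"
  assumes b: "b > 0" and q: "1 \<le> q" and H: "H \<in> borel_measurable halfline"
  shows "time_norm q (\<lambda>t. ennreal (t powr b) * (\<integral>\<^sup>+s\<in>{t..}. H s * ennreal (1 / s) \<partial>lborel))
    \<le> ennreal (1 / b) * time_norm q (\<lambda>t. ennreal (t powr b) * H t)"
proof -
  \<comment> \<open>Cut off to the half-line, \<open>H\<close> becomes Borel on the whole line,
    which Tonelli's theorem for Lebesgue measure on pairs requires.\<close>
  define h where "h = (\<lambda>s. H s * indicator {0<..} s)"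
  have [measurable]: "h \<in> borel_measurable borel"
    using H by (simp add: h_def measurable_halfline_indicator)
  have hH: "(\<integral>\<^sup>+s\<in>{t..}. H s * ennreal (1 / s) \<partial>lborel) = (\<integral>\<^sup>+s\<in>{t..}. h s * ennreal (1 / s) \<partial>lborel)"
    if "t > 0" for t
    using that by (intro nn_integral_cong) (auto simp: h_def split: split_indicator)
  have Im [measurable]: "(\<lambda>t. \<integral>\<^sup>+s\<in>{t..}. h s * ennreal (1 / s) \<partial>lborel) \<in> borel_measurable borel"
  proof -
    have "(\<lambda>t. \<integral>\<^sup>+s. h s * ennreal (1 / s) * indicator {(t::real, s::real). t \<le> s} (t, s) \<partial>lborel) \<in> borel_measurable borel"
      by measurable
    then show ?thesis by (simp add: indicator_def)
  qed
  have lhs_m: "(\<lambda>t. ennreal (t powr b) * (\<integral>\<^sup>+s\<in>{t..}. H s * ennreal (1 / s) \<partial>lborel)) \<in> borel_measurable halfline"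
  proof -
    have "(\<lambda>t. ennreal (t powr b) * (\<integral>\<^sup>+s\<in>{t..}. h s * ennreal (1 / s) \<partial>lborel)) \<in> borel_measurable halfline"
      by (intro measurable_restrict_space1) measurable
    then show ?thesis
      by (rule measurable_cong[THEN iffD2, rotated]) (auto simp: hH)
  qed
  show ?thesis
  proof (cases "q = \<infinity>")
    case True
    define E where "E = esssup (restrict_space lborel {0<..}) (\<lambda>t. ennreal (t powr b) * H t)"
    have "AE s in restrict_space lborel {0<..}. ennreal (s powr b) * H s \<le> E"
      unfolding E_def by (rule esssup_AE)
    then have AE: "AE s in lborel. s > 0 \<longrightarrow> ennreal (s powr b) * H s \<le> E"
      by (simp add: AE_halfline_iff)
    have "ennreal (t powr b) * (\<integral>\<^sup>+s\<in>{t..}. H s * ennreal (1 / s) \<partial>lborel) \<le> ennreal (1 / b) * E" if t: "t > 0" for t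
    proof -
      \<comment> \<open>Insert H(s) <= E s^(-b); the remaining integral of s^(-b - 1) over
        \<open>{t..}\<close> is t^(-b) / b.\<close>
      have "(\<integral>\<^sup>+s\<in>{t..}. H s * ennreal (1 / s) \<partial>lborel)
         \<le> (\<integral>\<^sup>+s. E * (ennreal (s powr (- b - 1)) * indicator {t..} s) \<partial>lborel)"
      proof (intro nn_integral_mono_AE, use AE in eventually_elim)
        fix s assume *: "s > 0 \<longrightarrow> ennreal (s powr b) * H s \<le> E"
        show "H s * ennreal (1 / s) * indicator {t..} s \<le> E * (ennreal (s powr (- b - 1)) * indicator {t..} s)"
        proof (cases "s \<ge> t")
          case True
          then have s: "s > 0" using t by simp
          have "H s * ennreal (1 / s) = (ennreal (s powr b) * H s) * ennreal (s powr (- b - 1))"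
          proof -
            have "ennreal (s powr b) * ennreal (s powr (- b - 1)) = ennreal (1 / s)"
              using s by (simp add: powr_minus_divide flip: ennreal_mult powr_add)
            then show ?thesis by (metis mult.assoc mult.commute)
          qed
          also have "\<dots> \<le> E * ennreal (s powr (- b - 1))" using * s by (intro mult_right_mono) auto
          finally show ?thesis using True by simp
        qed simp
      qed
      also have "\<dots> = E * ennreal (t powr (- b) / b)"
        by (subst nn_integral_cmult) (auto simp: nn_integral_powr_to_inf t b)
      finally have "ennreal (t powr b) * (\<integral>\<^sup>+s\<in>{t..}. H s * ennreal (1 / s) \<partial>lborel)
         \<le> ennreal (t powr b) * (E * ennreal (t powr (- b) / b))" by (rule mult_left_mono) simp
      also have "\<dots> = E * (ennreal (t powr b) * ennreal (t powr (- b) / b))" by (simp add: mult_ac)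
      also have "ennreal (t powr b) * ennreal (t powr (- b) / b) = ennreal (1 / b)"
        using t b by (simp add: powr_minus_divide flip: ennreal_mult)
      finally show ?thesis by (simp add: mult.commute)
    qed
    then show ?thesis using True lhs_m
      by (auto simp: time_norm_def measurable_halfline_iff E_def AE_halfline_iff intro!: esssup_I)
  next
    case False
    define r where "r = enn2real q"
    have r: "r \<ge> 1" using False q enn2real_ge_1 by (auto simp: r_def)
    \<comment> \<open>The part of the Jensen factor (t^(-b) / b)^(r - 1) that does not depend on
      \<open>t\<close>.\<close>
    define k where "k = ennreal (b powr (1 - r))"
    have pointwise: "ennreal_powr (ennreal (t powr b) * (\<integral>\<^sup>+s\<in>{t..}. H s * ennreal (1 / s) \<partial>lborel)) r * ennreal (1 / t)
      \<le> (\<integral>\<^sup>+s. k * ennreal (t powr (b - 1)) * (ennreal_powr (h s) r * ennreal (s powr (b * (r - 1) - 1)) * indicator {t..} s) \<partial>lborel)"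
      if t: "t > 0" for t
    proof -
      let ?N = "restrict_space lborel {t..}"
      have sets: "sets ?N = sets (restrict_space borel {t..})" by (intro sets_restrict_space_cong) auto
      have "ennreal_powr (\<integral>\<^sup>+s. h s * ennreal (1 / s) \<partial>?N) r
         \<le> ennreal_powr (\<integral>\<^sup>+s. ennreal (s powr (- b - 1)) \<partial>?N) (r - 1)
            * (\<integral>\<^sup>+s. ennreal_powr (h s * ennreal (1 / s)) r * ennreal_powr (ennreal (s powr (- b - 1))) (1 - r) \<partial>?N)"
      proof (rule nn_integral_powr_le)
        show "(\<lambda>s. h s * ennreal (1 / s)) \<in> borel_measurable ?N"
          by (intro measurable_restrict_space1) measurable
        show "(\<lambda>s. ennreal (s powr (- b - 1))) \<in> borel_measurable ?N"
          by (intro measurable_restrict_space1) measurable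
        show "AE s in ?N. ennreal (s powr (- b - 1)) \<noteq> 0"
          using t by (subst AE_restrict_space_iff) auto
        show "(\<integral>\<^sup>+s. ennreal (s powr (- b - 1)) \<partial>?N) \<noteq> top"
          by (simp add: nn_integral_restrict_space nn_integral_powr_to_inf[OF t b])
      qed (rule r)
      also have "(\<integral>\<^sup>+s. ennreal (s powr (- b - 1)) \<partial>?N) = ennreal (t powr (- b) / b)"
        by (simp add: nn_integral_restrict_space nn_integral_powr_to_inf[OF t b])
      also have "(\<integral>\<^sup>+s. ennreal_powr (h s * ennreal (1 / s)) r * ennreal_powr (ennreal (s powr (- b - 1))) (1 - r) \<partial>?N)
         = (\<integral>\<^sup>+s. ennreal_powr (h s) r * ennreal (s powr (b * (r - 1) - 1)) * indicator {t..} s \<partial>lborel)"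
      proof (subst nn_integral_restrict_space, simp, intro nn_integral_cong)
        fix s :: real
        have "ennreal_powr (h s * ennreal (1 / s)) r * ennreal_powr (ennreal (s powr (- b - 1))) (1 - r)
           = ennreal_powr (h s) r * ennreal (s powr (b * (r - 1) - 1))" if "s \<ge> t"
        proof -
          have s: "s > 0" using that t by simp
          have "(1 / s) powr r * (s powr (- b - 1)) powr (1 - r) = s powr (- r + (- b - 1) * (1 - r))"
            unfolding powr_add using s by (simp add: powr_powr powr_minus_divide powr_divide)
          also have "- r + (- b - 1) * (1 - r) = b * (r - 1) - 1" by (simp add: algebra_simps)
          finally show ?thesis using s
            by (simp add: ennreal_powr_mult ennreal_powr_ennreal mult.assoc flip: ennreal_mult)
        qed
        then show "ennreal_powr (h s * ennreal (1 / s)) r * ennreal_powr (ennreal (s powr (- b - 1))) (1 - r) * indicator {t..} s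
           = ennreal_powr (h s) r * ennreal (s powr (b * (r - 1) - 1)) * indicator {t..} s"
          by (auto split: split_indicator)
      qed
      finally have *: "ennreal_powr (\<integral>\<^sup>+s. h s * ennreal (1 / s) \<partial>?N) r \<le> ennreal_powr (ennreal (t powr (- b) / b)) (r - 1)
         * (\<integral>\<^sup>+s. ennreal_powr (h s) r * ennreal (s powr (b * (r - 1) - 1)) * indicator {t..} s \<partial>lborel)"
         (is "_ \<le> _ * ?I") .
      have **: "(\<integral>\<^sup>+s\<in>{t..}. H s * ennreal (1 / s) \<partial>lborel) = (\<integral>\<^sup>+s. h s * ennreal (1 / s) \<partial>?N)"
        using hH[OF t] by (simp add: nn_integral_restrict_space)
      have "ennreal_powr (ennreal (t powr b) * (\<integral>\<^sup>+s\<in>{t..}. H s * ennreal (1 / s) \<partial>lborel)) r * ennreal (1 / t)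
        \<le> ennreal_powr (ennreal (t powr b)) r * (ennreal_powr (ennreal (t powr (- b) / b)) (r - 1) * ?I) * ennreal (1 / t)"
        unfolding ** ennreal_powr_mult by (intro mult_left_mono mult_right_mono *) auto
      also have "\<dots> = (ennreal_powr (ennreal (t powr b)) r * ennreal_powr (ennreal (t powr (- b) / b)) (r - 1) * ennreal (1 / t)) * ?I"
        by (simp add: mult_ac)
      also have "ennreal_powr (ennreal (t powr b)) r * ennreal_powr (ennreal (t powr (- b) / b)) (r - 1) * ennreal (1 / t)
         = k * ennreal (t powr (b - 1))"
      proof -
        have "(t powr b) powr r * (t powr (- b) / b) powr (r - 1) * (1 / t)
          = (t powr (b * r) * t powr ((- b) * (r - 1)) * t powr (- 1)) * b powr (1 - r)"
        proof -
          have "(t powr (- b) / b) powr (r - 1) = t powr ((- b) * (r - 1)) / b powr (r - 1)"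
            using t b by (simp add: powr_divide powr_powr)
          also have "\<dots> = t powr ((- b) * (r - 1)) * b powr (1 - r)"
            using powr_minus_divide[of b "r - 1"] by simp
          finally show ?thesis using t by (simp add: powr_powr powr_minus_divide)
        qed
        also have "t powr (b * r) * t powr ((- b) * (r - 1)) * t powr (- 1) = t powr (b - 1)"
          unfolding powr_add[symmetric] by (simp add: algebra_simps)
        finally show ?thesis using t b
          by (simp add: k_def ennreal_powr_ennreal mult.commute flip: ennreal_mult)
      qed
      also have "k * ennreal (t powr (b - 1)) * ?I = (\<integral>\<^sup>+s. k * ennreal (t powr (b - 1)) * (ennreal_powr (h s) r * ennreal (s powr (b * (r - 1) - 1)) * indicator {t..} s) \<partial>lborel)"
        by (intro nn_integral_cmult[symmetric]) measurable
      finally show ?thesis .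
    qed
    \<comment> \<open>The condition t <= s becomes an indicator on pairs, which makes the integrand
      jointly measurable; the closed half-line matches the interval of
      \<open>nn_integral_powr_from_0\<close>.\<close>
    have "(\<integral>\<^sup>+ t \<in> {0<..}. ennreal_powr (ennreal (t powr b) * (\<integral>\<^sup>+s\<in>{t..}. H s * ennreal (1 / s) \<partial>lborel)) r * ennreal (1 / t) \<partial>lborel)
       \<le> (\<integral>\<^sup>+t. (\<integral>\<^sup>+s. (k * ennreal (t powr (b - 1)) * (ennreal_powr (h s) r * ennreal (s powr (b * (r - 1) - 1)) * indicator {(t::real, s::real). t \<le> s} (t, s))) * indicator {0..} t \<partial>lborel) \<partial>lborel)"
    proof (intro nn_integral_mono)
      fix t :: real
      show "ennreal_powr (ennreal (t powr b) * (\<integral>\<^sup>+s\<in>{t..}. H s * ennreal (1 / s) \<partial>lborel)) r * ennreal (1 / t) * indicator {0<..} t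
        \<le> (\<integral>\<^sup>+s. (k * ennreal (t powr (b - 1)) * (ennreal_powr (h s) r * ennreal (s powr (b * (r - 1) - 1)) * indicator {(t::real, s::real). t \<le> s} (t, s))) * indicator {0..} t \<partial>lborel)"
        using pointwise[of t] by (cases "t > 0") (auto simp: indicator_def)
    qed
    \<comment> \<open>After the exchange the inner integral of t^(b - 1) over \<open>{0..s}\<close>
      is s^b / b, and its 1/b turns \<open>k\<close> into b^(-r), the r-th power of the constant
      1/b.\<close>
    also have "\<dots> = (\<integral>\<^sup>+s. (\<integral>\<^sup>+t. (k * ennreal (t powr (b - 1)) * (ennreal_powr (h s) r * ennreal (s powr (b * (r - 1) - 1)) * indicator {(t::real, s::real). t \<le> s} (t, s))) * indicator {0..} t \<partial>lborel) \<partial>lborel)"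
      by (rule lborel_pair.Fubini') measurable
    also have "\<dots> = (\<integral>\<^sup>+s. ennreal_powr (ennreal (1 / b)) r * (ennreal_powr (ennreal (s powr b) * H s) r * ennreal (1 / s) * indicator {0<..} s) \<partial>lborel)"
    proof (intro nn_integral_cong)
      fix s :: real
      show "(\<integral>\<^sup>+t. (k * ennreal (t powr (b - 1)) * (ennreal_powr (h s) r * ennreal (s powr (b * (r - 1) - 1)) * indicator {(t::real, s::real). t \<le> s} (t, s))) * indicator {0..} t \<partial>lborel)
         = ennreal_powr (ennreal (1 / b)) r * (ennreal_powr (ennreal (s powr b) * H s) r * ennreal (1 / s) * indicator {0<..} s)"
      proof (cases "s > 0")
        case True
        have "(\<integral>\<^sup>+t. (k * ennreal (t powr (b - 1)) * (ennreal_powr (h s) r * ennreal (s powr (b * (r - 1) - 1)) * indicator {(t::real, s::real). t \<le> s} (t, s))) * indicator {0..} t \<partial>lborel)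
          = (\<integral>\<^sup>+t. (k * ennreal_powr (h s) r * ennreal (s powr (b * (r - 1) - 1))) * (ennreal (t powr (b - 1)) * indicator {0..s} t) \<partial>lborel)"
          by (intro nn_integral_cong) (auto simp: mult_ac split: split_indicator)
        also have "\<dots> = (k * ennreal_powr (h s) r * ennreal (s powr (b * (r - 1) - 1))) * ennreal (s powr b / b)"
          using True b by (subst nn_integral_cmult) (auto simp: nn_integral_powr_from_0)
        also have "\<dots> = ennreal_powr (h s) r * (k * ennreal (s powr (b * (r - 1) - 1)) * ennreal (s powr b / b))"
          by (simp add: mult_ac)
        also have "k * ennreal (s powr (b * (r - 1) - 1)) * ennreal (s powr b / b)
            = ennreal_powr (ennreal (1 / b)) r * ennreal_powr (ennreal (s powr b)) r * ennreal (1 / s)"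
        proof -
          have "b powr (1 - r) * s powr (b * (r - 1) - 1) * (s powr b / b)
            = (b powr (1 - r) * b powr (- 1)) * (s powr (b * (r - 1) - 1) * s powr b)"
            using True b by (simp add: powr_minus_divide)
          also have "\<dots> = b powr (- r) * s powr (b * r + (- 1))"
            unfolding powr_add[symmetric] by (simp add: algebra_simps)
          also have "\<dots> = (1 / b) powr r * (s powr b) powr r * (1 / s)"
            using True b unfolding powr_add by (simp add: powr_powr powr_divide powr_minus_divide)
          finally show ?thesis using True b
            by (simp add: k_def ennreal_powr_ennreal flip: ennreal_mult)
        qed
        finally show ?thesis using True by (simp add: h_def ennreal_powr_mult mult_ac)
      next
        case False
        then have "h s = 0" by (simp add: h_def)
        then show ?thesis using False by simp
      qed
    qed
    also have "\<dots> = ennreal_powr (ennreal (1 / b)) r * (\<integral>\<^sup>+s\<in>{0<..}. ennreal_powr (ennreal (s powr b) * H s) r * ennreal (1 / s) \<partial>lborel)"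
    proof (rule nn_integral_cmult)
      have "(\<lambda>s. ennreal_powr (ennreal (s powr b) * h s) r * ennreal (1 / s)) \<in> borel_measurable lborel" by measurable
      also have "(\<lambda>s. ennreal_powr (ennreal (s powr b) * h s) r * ennreal (1 / s)) = (\<lambda>s. ennreal_powr (ennreal (s powr b) * H s) r * ennreal (1 / s) * indicator {0<..} s)"
        by (auto simp: h_def fun_eq_iff split: split_indicator)
      finally show "(\<lambda>s. ennreal_powr (ennreal (s powr b) * H s) r * ennreal (1 / s) * indicator {0<..} s) \<in> borel_measurable lborel" .
    qed
    finally have "ennreal_powr (\<integral>\<^sup>+ t \<in> {0<..}. ennreal_powr (ennreal (t powr b) * (\<integral>\<^sup>+s\<in>{t..}. H s * ennreal (1 / s) \<partial>lborel)) r * ennreal (1 / t) \<partial>lborel) (1 / r)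
      \<le> ennreal_powr (ennreal_powr (ennreal (1 / b)) r * (\<integral>\<^sup>+s\<in>{0<..}. ennreal_powr (ennreal (s powr b) * H s) r * ennreal (1 / s) \<partial>lborel)) (1 / r)"
      using r by (intro ennreal_powr_mono) auto
    then show ?thesis using False r by (simp add: time_norm_def r_def ennreal_powr_mult ennreal_powr_powr)
  qed
qed

section \<open>From estimates at a fixed time to mixed norms\<close>

lemma lp_norm_measurable_halfline:
  assumes "\<And>n. continuous_on {0<..} (\<lambda>t. U t n)"
  shows "(\<lambda>t. lp_norm p (U t)) \<in> borel_measurable halfline"
  unfolding lp_norm_eq_lp_ennnorm
proof (rule measurable_lp_ennnorm)
  fix n
  have "(\<lambda>t. U t n) \<in> borel_measurable halfline"
    by (rule borel_measurable_continuous_on_restrict[OF assms])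
  then show "(\<lambda>t. ennreal \<bar>U t n\<bar>) \<in> borel_measurable halfline" by measurable
qed

lemma measurable_halfline_powr_mult:
  assumes "h \<in> borel_measurable halfline"
  shows "(\<lambda>t. ennreal (t powr b) * h t) \<in> borel_measurable halfline"
proof -
  have "(\<lambda>t. ennreal (t powr b)) \<in> borel_measurable halfline"
    by (intro measurable_restrict_space1) measurable
  then show ?thesis using assms by (rule borel_measurable_times_ennreal)
qed

lemma mixed_norm_powr_eq:
  assumes "1 \<le> p"
  shows "mixed_norm p q (\<lambda>t n. t powr b * U t n) = time_norm q (\<lambda>t. ennreal (t powr b) * lp_norm p (U t))"
  by (simp add: mixed_norm_eq_time_norm lp_norm_cmult assms)

text \<open>Evaluating \<open>U\<close> at t/2 is harmless by dilation invariance; rescaling the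
  power of \<open>t\<close> produces the power of 2. The parameter \<open>g\<close> is the power of
  \<open>t\<close> gained over 1/t: 1/2 for the heat kernel and 0 for the Poisson kernel.\<close>

lemma mixed_norm_le_of_halved_time:
  fixes V U :: "real \<Rightarrow> int \<Rightarrow> real"
  assumes pq: "1 \<le> p" "1 \<le> q" and C: "C > 0"
    and V: "\<And>n. continuous_on {0<..} (\<lambda>t. V t n)" and U: "\<And>n. continuous_on {0<..} (\<lambda>t. U t n)"
    and le: "\<And>t. t > 0 \<Longrightarrow> lp_norm p (V t) \<le> ennreal (C * t powr (g - 1)) * lp_norm p (U (t / 2))"
  shows "mixed_norm p q (\<lambda>t n. t powr b * V t n)
    \<le> ennreal (C * 2 powr (b + g - 1)) * mixed_norm p q (\<lambda>t n. t powr (b + g - 1) * U t n)"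
proof -
  define h where "h t = ennreal (t powr (b + g - 1)) * lp_norm p (U t)" for t
  have hm: "h \<in> borel_measurable halfline" unfolding h_def
    by (intro measurable_halfline_powr_mult lp_norm_measurable_halfline U)
  have "mixed_norm p q (\<lambda>t n. t powr b * V t n) = time_norm q (\<lambda>t. ennreal (t powr b) * lp_norm p (V t))"
    by (rule mixed_norm_powr_eq[OF pq(1)])
  also have "\<dots> \<le> time_norm q (\<lambda>t. ennreal (C * 2 powr (b + g - 1)) * h (1/2 * t))"
  proof (rule time_norm_mono)
    show "(\<lambda>t. ennreal (t powr b) * lp_norm p (V t)) \<in> borel_measurable halfline"
      by (intro measurable_halfline_powr_mult lp_norm_measurable_halfline V)
    fix t :: real assume t: "t > 0"
    have "ennreal (t powr b) * lp_norm p (V t) \<le> ennreal (t powr b) * (ennreal (C * t powr (g - 1)) * lp_norm p (U (t / 2)))"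
      by (intro mult_left_mono le t) simp
    also have "\<dots> = (ennreal (t powr b) * ennreal (C * t powr (g - 1))) * lp_norm p (U (t / 2))"
      by (simp add: mult_ac)
    also have "ennreal (t powr b) * ennreal (C * t powr (g - 1)) = ennreal (C * 2 powr (b + g - 1)) * ennreal ((1/2 * t) powr (b + g - 1))"
    proof -
      have "t powr b * (C * t powr (g - 1)) = C * t powr (b + g - 1)"
        using t by (simp add: powr_add[symmetric] algebra_simps)
      also have "\<dots> = C * 2 powr (b + g - 1) * (1/2 * t) powr (b + g - 1)"
        using t by (simp add: powr_divide)
      finally show ?thesis using C by (simp flip: ennreal_mult)
    qed
    finally show "ennreal (t powr b) * lp_norm p (V t) \<le> ennreal (C * 2 powr (b + g - 1)) * h (1/2 * t)"
      by (simp add: h_def mult_ac)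
  qed
  also have "\<dots> \<le> ennreal (C * 2 powr (b + g - 1)) * time_norm q (\<lambda>t. h (1/2 * t))"
  proof (rule time_norm_cmult_le)
    show "(\<lambda>t. h (1/2 * t)) \<in> borel_measurable halfline"
    proof -
      have "continuous_on {0<..} (\<lambda>t. U (1/2*t) n)" for n
        by (rule continuous_on_compose2[OF U[of n]]) (auto intro!: continuous_intros)
      then have "(\<lambda>t. lp_norm p (U (1/2 * t))) \<in> borel_measurable halfline"
        by (intro lp_norm_measurable_halfline)
      moreover have "(\<lambda>t. ennreal ((1/2 * t) powr (b + g - 1))) \<in> borel_measurable halfline"
        by (intro measurable_restrict_space1) measurable
      ultimately show ?thesis unfolding h_def by (rule borel_measurable_times_ennreal[rotated])
    qed
  qed (use C pq in auto)
  also have "\<dots> \<le> ennreal (C * 2 powr (b + g - 1)) * time_norm q h"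
    by (intro mult_left_mono time_norm_dilate_le hm) auto
  also have "time_norm q h = mixed_norm p q (\<lambda>t n. t powr (b + g - 1) * U t n)"
    unfolding mixed_norm_powr_eq[OF pq(1)] by (simp add: h_def [abs_def])
  finally show ?thesis .
qed

text \<open>The fundamental theorem on \<open>{t..T}\<close> with \<open>T\<close> tending to
  infinity. The limit is taken in the extended reals, so an infinite integral of the derivative is
  allowed.\<close>

lemma abs_le_nn_integral_deriv:
  fixes v v' :: "real \<Rightarrow> real"
  assumes v: "\<And>s. s \<ge> t \<Longrightarrow> (v has_real_derivative v' s) (at s)"
    and c: "continuous_on {t..} v'" and lim: "(v \<longlongrightarrow> 0) at_top"
  shows "ennreal \<bar>v t\<bar> \<le> (\<integral>\<^sup>+s\<in>{t..}. ennreal \<bar>v' s\<bar> \<partial>lborel)" (is "_ \<le> ?X")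
proof -
  have le: "ennreal \<bar>v t\<bar> \<le> ennreal \<bar>v T\<bar> + ?X" if T: "T \<ge> t" for T
  proof -
    have ftc: "(v' has_integral (v T - v t)) {t..T}"
      using T v by (intro fundamental_theorem_of_calculus)
        (auto simp: has_real_derivative_iff_has_vector_derivative[symmetric] intro: has_field_derivative_at_within)
    have cT: "continuous_on {t..T} v'" using c by (rule continuous_on_subset) auto
    then have int: "(\<lambda>s. \<bar>v' s\<bar>) integrable_on {t..T}"
      by (intro integrable_continuous_interval continuous_intros)
    have "\<bar>v T - v t\<bar> \<le> integral {t..T} (\<lambda>s. \<bar>v' s\<bar>)"
      using integral_norm_bound_integral[of v' "{t..T}" "\<lambda>s. \<bar>v' s\<bar>"] ftc int
      by (auto simp: integral_unique has_integral_integrable)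
    moreover have "ennreal (integral {t..T} (\<lambda>s. \<bar>v' s\<bar>)) = (\<integral>\<^sup>+s\<in>{t..T}. ennreal \<bar>v' s\<bar> \<partial>lborel)"
      using nn_integral_has_integral_lebesgue'[OF _ integrable_integral[OF int]] by simp
    moreover have "(\<integral>\<^sup>+s\<in>{t..T}. ennreal \<bar>v' s\<bar> \<partial>lborel) \<le> ?X"
      by (intro nn_integral_mono) (auto split: split_indicator)
    ultimately have "ennreal \<bar>v T - v t\<bar> \<le> ?X"
      by (metis ennreal_leI order_trans)
    moreover have "ennreal \<bar>v t\<bar> \<le> ennreal \<bar>v T\<bar> + ennreal \<bar>v T - v t\<bar>"
    proof -
      have "\<bar>v t\<bar> \<le> \<bar>v T\<bar> + \<bar>v T - v t\<bar>" by linarith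
      from ennreal_leI[OF this] show ?thesis by simp
    qed
    ultimately show ?thesis by (meson add_left_mono order_trans)
  qed
  have "((\<lambda>T. ennreal \<bar>v T\<bar> + ?X) \<longlongrightarrow> ennreal \<bar>0\<bar> + ?X) at_top"
    by (intro tendsto_add tendsto_const tendsto_ennrealI tendsto_rabs lim)
  moreover have "eventually (\<lambda>T. ennreal \<bar>v t\<bar> \<le> ennreal \<bar>v T\<bar> + ?X) at_top"
    using eventually_ge_at_top[of t] by eventually_elim (rule le)
  ultimately have "ennreal \<bar>v t\<bar> \<le> ennreal \<bar>0\<bar> + ?X"
    by (rule tendsto_lowerbound) simp
  then show ?thesis by simp
qed

text \<open>Hardy's inequality returns the factor \<open>t\<close> that differentiation costs: a
  bound on \<open>v'\<close> with the exponent g - 1 becomes a bound on \<open>v\<close> with the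
  exponent g. It is the source of the factor 1/b.\<close>

lemma mixed_norm_hardy:
  fixes v v' U :: "real \<Rightarrow> int \<Rightarrow> real"
  assumes pq: "1 \<le> p" "1 \<le> q" and C: "C > 0" and b: "b > 0"
    and v: "\<And>t n. t > 0 \<Longrightarrow> ((\<lambda>s. v s n) has_real_derivative v' t n) (at t)"
    and v': "\<And>n. continuous_on {0<..} (\<lambda>t. v' t n)"
    and lim: "\<And>n. ((\<lambda>t. v t n) \<longlongrightarrow> 0) at_top"
    and U: "\<And>n. continuous_on {0<..} (\<lambda>t. U t n)"
    and le: "\<And>t. t > 0 \<Longrightarrow> lp_norm p (v' t) \<le> ennreal (C * t powr (g - 1)) * lp_norm p (U (t / 2))"
  shows "mixed_norm p q (\<lambda>t n. t powr b * v t n)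
    \<le> ennreal (C * 2 powr (b + g) / b) * mixed_norm p q (\<lambda>t n. t powr (b + g) * U t n)"
proof -
  have vc: "continuous_on {0<..} (\<lambda>t. v t n)" for n
    using v by (intro continuous_at_imp_continuous_on) (auto intro: DERIV_isCont)
  \<comment> \<open>With the factor \<open>t\<close> included, \<open>H s\<close> ds/s is the norm
    of \<open>v'\<close> times ds, the form in which Hardy's inequality is stated.\<close>
  define H where "H t = lp_norm p (\<lambda>n. t * v' t n)" for t
  have Hc: "continuous_on {0<..} (\<lambda>t. t * v' t n)" for n
    by (intro continuous_intros v')
  have Hm: "H \<in> borel_measurable halfline" unfolding H_def by (rule lp_norm_measurable_halfline[OF Hc])
  have "mixed_norm p q (\<lambda>t n. t powr b * v t n) = time_norm q (\<lambda>t. ennreal (t powr b) * lp_norm p (v t))"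
    by (rule mixed_norm_powr_eq[OF pq(1)])
  also have "\<dots> \<le> time_norm q (\<lambda>t. ennreal (t powr b) * (\<integral>\<^sup>+s\<in>{t..}. H s * ennreal (1 / s) \<partial>lborel))"
  proof (rule time_norm_mono)
    show "(\<lambda>t. ennreal (t powr b) * lp_norm p (v t)) \<in> borel_measurable halfline"
      by (intro measurable_halfline_powr_mult lp_norm_measurable_halfline vc)
    fix t :: real assume t: "t > 0"
    let ?N = "restrict_space lborel {t..}"
    have v'm: "(\<lambda>s. ennreal \<bar>v' s n\<bar>) \<in> borel_measurable ?N" for n
    proof -
      have "continuous_on {t..} (\<lambda>s. v' s n)" using v' by (rule continuous_on_subset) (use t in auto)
      from borel_measurable_continuous_on_restrict[OF this]
      have "(\<lambda>s. ennreal \<bar>v' s n\<bar>) \<in> borel_measurable (restrict_space borel {t..})" by measurable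
      then show ?thesis by (subst measurable_cong_sets[OF sets_restrict_space_cong refl, of _ borel]) auto
    qed
    have "lp_norm p (v t) \<le> lp_ennnorm p (\<lambda>n. \<integral>\<^sup>+s. ennreal \<bar>v' s n\<bar> \<partial>?N)"
      unfolding lp_norm_eq_lp_ennnorm
    proof (rule lp_ennnorm_mono)
      fix n
      have "ennreal \<bar>v t n\<bar> \<le> (\<integral>\<^sup>+s\<in>{t..}. ennreal \<bar>v' s n\<bar> \<partial>lborel)"
        using t by (intro abs_le_nn_integral_deriv v lim continuous_on_subset[OF v']) auto
      then show "ennreal \<bar>v t n\<bar> \<le> (\<integral>\<^sup>+s. ennreal \<bar>v' s n\<bar> \<partial>?N)"
        by (simp add: nn_integral_restrict_space)
    qed
    also have "\<dots> \<le> (\<integral>\<^sup>+s. lp_ennnorm p (\<lambda>n. ennreal \<bar>v' s n\<bar>) \<partial>?N)"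
      by (intro lp_ennnorm_nn_integral_le pq v'm sigma_finite_measure_restrict_space) (auto intro: lborel.sigma_finite_measure_axioms)
    also have "\<dots> = (\<integral>\<^sup>+s\<in>{t..}. H s * ennreal (1 / s) \<partial>lborel)"
    proof (subst nn_integral_restrict_space, simp, intro nn_integral_cong)
      fix s :: real
      show "lp_ennnorm p (\<lambda>n. ennreal \<bar>v' s n\<bar>) * indicator {t..} s = H s * ennreal (1 / s) * indicator {t..} s"
      proof (cases "s \<ge> t")
        case True
        then have s: "s > 0" using t by simp
        have "H s * ennreal (1 / s) = (ennreal s * ennreal (1 / s)) * lp_norm p (v' s)"
          unfolding H_def using s by (simp add: lp_norm_cmult pq mult_ac)
        also have "ennreal s * ennreal (1 / s) = 1"
          using s by (subst ennreal_mult[symmetric]) auto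
        finally show ?thesis by (simp add: lp_norm_eq_lp_ennnorm)
      qed simp
    qed
    finally show "ennreal (t powr b) * lp_norm p (v t) \<le> ennreal (t powr b) * (\<integral>\<^sup>+s\<in>{t..}. H s * ennreal (1 / s) \<partial>lborel)"
      by (intro mult_left_mono) auto
  qed
  also have "\<dots> \<le> ennreal (1 / b) * time_norm q (\<lambda>t. ennreal (t powr b) * H t)"
    by (rule hardy_time_norm[OF b pq(2) Hm])
  also have "time_norm q (\<lambda>t. ennreal (t powr b) * H t) = mixed_norm p q (\<lambda>t n. t powr b * (t * v' t n))"
    unfolding mixed_norm_powr_eq[OF pq(1)] H_def ..
  \<comment> \<open>The factor \<open>t\<close> in front of \<open>v'\<close> raises the parameter
    \<open>g\<close> to \<open>g + 1\<close>.\<close>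
  also have "\<dots> \<le> ennreal (C * 2 powr (b + (g + 1) - 1)) * mixed_norm p q (\<lambda>t n. t powr (b + (g + 1) - 1) * U t n)"
  proof (rule mixed_norm_le_of_halved_time[OF pq C Hc U])
    fix t :: real assume t: "t > 0"
    have "lp_norm p (\<lambda>n. t * v' t n) = ennreal t * lp_norm p (v' t)"
      using t by (simp add: lp_norm_cmult pq)
    also have "\<dots> \<le> ennreal t * (ennreal (C * t powr (g - 1)) * lp_norm p (U (t / 2)))"
      by (intro mult_left_mono le t) simp
    also have "\<dots> = (ennreal t * ennreal (C * t powr (g - 1))) * lp_norm p (U (t / 2))" by (simp add: mult_ac)
    also have "ennreal t * ennreal (C * t powr (g - 1)) = ennreal (C * t powr (g + 1 - 1))"
      using t C by (simp add: powr_diff flip: ennreal_mult)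
    finally show "lp_norm p (\<lambda>n. t * v' t n) \<le> ennreal (C * t powr (g + 1 - 1)) * lp_norm p (U (t / 2))" .
  qed
  finally have "mixed_norm p q (\<lambda>t n. t powr b * v t n)
     \<le> ennreal (1 / b) * (ennreal (C * 2 powr (b + g)) * mixed_norm p q (\<lambda>t n. t powr (b + g) * U t n))"
    by (simp add: mult_left_mono)
  also have "\<dots> = (ennreal (1 / b) * ennreal (C * 2 powr (b + g))) * mixed_norm p q (\<lambda>t n. t powr (b + g) * U t n)"
    by (simp add: mult_ac)
  also have "ennreal (1 / b) * ennreal (C * 2 powr (b + g)) = ennreal (C * 2 powr (b + g) / b)"
    using b C by (simp flip: ennreal_mult)
  finally show ?thesis .
qed

section \<open>Convolution on the integers\<close>

lemma summable_on_real_comparison: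
  fixes f g :: "'a \<Rightarrow> real"
  assumes "g summable_on A" "\<And>x. x \<in> A \<Longrightarrow> \<bar>f x\<bar> \<le> g x"
  shows "f summable_on A"
proof -
  have "Infinite_Sum.abs_summable_on g A" using assms(1) summable_on_iff_abs_summable_on_real by blast
  then have "Infinite_Sum.abs_summable_on f A"
    by (rule Infinite_Sum.abs_summable_on_comparison_test) (use assms(2) in force)
  then show ?thesis using summable_on_iff_abs_summable_on_real by blast
qed

lemma summable_on_abs_real: "f summable_on A \<Longrightarrow> (\<lambda>x. \<bar>f x :: real\<bar>) summable_on A"
  using summable_on_iff_abs_summable_on_real[of f A] by simp

lemma summable_on_bounded_mult:
  fixes f g :: "'a \<Rightarrow> real"
  assumes "\<And>x. \<bar>f x\<bar> \<le> B" "g summable_on A" shows "(\<lambda>x. f x * g x) summable_on A"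
proof (rule summable_on_real_comparison)
  show "(\<lambda>x. B * \<bar>g x\<bar>) summable_on A" by (intro summable_on_cmult_right summable_on_abs_real assms)
qed (simp add: abs_mult assms(1) mult_right_mono)

lemma abs_infsum_le_real:
  fixes f :: "'a \<Rightarrow> real"
  assumes "f summable_on A" shows "\<bar>infsum f A\<bar> \<le> (\<Sum>\<^sub>\<infinity>x\<in>A. \<bar>f x\<bar>)"
  using norm_infsum_bound[of f A] summable_on_iff_abs_summable_on_real[of f A] assms by simp

lemma nn_integral_count_space_eq_infsum:
  fixes f :: "'a \<Rightarrow> real"
  assumes "f summable_on A" "\<And>x. x \<in> A \<Longrightarrow> f x \<ge> 0"
  shows "(\<integral>\<^sup>+x. ennreal (f x) \<partial>count_space A) = ennreal (infsum f A)"
proof -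
  have "Infinite_Sum.abs_summable_on f A" using assms(1) summable_on_iff_abs_summable_on_real by blast
  then have "Infinite_Set_Sum.abs_summable_on f A" using abs_summable_equivalent by blast
  then show ?thesis using assms(2) by (simp add: nn_integral_conv_infsetsum infsetsum_infsum)
qed

lemma abs_infsum_le_nn_integral:
  fixes f :: "'a \<Rightarrow> real"
  assumes "f summable_on A"
  shows "ennreal \<bar>infsum f A\<bar> \<le> (\<integral>\<^sup>+x. ennreal \<bar>f x\<bar> \<partial>count_space A)"
  using nn_integral_count_space_eq_infsum[OF summable_on_abs_real[OF assms]] abs_infsum_le_real[OF assms]
  by (simp add: ennreal_leI)

lemma nn_integral_finite_imp_summable_on:
  fixes f :: "'a \<Rightarrow> real"
  assumes "(\<integral>\<^sup>+x. ennreal \<bar>f x\<bar> \<partial>count_space A) < top" shows "f summable_on A"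
proof -
  have "integrable (count_space A) f" using assms by (simp add: integrable_iff_bounded)
  then have "Infinite_Set_Sum.abs_summable_on f A" by (simp add: abs_summable_on_def)
  then show ?thesis using abs_summable_equivalent summable_on_iff_abs_summable_on_real by blast
qed

text \<open>Enumerating the integers turns an unconditional sum into a series, to which the theorems
  on termwise integration and differentiation apply.\<close>

lemma suminf_int_decode:
  fixes f :: "int \<Rightarrow> real"
  assumes "f summable_on UNIV"
  shows "summable (\<lambda>n. \<bar>f (int_decode n)\<bar>)" "(\<Sum>n. f (int_decode n)) = infsum f UNIV"
proof -
  have b: "bij_betw int_decode UNIV UNIV"
    by (simp add: bij_betw_def inj_int_decode surj_int_decode)
  have s: "(\<lambda>n. f (int_decode n)) summable_on UNIV"
    using assms summable_on_reindex_bij_betw[OF b, of f] by simp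
  then show "summable (\<lambda>n. \<bar>f (int_decode n)\<bar>)"
    using summable_on_abs_real[OF s] summable_on_UNIV_nonneg_real_iff[of "\<lambda>n. \<bar>f (int_decode n)\<bar>"] by simp
  have "((\<lambda>n. f (int_decode n)) has_sum infsum f UNIV) UNIV"
    using s infsum_reindex_bij_betw[OF b, of f] by (metis has_sum_infsum)
  then have "(\<lambda>n. f (int_decode n)) sums infsum f UNIV" by (rule has_sum_imp_sums)
  then show "(\<Sum>n. f (int_decode n)) = infsum f UNIV" by (rule sums_unique[symmetric])
qed

lemma integral_infsum:
  fixes F :: "int \<Rightarrow> 'a \<Rightarrow> real"
  assumes int: "\<And>j. integrable M (F j)" and s: "\<And>x. x \<in> space M \<Longrightarrow> (\<lambda>j. F j x) summable_on UNIV"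
    and b: "(\<lambda>j. \<integral>x. \<bar>F j x\<bar> \<partial>M) summable_on UNIV"
  shows "integrable M (\<lambda>x. \<Sum>\<^sub>\<infinity>j. F j x)"
    and "(\<integral>x. (\<Sum>\<^sub>\<infinity>j. F j x) \<partial>M) = (\<Sum>\<^sub>\<infinity>j. \<integral>x. F j x \<partial>M)"
    and "(\<lambda>j. \<integral>x. F j x \<partial>M) summable_on UNIV"
proof -
  have eq: "(\<Sum>\<^sub>\<infinity>j. F j x) = (\<Sum>n. F (int_decode n) x)" if "x \<in> space M" for x
    using suminf_int_decode(2)[OF s[OF that]] by simp
  have A: "AE x in M. summable (\<lambda>n. norm (F (int_decode n) x))"
    using suminf_int_decode(1)[OF s] by auto
  have B: "summable (\<lambda>n. \<integral>x. norm (F (int_decode n) x) \<partial>M)"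
    using suminf_int_decode(1)[OF b] by (auto simp: abs_of_nonneg)
  have "integrable M (\<lambda>x. \<Sum>n. F (int_decode n) x)"
    by (rule integrable_suminf[OF int A B])
  then show "integrable M (\<lambda>x. \<Sum>\<^sub>\<infinity>j. F j x)"
    by (subst Bochner_Integration.integrable_cong[OF refl eq])
  have "(\<integral>x. (\<Sum>\<^sub>\<infinity>j. F j x) \<partial>M) = (\<integral>x. (\<Sum>n. F (int_decode n) x) \<partial>M)"
    by (rule Bochner_Integration.integral_cong[OF refl eq])
  also have "\<dots> = (\<Sum>n. \<integral>x. F (int_decode n) x \<partial>M)"
    by (rule integral_suminf[OF int A B])
  also have "\<dots> = (\<Sum>\<^sub>\<infinity>j. \<integral>x. F j x \<partial>M)"
  proof (rule suminf_int_decode(2))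
    show "(\<lambda>j. \<integral>x. F j x \<partial>M) summable_on UNIV"
      by (rule summable_on_real_comparison[OF b]) (use integral_abs_bound in blast)
  qed
  finally show "(\<integral>x. (\<Sum>\<^sub>\<infinity>j. F j x) \<partial>M) = (\<Sum>\<^sub>\<infinity>j. \<integral>x. F j x \<partial>M)" .
  show "(\<lambda>j. \<integral>x. F j x \<partial>M) summable_on UNIV"
    by (rule summable_on_real_comparison[OF b]) (use integral_abs_bound in blast)
qed

lemma has_real_derivative_infsum:
  fixes F F' :: "int \<Rightarrow> real \<Rightarrow> real"
  assumes x: "a < x" "x < b"
    and d: "\<And>j s. a < s \<Longrightarrow> s < b \<Longrightarrow> (F j has_real_derivative F' j s) (at s)"
    and bnd: "\<And>j s. a < s \<Longrightarrow> s < b \<Longrightarrow> \<bar>F' j s\<bar> \<le> M j" and M: "M summable_on UNIV"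
    and s: "\<And>s. a < s \<Longrightarrow> s < b \<Longrightarrow> (\<lambda>j. F j s) summable_on UNIV"
  shows "((\<lambda>s. \<Sum>\<^sub>\<infinity>j. F j s) has_real_derivative (\<Sum>\<^sub>\<infinity>j. F' j x)) (at x)"
proof -
  have sF': "(\<lambda>j. F' j s) summable_on UNIV" if "a < s" "s < b" for s
    by (rule summable_on_real_comparison[OF M]) (use bnd that in auto)
  have "((\<lambda>s. \<Sum>n. F (int_decode n) s) has_real_derivative (\<Sum>n. F' (int_decode n) x)) (at x)"
  proof (rule has_field_derivative_series'(2)[where S="{a<..<b}" and x0=x])
    show "uniformly_convergent_on {a<..<b} (\<lambda>n s. \<Sum>i<n. F' (int_decode i) s)"
    proof (rule Weierstrass_m_test'[where M="\<lambda>n. M (int_decode n)"])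
      show "summable (\<lambda>n. M (int_decode n))"
        using suminf_int_decode(1)[OF M] by (rule summable_rabs_cancel)
    qed (use bnd in auto)
    show "summable (\<lambda>n. F (int_decode n) x)"
      using suminf_int_decode(1)[OF s[OF x]] by (rule summable_rabs_cancel)
  qed (use x d in \<open>auto intro: has_field_derivative_at_within simp: interior_open\<close>)
  then have "((\<lambda>s. \<Sum>n. F (int_decode n) s) has_real_derivative (\<Sum>\<^sub>\<infinity>j. F' j x)) (at x)"
    using suminf_int_decode(2)[OF sF'[OF x]] by simp
  moreover have "eventually (\<lambda>s. (\<Sum>n. F (int_decode n) s) = (\<Sum>\<^sub>\<infinity>j. F j s)) (nhds x)"
    using eventually_nhds_in_open[of "{a<..<b}" x] x
    by (auto elim!: eventually_mono intro!: suminf_int_decode(2) s)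
  ultimately show ?thesis
    by (subst (asm) DERIV_cong_ev[OF refl _ refl]) assumption+
qed

section \<open>Polynomial weights and convolution\<close>

definition conv :: "(int \<Rightarrow> real) \<Rightarrow> (int \<Rightarrow> real) \<Rightarrow> int \<Rightarrow> real" where
  "conv k f n = (\<Sum>\<^sub>\<infinity>j. k (n - j) * f j)"

definition weight :: "real \<Rightarrow> int \<Rightarrow> real" where
  "weight a j = (1 + \<bar>real_of_int j\<bar>) powr (- a)"

definition decaying :: "real \<Rightarrow> (int \<Rightarrow> real) \<Rightarrow> bool" where
  "decaying a k \<longleftrightarrow> (\<exists>C. \<forall>j. \<bar>k j\<bar> \<le> C * weight a j)"

text \<open>The dual of \<open>decaying a\<close>: a weighted l^1 condition against a weighted
  l^\<infinity> condition, so that the sums in \<open>conv k f\<close> converge absolutely.\<close>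

definition tempered :: "real \<Rightarrow> (int \<Rightarrow> real) \<Rightarrow> bool" where
  "tempered a f \<longleftrightarrow> (\<lambda>j. f j * weight a j) summable_on UNIV"

lemma weight_pos [simp]: "weight a j > 0"
  by (simp add: weight_def add_pos_nonneg)

lemma weight_nonneg [simp]: "weight a j \<ge> 0"
  using weight_pos[of a j] by linarith

lemma weight_minus [simp]: "weight a (- j) = weight a j"
  by (simp add: weight_def)

text \<open>Comes from 1 + |i + j| <= (1 + |i|) (1 + |j|). It makes each translate of the weight
  comparable with the weight, so shifts preserve both classes.\<close>

lemma weight_mult_le: assumes "a \<ge> 0" shows "weight a i * weight a j \<le> weight a (i + j)"
proof -
  have "1 + \<bar>real_of_int (i + j)\<bar> \<le> (1 + \<bar>real_of_int i\<bar>) * (1 + \<bar>real_of_int j\<bar>)"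
  proof -
    have "\<bar>real_of_int (i + j)\<bar> \<le> \<bar>real_of_int i\<bar> + \<bar>real_of_int j\<bar>" by simp
    moreover have "0 \<le> \<bar>real_of_int i\<bar> * \<bar>real_of_int j\<bar>" by simp
    moreover have "(1 + \<bar>real_of_int i\<bar>) * (1 + \<bar>real_of_int j\<bar>)
      = 1 + (\<bar>real_of_int i\<bar> + \<bar>real_of_int j\<bar>) + \<bar>real_of_int i\<bar> * \<bar>real_of_int j\<bar>"
      by (simp only: algebra_simps)
    ultimately show ?thesis by linarith
  qed
  then have "((1 + \<bar>real_of_int i\<bar>) * (1 + \<bar>real_of_int j\<bar>)) powr (- a) \<le> (1 + \<bar>real_of_int (i + j)\<bar>) powr (- a)"
    using assms by (intro powr_mono2') (auto simp: add_pos_nonneg)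
  then show ?thesis by (simp add: weight_def powr_mult)
qed

lemma weight_diff_le: assumes "a \<ge> 0" shows "weight a (n - j) \<le> weight a j / weight a n"
  using weight_mult_le[OF assms, of "n - j" "- n"] by (simp add: field_simps)

lemma summable_on_nat_abs:
  fixes g :: "nat \<Rightarrow> real"
  assumes "\<And>n. g n \<ge> 0" "summable g"
  shows "(\<lambda>j::int. g (nat \<bar>j\<bar>)) summable_on UNIV"
proof -
  have s: "g summable_on UNIV" using assms by (simp add: summable_on_UNIV_nonneg_real_iff)
  have "(\<lambda>j::int. g (nat \<bar>j\<bar>)) summable_on (range int)"
    using s by (subst summable_on_reindex) (auto simp: o_def)
  moreover have "(\<lambda>j::int. g (nat \<bar>j\<bar>)) summable_on (range (\<lambda>n. - int n))"
    using s by (subst summable_on_reindex) (auto simp: o_def inj_on_def)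
  ultimately have "(\<lambda>j::int. g (nat \<bar>j\<bar>)) summable_on (range int \<union> range (\<lambda>n. - int n))"
    by (rule summable_on_union)
  moreover have "range int \<union> range (\<lambda>n. - int n) = UNIV"
  proof -
    have "x \<in> range int \<union> range (\<lambda>n. - int n)" for x
      by (cases x rule: int_cases2) auto
    then show ?thesis by auto
  qed
  ultimately show ?thesis by simp
qed

lemma weight_summable: assumes "a > 1" shows "weight a summable_on UNIV"
proof -
  have "summable (\<lambda>n. real (Suc n) powr (- a))"
    using summable_real_powr_iff[of "- a"] assms by (subst summable_Suc_iff) simp
  then have "(\<lambda>j::int. real (Suc (nat \<bar>j\<bar>)) powr (- a)) summable_on UNIV"
    by (intro summable_on_nat_abs) auto
  then show ?thesis by (simp add: weight_def [abs_def])
qed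

text \<open>Of \<open>n - k\<close> and \<open>k\<close> one has modulus at least |n|/2, so one
  factor is comparable with \<open>weight a n\<close> while the other is summable, \<open>a\<close>
  being larger than 1.\<close>

lemma weight_conv_le:
  assumes "a > 1"
  shows "\<exists>D\<ge>0. \<forall>n. (\<lambda>k. weight a (n - k) * weight a k) summable_on UNIV
     \<and> (\<Sum>\<^sub>\<infinity>k. weight a (n - k) * weight a k) \<le> D * weight a n"
proof -
  define D where "D = 2 powr a * (2 * infsum (weight a) UNIV)"
  have ws: "weight a summable_on UNIV" by (rule weight_summable[OF assms])
  have b: "bij_betw (\<lambda>k. n - k) UNIV (UNIV::int set)" for n
    by (intro bij_betwI[where g="\<lambda>k. n - k"]) auto
  have wsn: "(\<lambda>k. weight a (n - k)) summable_on UNIV" for n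
    using summable_on_reindex_bij_betw[OF b, of "weight a" n] ws by simp
  have wi: "(\<Sum>\<^sub>\<infinity>k. weight a (n - k)) = infsum (weight a) UNIV" for n
    by (rule infsum_reindex_bij_betw[OF b])
  have pt: "weight a (n - k) * weight a k \<le> 2 powr a * weight a n * (weight a (n - k) + weight a k)" for n k
  proof -
    define x y z where "x = 1 + \<bar>real_of_int (n - k)\<bar>" and "y = 1 + \<bar>real_of_int k\<bar>" and "z = 1 + \<bar>real_of_int n\<bar>"
    have pos: "x > 0" "y > 0" "z > 0" by (auto simp: x_def y_def z_def add_pos_nonneg)
    have "z \<le> x + y" by (auto simp: x_def y_def z_def)
    then have "z \<le> 2 * max x y"
      using max.cobounded1[of x y] max.cobounded2[of y x] by linarith
    then have "z powr a \<le> (2 * max x y) powr a" using pos assms by (intro powr_mono2) auto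
    also have "\<dots> = 2 powr a * (max x y) powr a" by (rule powr_mult)
    also have "(max x y) powr a \<le> x powr a + y powr a" by (auto simp: max_def)
    finally have *: "z powr a \<le> 2 powr a * (x powr a + y powr a)" by simp
    define X Y Z P where "X = x powr a" and "Y = y powr a" and "Z = z powr a" and "P = (2::real) powr a"
    have pos': "X > 0" "Y > 0" "Z > 0" using pos by (auto simp: X_def Y_def Z_def)
    have "1 \<le> P * (X + Y) / Z" using * pos' by (simp add: X_def Y_def Z_def P_def)
    then have "1 / (X * Y) * 1 \<le> 1 / (X * Y) * (P * (X + Y) / Z)" using pos' by (intro mult_left_mono) auto
    also have "\<dots> = P * (1 / Z) * (1 / X + 1 / Y)" using pos' by (simp add: divide_simps)
    finally have "x powr (-a) * y powr (-a) \<le> 2 powr a * z powr (-a) * (x powr (-a) + y powr (-a))"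
      by (simp add: powr_minus_divide X_def Y_def Z_def P_def)
    then show ?thesis by (simp add: weight_def x_def y_def z_def)
  qed
  have sum1: "(\<lambda>k. 2 powr a * weight a n * (weight a (n - k) + weight a k)) summable_on UNIV" for n
    by (intro summable_on_cmult_right summable_on_add wsn ws)
  have s: "(\<lambda>k. weight a (n - k) * weight a k) summable_on UNIV" for n
    by (rule summable_on_real_comparison[OF sum1[of n]]) (use pt in auto)
  have "(\<Sum>\<^sub>\<infinity>k. weight a (n - k) * weight a k) \<le> D * weight a n" for n
  proof -
    have "(\<Sum>\<^sub>\<infinity>k. weight a (n - k) * weight a k) \<le> (\<Sum>\<^sub>\<infinity>k. 2 powr a * weight a n * (weight a (n - k) + weight a k))"
      by (rule infsum_mono[OF s sum1 pt])
    also have "\<dots> = 2 powr a * weight a n * (infsum (weight a) UNIV + infsum (weight a) UNIV)"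
      by (subst infsum_cmult_right) (auto simp: infsum_add wsn ws wi intro!: summable_on_add)
    finally show ?thesis by (simp add: D_def mult_ac)
  qed
  moreover have "D \<ge> 0" unfolding D_def by (intro mult_nonneg_nonneg infsum_nonneg) auto
  ultimately show ?thesis using s by blast
qed

lemma decaying_bound:
  assumes "decaying a k" shows "\<exists>C\<ge>0. \<forall>j. \<bar>k j\<bar> \<le> C * weight a j"
proof -
  obtain C where C: "\<And>j. \<bar>k j\<bar> \<le> C * weight a j" using assms by (auto simp: decaying_def)
  have "0 \<le> C * weight a 0" using C[of 0] by linarith
  then have "C \<ge> 0" by (simp add: zero_le_mult_iff not_le[symmetric] weight_def)
  then show ?thesis using C by blast
qed

lemma conv_summable:
  assumes a: "a \<ge> 0" and k: "decaying a k" and f: "tempered a f"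
  shows "(\<lambda>j. k (n - j) * f j) summable_on UNIV"
proof -
  obtain C where C: "C \<ge> 0" "\<And>j. \<bar>k j\<bar> \<le> C * weight a j" using decaying_bound[OF k] by blast
  have "(\<lambda>j. C / weight a n * \<bar>f j * weight a j\<bar>) summable_on UNIV"
    using f by (intro summable_on_cmult_right summable_on_abs_real) (simp add: tempered_def)
  then show ?thesis
  proof (rule summable_on_real_comparison)
    fix j
    have "\<bar>k (n - j)\<bar> \<le> C * (weight a j / weight a n)"
      using C(2)[of "n - j"] mult_left_mono[OF weight_diff_le[OF a, of n j] C(1)] by linarith
    then have "\<bar>k (n - j)\<bar> * \<bar>f j\<bar> \<le> C * (weight a j / weight a n) * \<bar>f j\<bar>" by (intro mult_right_mono) auto
    then show "\<bar>k (n - j) * f j\<bar> \<le> C / weight a n * \<bar>f j * weight a j\<bar>"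
      by (simp add: abs_mult mult_ac)
  qed
qed

text \<open>Summing over the middle index first leaves a multiple of
  \<open>weight a (n - j)\<close>, which the growth condition on \<open>f\<close> absorbs.
  Associativity of \<open>conv\<close> and stability of \<open>tempered\<close> both rest on this
  double sum.\<close>

lemma conv_pair_summable:
  assumes a: "a > 1" and k: "decaying a k" and k': "decaying a k'" and f: "tempered a f"
  shows "(\<lambda>(i, j). k (n - i) * (k' (i - j) * f j)) summable_on UNIV \<times> UNIV"
proof -
  obtain C where C: "C \<ge> 0" "\<And>j. \<bar>k j\<bar> \<le> C * weight a j" using decaying_bound[OF k] by blast
  obtain C' where C': "C' \<ge> 0" "\<And>j. \<bar>k' j\<bar> \<le> C' * weight a j" using decaying_bound[OF k'] by blast
  obtain D where D: "D \<ge> 0" "\<And>n. (\<lambda>k. weight a (n - k) * weight a k) summable_on UNIV"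
      "\<And>n. (\<Sum>\<^sub>\<infinity>k. weight a (n - k) * weight a k) \<le> D * weight a n"
    using weight_conv_le[OF a] by blast
  have b: "bij_betw (\<lambda>i. i - j) UNIV (UNIV::int set)" for j
    by (intro bij_betwI[where g="\<lambda>k. k + j"]) auto
  have ws: "(\<lambda>i. weight a (n - i) * weight a (i - j)) summable_on UNIV" for j
    using summable_on_reindex_bij_betw[OF b, of "\<lambda>i. weight a ((n - j) - i) * weight a i" j] D(2)[of "n - j"] by simp
  have wi: "(\<Sum>\<^sub>\<infinity>i. weight a (n - i) * weight a (i - j)) \<le> D * weight a (n - j)" for j
    using infsum_reindex_bij_betw[OF b, of "\<lambda>i. weight a ((n - j) - i) * weight a i" j] D(3)[of "n - j"] by simp
  \<comment> \<open>The pair is ordered as \<open>(j, i)\<close> because the inner sum must be the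
    one over \<open>i\<close>; the components are swapped back at the end.\<close>
  let ?F = "\<lambda>(j, i). C * C' * \<bar>f j\<bar> * (weight a (n - i) * weight a (i - j))"
  have "Infinite_Sum.abs_summable_on ?F (UNIV \<times> UNIV)"
    unfolding Infinite_Sum.abs_summable_on_Sigma_iff
  proof (intro conjI ballI)
    fix j :: int
    show "Infinite_Sum.abs_summable_on (\<lambda>i. ?F (j, i)) UNIV"
      using summable_on_abs_real[OF summable_on_cmult_right[OF ws, of "C * C' * \<bar>f j\<bar>" j]] by simp
  next
    have eq: "(\<Sum>\<^sub>\<infinity>i. norm (?F (j, i))) = C * C' * \<bar>f j\<bar> * (\<Sum>\<^sub>\<infinity>i. weight a (n - i) * weight a (i - j))" for j
      using C C' by (simp add: abs_mult infsum_cmult_right ws)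
    have "(\<lambda>j. C * C' * D / weight a n * \<bar>f j * weight a j\<bar>) summable_on UNIV"
      using f by (intro summable_on_cmult_right summable_on_abs_real) (simp add: tempered_def)
    then have "(\<lambda>j. \<Sum>\<^sub>\<infinity>i. norm (?F (j, i))) summable_on UNIV"
    proof (rule summable_on_real_comparison)
      fix j
      have "(\<Sum>\<^sub>\<infinity>i. weight a (n - i) * weight a (i - j)) \<le> D * (weight a j / weight a n)"
        using wi[of j] mult_left_mono[OF weight_diff_le[of a n j] D(1)] a by linarith
      moreover have "(\<Sum>\<^sub>\<infinity>i. weight a (n - i) * weight a (i - j)) \<ge> 0" by (intro infsum_nonneg) auto
      ultimately have "C * C' * \<bar>f j\<bar> * \<bar>\<Sum>\<^sub>\<infinity>i. weight a (n - i) * weight a (i - j)\<bar>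
        \<le> C * C' * \<bar>f j\<bar> * (D * (weight a j / weight a n))"
        using C C' by (intro mult_left_mono) auto
      then show "\<bar>\<Sum>\<^sub>\<infinity>i. norm (?F (j, i))\<bar> \<le> C * C' * D / weight a n * \<bar>f j * weight a j\<bar>"
        unfolding eq using C C' by (simp add: abs_mult mult_ac)
    qed
    from summable_on_abs_real[OF this]
    show "Infinite_Sum.abs_summable_on (\<lambda>j. \<Sum>\<^sub>\<infinity>i. norm (?F (j, i))) UNIV"
      unfolding real_norm_def .
  qed
  then have s: "?F summable_on (UNIV \<times> UNIV)" by (rule abs_summable_summable)
  have "(\<lambda>(j, i). k (n - i) * (k' (i - j) * f j)) summable_on UNIV \<times> UNIV"
  proof (rule summable_on_real_comparison[OF s])
    fix x :: "int \<times> int"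
    obtain j i where x: "x = (j, i)" by (cases x)
    have "\<bar>k (n - i)\<bar> * (\<bar>k' (i - j)\<bar> * \<bar>f j\<bar>) \<le> (C * weight a (n - i)) * ((C' * weight a (i - j)) * \<bar>f j\<bar>)"
      using C C' by (intro mult_mono mult_nonneg_nonneg) auto
    then show "\<bar>(\<lambda>(j, i). k (n - i) * (k' (i - j) * f j)) x\<bar> \<le> ?F x"
      by (simp add: x abs_mult mult_ac)
  qed
  moreover have "bij_betw prod.swap (UNIV \<times> UNIV :: (int \<times> int) set) (UNIV \<times> UNIV)"
    by (simp add: bij_betw_def)
  ultimately show ?thesis
    using summable_on_reindex_bij_betw[of prod.swap "UNIV \<times> UNIV" "UNIV \<times> UNIV" "\<lambda>(j, i). k (n - i) * (k' (i - j) * f j)"]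
    by (simp add: case_prod_beta')
qed

lemma decaying_imp_tempered:
  assumes "a > 1" "decaying a k" shows "tempered a k"
proof -
  obtain C where C: "C \<ge> 0" "\<And>j. \<bar>k j\<bar> \<le> C * weight a j" using decaying_bound[OF assms(2)] by blast
  have "weight a j \<le> 1" for j
    using assms(1) by (simp add: weight_def powr_minus_divide ge_one_powr_ge_zero)
  then have "\<bar>k j * weight a j\<bar> \<le> C * weight a j" for j
    using C(2)[of j] mult_mono[of "\<bar>k j\<bar>" "C * weight a j" "weight a j" 1] C(1) by (simp add: abs_mult)
  then show "tempered a k" unfolding tempered_def
    by (intro summable_on_real_comparison[OF summable_on_cmult_right[OF weight_summable[OF assms(1)], of C]])
qed

lemma conv_conv:
  assumes "a > 1" "decaying a k" "decaying a k'" "tempered a f"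
  shows "conv k (conv k' f) n = conv (conv k k') f n"
proof -
  have "conv k (conv k' f) n = (\<Sum>\<^sub>\<infinity>i. \<Sum>\<^sub>\<infinity>j. k (n - i) * (k' (i - j) * f j))"
    using conv_summable[of a k' f] assms by (simp add: conv_def infsum_cmult_right)
  also have "\<dots> = (\<Sum>\<^sub>\<infinity>j. \<Sum>\<^sub>\<infinity>i. k (n - i) * (k' (i - j) * f j))"
    by (rule infsum_swap_banach) (rule conv_pair_summable[OF assms])
  also have "\<dots> = (\<Sum>\<^sub>\<infinity>j. conv k k' (n - j) * f j)"
  proof (intro infsum_cong)
    fix j
    have b: "bij_betw (\<lambda>i. i - j) UNIV (UNIV::int set)"
      by (intro bij_betwI[where g="\<lambda>k. k + j"]) auto
    have s: "(\<lambda>i. k (n - j - i) * k' i) summable_on UNIV"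
      by (rule conv_summable[OF _ assms(2) decaying_imp_tempered[OF assms(1,3)]]) (use assms(1) in simp)
    have "(\<Sum>\<^sub>\<infinity>i. k (n - i) * (k' (i - j) * f j)) = (\<Sum>\<^sub>\<infinity>i. k (n - j - (i - j)) * k' (i - j) * f j)"
      by (simp add: mult.assoc)
    also have "\<dots> = (\<Sum>\<^sub>\<infinity>i. k (n - j - i) * k' i * f j)"
      by (rule infsum_reindex_bij_betw[OF b, of "\<lambda>i. k (n - j - i) * k' i * f j"])
    also have "\<dots> = conv k k' (n - j) * f j"
      using s by (simp add: conv_def infsum_cmult_left)
    finally show "(\<Sum>\<^sub>\<infinity>i. k (n - i) * (k' (i - j) * f j)) = conv k k' (n - j) * f j" .
  qed
  finally show ?thesis by (simp add: conv_def)
qed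

lemma decaying_weight: "decaying a (weight a)"
  unfolding decaying_def by (intro exI[of _ 1]) auto

lemma tempered_conv:
  assumes "a > 1" "decaying a k" "tempered a f"
  shows "tempered a (conv k f)"
proof -
  \<comment> \<open>The weight is itself a decaying kernel: at \<open>n = 0\<close> the double sum
    is the weighted sum that \<open>tempered\<close> asks for.\<close>
  have "(\<lambda>(i, j). weight a (0 - i) * (k (i - j) * f j)) summable_on UNIV \<times> UNIV"
    by (rule conv_pair_summable[OF assms(1) decaying_weight assms(2,3)])
  then have "(\<lambda>i. \<Sum>\<^sub>\<infinity>j. weight a (0 - i) * (k (i - j) * f j)) summable_on UNIV"
    by (rule summable_on_Sigma_banach)
  then show ?thesis unfolding tempered_def conv_def
    using conv_summable[of a k f] assms by (simp add: infsum_cmult_right mult.commute[of _ "weight a _"])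
qed

definition laplacian :: "(int \<Rightarrow> real) \<Rightarrow> int \<Rightarrow> real" where
  "laplacian f n = f (n + 1) - 2 * f n + f (n - 1)"

lemma weight_shift_le: assumes "a \<ge> 0" shows "weight a (j + c) \<le> weight a j / weight a c"
  using weight_diff_le[OF assms, of c "- j"] by (simp add: add.commute)

lemma decaying_shift: assumes "a \<ge> 0" "decaying a k" shows "decaying a (\<lambda>j. k (j + c))"
proof -
  obtain C where C: "C \<ge> 0" "\<And>j. \<bar>k j\<bar> \<le> C * weight a j" using decaying_bound[OF assms(2)] by blast
  have "\<bar>k (j + c)\<bar> \<le> C / weight a c * weight a j" for j
    using C(2)[of "j + c"] mult_left_mono[OF weight_shift_le[OF assms(1), of j c] C(1)] by simp
  then show ?thesis unfolding decaying_def by blast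
qed

lemma decaying_add: assumes "decaying a k" "decaying a k'" shows "decaying a (\<lambda>j. k j + k' j)"
proof -
  obtain C C' where "\<And>j. \<bar>k j\<bar> \<le> C * weight a j" "\<And>j. \<bar>k' j\<bar> \<le> C' * weight a j"
    using assms unfolding decaying_def by blast
  then have "\<bar>k j + k' j\<bar> \<le> (C + C') * weight a j" for j
    by (smt (verit, ccfv_SIG) distrib_right)
  then show ?thesis unfolding decaying_def by blast
qed

lemma decaying_cmult: assumes "decaying a k" shows "decaying a (\<lambda>j. c * k j)"
proof -
  obtain C where "\<And>j. \<bar>k j\<bar> \<le> C * weight a j" using assms unfolding decaying_def by blast
  then have "\<bar>c * k j\<bar> \<le> (\<bar>c\<bar> * C) * weight a j" for j
    by (simp add: abs_mult mult.assoc mult_left_mono)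
  then show ?thesis unfolding decaying_def by blast
qed

lemma decaying_delta_right: assumes "a \<ge> 0" "decaying a k" shows "decaying a (delta_right k)"
  using decaying_add[OF assms(2) decaying_cmult[OF decaying_shift[OF assms, of 1], of "- 1"]]
  by (simp add: delta_right_def [abs_def])

text \<open>Written as a linear combination of shifts with explicit coefficients, so that the
  closure properties under sums, multiples and shifts apply literally.\<close>

lemma laplacian_eq_delta_right: "laplacian f n = 1 * delta_right f (n + (- 1)) + (- 1) * delta_right f n"
  by (simp add: laplacian_def delta_right_def)

lemma decaying_laplacian: assumes "a \<ge> 0" "decaying a k" shows "decaying a (laplacian k)"
  unfolding laplacian_eq_delta_right [abs_def]
  by (intro decaying_add decaying_cmult decaying_shift decaying_delta_right assms)

lemma tempered_shift: assumes "a \<ge> 0" "tempered a f" shows "tempered a (\<lambda>j. f (j + c))"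
proof -
  have b: "bij_betw (\<lambda>i. i + c) UNIV (UNIV::int set)"
    by (intro bij_betwI[where g="\<lambda>k. k - c"]) auto
  have "(\<lambda>j. f (j + c) * weight a (j + c)) summable_on UNIV"
    using summable_on_reindex_bij_betw[OF b, of "\<lambda>j. f j * weight a j"] assms(2) by (simp add: tempered_def)
  then have "(\<lambda>j. 1 / weight a c * \<bar>f (j + c) * weight a (j + c)\<bar>) summable_on UNIV"
    by (intro summable_on_cmult_right summable_on_abs_real)
  then show ?thesis unfolding tempered_def
  proof (rule summable_on_real_comparison)
    fix j
    have "weight a j \<le> weight a (j + c) / weight a c"
      using weight_shift_le[OF assms(1), of "j + c" "- c"] by simp
    then have "\<bar>f (j + c)\<bar> * weight a j \<le> \<bar>f (j + c)\<bar> * (weight a (j + c) / weight a c)"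
      by (intro mult_left_mono) auto
    then show "\<bar>f (j + c) * weight a j\<bar> \<le> 1 / weight a c * \<bar>f (j + c) * weight a (j + c)\<bar>"
      by (simp add: abs_mult)
  qed
qed

lemma tempered_lincomb: "tempered a f \<Longrightarrow> tempered a g \<Longrightarrow> tempered a (\<lambda>j. c * f j + d * g j)"
  unfolding tempered_def distrib_right mult.assoc by (intro summable_on_add summable_on_cmult_right)

lemma tempered_delta_right: "a \<ge> 0 \<Longrightarrow> tempered a f \<Longrightarrow> tempered a (delta_right f)"
  using tempered_lincomb[of a f "\<lambda>j. f (j + 1)" 1 "- 1"] tempered_shift[of a f 1]
  by (simp add: delta_right_def [abs_def])

lemma tempered_laplacian: "a \<ge> 0 \<Longrightarrow> tempered a f \<Longrightarrow> tempered a (laplacian f)"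
  unfolding laplacian_eq_delta_right [abs_def]
  by (intro tempered_lincomb tempered_shift tempered_delta_right)

lemma conv_shift_right: "conv k (\<lambda>j. f (j + c)) n = conv k f (n + c)"
proof -
  have b: "bij_betw (\<lambda>i. i + c) UNIV (UNIV::int set)"
    by (intro bij_betwI[where g="\<lambda>k. k - c"]) auto
  show ?thesis
    using infsum_reindex_bij_betw[OF b, of "\<lambda>j. k (n + c - j) * f j"] by (simp add: conv_def)
qed

lemma conv_shift_left: "conv (\<lambda>j. k (j + c)) f n = conv k f (n + c)"
  by (simp add: conv_def algebra_simps)

lemma conv_lincomb_right:
  assumes "a \<ge> 0" "decaying a k" "tempered a f" "tempered a g"
  shows "conv k (\<lambda>j. c * f j + d * g j) n = c * conv k f n + d * conv k g n"
proof -
  note s = conv_summable[OF assms(1,2), of _ n]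
  have "conv k (\<lambda>j. c * f j + d * g j) n = (\<Sum>\<^sub>\<infinity>j. c * (k (n - j) * f j) + d * (k (n - j) * g j))"
    by (simp add: conv_def algebra_simps)
  also have "\<dots> = c * conv k f n + d * conv k g n"
    by (simp add: conv_def infsum_add infsum_cmult_right summable_on_cmult_right s assms)
  finally show ?thesis .
qed

lemma conv_lincomb_left:
  assumes "a \<ge> 0" "decaying a k" "decaying a k'" "tempered a f"
  shows "conv (\<lambda>j. c * k j + d * k' j) f n = c * conv k f n + d * conv k' f n"
proof -
  note s = conv_summable[OF assms(1) _ assms(4), of _ n]
  have "conv (\<lambda>j. c * k j + d * k' j) f n = (\<Sum>\<^sub>\<infinity>j. c * (k (n - j) * f j) + d * (k' (n - j) * f j))"
    by (simp add: conv_def algebra_simps)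
  also have "\<dots> = c * conv k f n + d * conv k' f n"
    by (simp add: conv_def infsum_add infsum_cmult_right summable_on_cmult_right s assms)
  finally show ?thesis .
qed

lemma delta_right_conv_left:
  assumes "a \<ge> 0" "decaying a k" "tempered a f"
  shows "delta_right (conv k f) = conv (delta_right k) f"
  using conv_lincomb_left[OF assms(1,2) decaying_shift[OF assms(1,2), of 1] assms(3), of 1 "- 1"]
  by (auto simp: fun_eq_iff delta_right_def [abs_def] conv_shift_left)

lemma delta_right_conv_right:
  assumes "a \<ge> 0" "decaying a k" "tempered a f"
  shows "delta_right (conv k f) = conv k (delta_right f)"
  using conv_lincomb_right[OF assms(1-3) tempered_shift[OF assms(1,3), of 1], of 1 "- 1"]
  by (auto simp: fun_eq_iff delta_right_def [abs_def] conv_shift_right)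

lemma laplacian_conv_left:
  assumes "a \<ge> 0" "decaying a k" "tempered a f"
  shows "laplacian (conv k f) = conv (laplacian k) f"
proof
  fix n
  note d = decaying_delta_right[OF assms(1,2)]
  show "laplacian (conv k f) n = conv (laplacian k) f n"
    unfolding laplacian_eq_delta_right [abs_def] delta_right_conv_left[OF assms]
    by (subst conv_lincomb_left[OF assms(1) decaying_shift[OF assms(1) d] d assms(3)]) (simp only: conv_shift_left)
qed

lemma laplacian_conv_right:
  assumes "a \<ge> 0" "decaying a k" "tempered a f"
  shows "laplacian (conv k f) = conv k (laplacian f)"
proof
  fix n
  note d = tempered_delta_right[OF assms(1,3)]
  show "laplacian (conv k f) n = conv k (laplacian f) n"
    unfolding laplacian_eq_delta_right [abs_def] delta_right_conv_right[OF assms]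
    by (subst conv_lincomb_right[OF assms(1,2) tempered_shift[OF assms(1) d] d]) (simp only: conv_shift_right)
qed

text \<open>Young's inequality for sequences whose p-norm may be infinite: the growth condition
  guarantees that the convolution is a genuine sum, bounded by the sum of the moduli.\<close>

lemma lp_norm_conv_le:
  assumes p: "1 \<le> p" and a: "a \<ge> 0" "decaying a k" "tempered a f"
  shows "lp_norm p (conv k f) \<le> (\<integral>\<^sup>+j. ennreal \<bar>k j\<bar> \<partial>count_space UNIV) * lp_norm p f"
proof -
  have "ennreal \<bar>conv k f n\<bar> \<le> (\<integral>\<^sup>+j. ennreal \<bar>k j\<bar> * ennreal \<bar>f (n - j)\<bar> \<partial>count_space UNIV)" for n
  proof -
    have b: "bij_betw (\<lambda>j. n - j) UNIV (UNIV::int set)"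
      by (intro bij_betwI[where g="\<lambda>k. n - k"]) auto
    have "ennreal \<bar>conv k f n\<bar> \<le> (\<integral>\<^sup>+j. ennreal \<bar>k (n - j) * f j\<bar> \<partial>count_space UNIV)"
      unfolding conv_def by (intro abs_infsum_le_nn_integral conv_summable[OF a])
    also have "\<dots> = (\<integral>\<^sup>+j. ennreal \<bar>k j * f (n - j)\<bar> \<partial>count_space UNIV)"
      using nn_integral_bij_count_space[OF b, of "\<lambda>j. ennreal \<bar>k j * f (n - j)\<bar>"] by simp
    finally show ?thesis by (simp add: abs_mult ennreal_mult)
  qed
  then have "lp_norm p (conv k f) \<le> lp_ennnorm p (\<lambda>n. \<integral>\<^sup>+j. ennreal \<bar>k j\<bar> * ennreal \<bar>f (n - j)\<bar> \<partial>count_space UNIV)"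
    unfolding lp_norm_eq_lp_ennnorm by (rule lp_ennnorm_mono)
  also have "\<dots> \<le> (\<integral>\<^sup>+j. ennreal \<bar>k j\<bar> \<partial>count_space UNIV) * lp_ennnorm p (\<lambda>n. ennreal \<bar>f n\<bar>)"
    by (rule young_lp_ennnorm[OF p])
  finally show ?thesis by (simp add: lp_norm_eq_lp_ennnorm)
qed

section \<open>Fourier series\<close>

text \<open>Mean over one period. Only real cosine series occur, because all kernels are
  even.\<close>

definition circ :: "(real \<Rightarrow> real) \<Rightarrow> real" where
  "circ f = integral {0..2 * pi} f / (2 * pi)"

lemma circ_eq_lebesgue:
  assumes "continuous_on {0..2 * pi} f"
  shows "circ f = (\<integral>\<theta>. f \<theta> \<partial>restrict_space lborel {0..2 * pi}) / (2 * pi)"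
    and "integrable (restrict_space lborel {0..2 * pi}) f"
proof -
  have i: "set_integrable lborel {0..2 * pi} f" by (rule borel_integrable_atLeastAtMost'[OF assms])
  show "integrable (restrict_space lborel {0..2 * pi}) f"
    using i by (simp add: integrable_restrict_space set_integrable_def)
  have "(\<integral>\<theta>. f \<theta> \<partial>restrict_space lborel {0..2 * pi}) = integral {0..2 * pi} f"
    using set_borel_integral_eq_integral(2)[OF i]
    by (simp add: integral_restrict_space set_lebesgue_integral_def)
  then show "circ f = (\<integral>\<theta>. f \<theta> \<partial>restrict_space lborel {0..2 * pi}) / (2 * pi)"
    by (simp add: circ_def)
qed

lemma abs_circ_le:
  assumes "continuous_on {0..2 * pi} f" "\<And>\<theta>. \<theta> \<in> {0..2 * pi} \<Longrightarrow> \<bar>f \<theta>\<bar> \<le> B"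
  shows "\<bar>circ f\<bar> \<le> B"
proof -
  have "norm (integral {0..2 * pi} f) \<le> B * (2 * pi - 0)"
    using assms by (intro integral_bound) auto
  then show ?thesis by (simp add: circ_def field_simps)
qed

lemma circ_infsum:
  fixes a :: "int \<Rightarrow> real" and \<phi> :: "int \<Rightarrow> real \<Rightarrow> real"
  assumes a: "a summable_on UNIV"
    and c: "\<And>j. continuous_on {0..2 * pi} (\<phi> j)"
    and b: "\<And>j \<theta>. \<theta> \<in> {0..2 * pi} \<Longrightarrow> \<bar>\<phi> j \<theta>\<bar> \<le> B"
  shows "circ (\<lambda>\<theta>. \<Sum>\<^sub>\<infinity>j. a j * \<phi> j \<theta>) = (\<Sum>\<^sub>\<infinity>j. a j * circ (\<phi> j))"
proof -
  let ?M = "restrict_space lborel {0..2 * pi}"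
  have B: "B \<ge> 0" using b[of 0 0] by (auto intro: order_trans[OF abs_ge_zero])
  have bb: "\<bar>a j * \<phi> j \<theta>\<bar> \<le> B * \<bar>a j\<bar>" if "\<theta> \<in> {0..2 * pi}" for j \<theta>
    using mult_left_mono[OF b[OF that, of j], of "\<bar>a j\<bar>"] by (simp add: abs_mult mult.commute)
  have cj: "continuous_on {0..2 * pi} (\<lambda>\<theta>. a j * \<phi> j \<theta>)" for j by (intro continuous_intros c)
  have sB: "(\<lambda>j. B * \<bar>a j\<bar>) summable_on UNIV" by (intro summable_on_cmult_right summable_on_abs_real a)
  have int: "integrable ?M (\<lambda>\<theta>. a j * \<phi> j \<theta>)" for j by (rule circ_eq_lebesgue(2)[OF cj])
  have s: "(\<lambda>j. a j * \<phi> j \<theta>) summable_on UNIV" if "\<theta> \<in> {0..2 * pi}" for \<theta>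
    by (rule summable_on_real_comparison[OF sB]) (use bb that in auto)
  have cint: "(\<integral>\<theta>. f \<theta> \<partial>?M) = 2 * pi * circ f" if "continuous_on {0..2 * pi} f" for f
    using circ_eq_lebesgue(1)[OF that] by simp
  have b': "(\<lambda>j. \<integral>\<theta>. \<bar>a j * \<phi> j \<theta>\<bar> \<partial>?M) summable_on UNIV"
  proof (rule summable_on_real_comparison)
    show "(\<lambda>j. 2 * pi * (B * \<bar>a j\<bar>)) summable_on UNIV" by (intro summable_on_cmult_right sB)
    fix j
    have ca: "continuous_on {0..2 * pi} (\<lambda>\<theta>. \<bar>a j * \<phi> j \<theta>\<bar>)" by (intro continuous_intros cj)
    have "\<bar>circ (\<lambda>\<theta>. \<bar>a j * \<phi> j \<theta>\<bar>)\<bar> \<le> B * \<bar>a j\<bar>"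
      by (rule abs_circ_le[OF ca]) (use bb in auto)
    then show "\<bar>\<integral>\<theta>. \<bar>a j * \<phi> j \<theta>\<bar> \<partial>?M\<bar> \<le> 2 * pi * (B * \<bar>a j\<bar>)"
      unfolding cint[OF ca] by (simp add: abs_mult)
  qed
  have sp: "(\<lambda>j. a j * \<phi> j \<theta>) summable_on UNIV" if "\<theta> \<in> space ?M" for \<theta>
    using that by (intro s) (simp add: space_restrict_space)
  note I = integral_infsum[OF int sp b']
  \<comment> \<open>Uniform convergence makes the sum continuous, so its gauge integral in
    \<open>circ\<close> agrees with the Lebesgue integral used for the exchange.\<close>
  have "uniform_limit {0..2 * pi} (\<lambda>X \<theta>. \<Sum>j\<in>X. a j * \<phi> j \<theta>) (\<lambda>\<theta>. \<Sum>\<^sub>\<infinity>j. a j * \<phi> j \<theta>) (finite_subsets_at_top UNIV)"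
    by (rule Weierstrass_m_test_general[OF _ sB]) (use bb in auto)
  then have csum: "continuous_on {0..2 * pi} (\<lambda>\<theta>. \<Sum>\<^sub>\<infinity>j. a j * \<phi> j \<theta>)"
    by (rule uniform_limit_theorem[rotated]) (auto intro!: always_eventually continuous_on_sum cj)
  have "2 * pi * circ (\<lambda>\<theta>. \<Sum>\<^sub>\<infinity>j. a j * \<phi> j \<theta>) = (\<Sum>\<^sub>\<infinity>j. \<integral>\<theta>. a j * \<phi> j \<theta> \<partial>?M)"
    using I(2) cint[OF csum] by simp
  also have "\<dots> = (\<Sum>\<^sub>\<infinity>j. 2 * pi * (a j * circ (\<phi> j)))"
    by (intro infsum_cong) (simp only: cint[OF cj], simp add: circ_def)
  also have "\<dots> = 2 * pi * (\<Sum>\<^sub>\<infinity>j. a j * circ (\<phi> j))"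
  proof (rule infsum_cmult_right)
    show "(\<lambda>j. a j * circ (\<phi> j)) summable_on UNIV"
    proof (rule summable_on_real_comparison[OF sB])
      fix j show "\<bar>a j * circ (\<phi> j)\<bar> \<le> B * \<bar>a j\<bar>"
        using mult_left_mono[OF abs_circ_le[OF c b], of "\<bar>a j\<bar>" j] by (simp add: abs_mult mult.commute)
    qed
  qed
  finally show ?thesis by simp
qed

lemma circ_cos: "circ (\<lambda>\<theta>. cos (real_of_int m * \<theta>)) = (if m = 0 then 1 else 0)"
proof (cases "m = 0")
  case True then show ?thesis by (simp add: circ_def)
next
  case False
  have "((\<lambda>\<theta>. cos (real_of_int m * \<theta>)) has_integral
      (sin (real_of_int m * (2 * pi)) / real_of_int m - sin (real_of_int m * 0) / real_of_int m)) {0..2 * pi}"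
    using False by (intro fundamental_theorem_of_calculus)
      (auto intro!: derivative_eq_intros simp: has_real_derivative_iff_has_vector_derivative[symmetric])
  moreover have "sin (real_of_int m * (2 * pi)) = 0"
    using sin_zero_iff_int2[of "real_of_int m * (2 * pi)"] by (auto intro: exI[of _ "2 * m"])
  ultimately show ?thesis using False by (simp add: circ_def integral_unique)
qed

lemma circ_cos_cos:
  "circ (\<lambda>\<theta>. cos (real_of_int j * \<theta>) * cos (real_of_int n * \<theta>))
    = ((if j = n then 1 else 0) + (if j = - n then 1 else 0)) / 2"
proof -
  have "(\<lambda>\<theta>. cos (real_of_int j * \<theta>) * cos (real_of_int n * \<theta>))
    = (\<lambda>\<theta>. (1/2) * (cos (real_of_int (j - n) * \<theta>) + cos (real_of_int (j + n) * \<theta>)))"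
    by (auto simp: cos_add cos_diff algebra_simps)
  moreover have "circ (\<lambda>\<theta>. (1/2) * (cos (real_of_int (j - n) * \<theta>) + cos (real_of_int (j + n) * \<theta>)))
     = (1/2) * (circ (\<lambda>\<theta>. cos (real_of_int (j - n) * \<theta>)) + circ (\<lambda>\<theta>. cos (real_of_int (j + n) * \<theta>)))"
    unfolding circ_def
    by (subst integral_mult_right, subst Henstock_Kurzweil_Integration.integral_add)
       (auto intro!: integrable_continuous_interval continuous_intros simp: field_simps)
  ultimately show ?thesis unfolding circ_cos by (auto simp: add_eq_0_iff)
qed

text \<open>Orthogonality of cosines picks out the indices \<open>n\<close> and \<open>- n\<close>
  with weight 1/2 each, and evenness adds the two halves; for \<open>n = 0\<close> there is a single
  term of weight 1.\<close>

lemma fourier_coeff: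
  assumes a: "a summable_on UNIV" and even: "\<And>j. a (- j) = a j"
  shows "a n = circ (\<lambda>\<theta>. (\<Sum>\<^sub>\<infinity>j. a j * cos (real_of_int j * \<theta>)) * cos (real_of_int n * \<theta>))"
proof -
  have s: "(\<lambda>j. a j * cos (real_of_int j * \<theta>)) summable_on UNIV" for \<theta>
    by (rule summable_on_real_comparison[OF summable_on_abs_real[OF a]]) (simp add: abs_mult mult_left_le)
  have "circ (\<lambda>\<theta>. (\<Sum>\<^sub>\<infinity>j. a j * cos (real_of_int j * \<theta>)) * cos (real_of_int n * \<theta>))
     = circ (\<lambda>\<theta>. \<Sum>\<^sub>\<infinity>j. a j * (cos (real_of_int j * \<theta>) * cos (real_of_int n * \<theta>)))"
    using infsum_cmult_left[OF s] by (simp add: mult.assoc)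
  also have "\<dots> = (\<Sum>\<^sub>\<infinity>j. a j * circ (\<lambda>\<theta>. cos (real_of_int j * \<theta>) * cos (real_of_int n * \<theta>)))"
    by (rule circ_infsum[OF a, where B=1]) (auto intro!: continuous_intros mult_le_one simp: abs_mult)
  also have "\<dots> = (\<Sum>\<^sub>\<infinity>j\<in>{n, - n}. a j * circ (\<lambda>\<theta>. cos (real_of_int j * \<theta>) * cos (real_of_int n * \<theta>)))"
    by (rule infsum_cong_neutral) (auto simp: circ_cos_cos)
  also have "\<dots> = a n" using even[of n] by (cases "n = 0") (auto simp: circ_cos_cos circ_def)
  finally show ?thesis by simp
qed

text \<open>The second factor enters through its symbol \<open>B\<close> alone, so the lemma also
  multiplies \<open>poisson_kernel'\<close>, defined by its symbol, with the Poisson kernel.\<close>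

lemma fourier_conv:
  assumes a: "a summable_on UNIV" and even: "\<And>j. a (- j) = a j" and B: "continuous_on {0..2 * pi} B"
    and b: "\<And>n. b n = circ (\<lambda>\<theta>. B \<theta> * cos (real_of_int n * \<theta>))"
  shows "conv a b n = circ (\<lambda>\<theta>. (\<Sum>\<^sub>\<infinity>j. a j * cos (real_of_int j * \<theta>)) * B \<theta> * cos (real_of_int n * \<theta>))"
proof -
  have bij: "bij_betw (\<lambda>j. n - j) UNIV (UNIV::int set)"
    by (intro bij_betwI[where g="\<lambda>k. n - k"]) auto
  obtain C where C: "\<And>\<theta>. \<theta> \<in> {0..2 * pi} \<Longrightarrow> \<bar>B \<theta>\<bar> \<le> C"
    using compact_imp_bounded[OF compact_continuous_image[OF B compact_Icc]] unfolding bounded_iff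
    by (metis imageI real_norm_def)
  have s: "(\<lambda>j. a j * cos (real_of_int j * \<theta>)) summable_on UNIV" for \<theta>
    by (rule summable_on_real_comparison[OF summable_on_abs_real[OF a]]) (simp add: abs_mult mult_left_le)
  have s': "(\<lambda>j. a j * sin (real_of_int j * \<theta>)) summable_on UNIV" for \<theta>
    by (rule summable_on_real_comparison[OF summable_on_abs_real[OF a]]) (simp add: abs_mult mult_left_le)
  \<comment> \<open>Expanding cos((n - j) \<theta>) leaves a sine sum, which evenness of the
    coefficients annihilates.\<close>
  have odd: "(\<Sum>\<^sub>\<infinity>j. a j * sin (real_of_int j * \<theta>)) = 0" for \<theta>
  proof -
    have bm: "bij_betw (\<lambda>j. - j) UNIV (UNIV::int set)" by (intro bij_betwI[where g="\<lambda>k. - k"]) auto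
    have "(\<Sum>\<^sub>\<infinity>j. a j * sin (real_of_int j * \<theta>)) = (\<Sum>\<^sub>\<infinity>j. a (- j) * sin (real_of_int (- j) * \<theta>))"
      using infsum_reindex_bij_betw[OF bm, of "\<lambda>j. a j * sin (real_of_int j * \<theta>)"] by simp
    also have "\<dots> = - (\<Sum>\<^sub>\<infinity>j. a j * sin (real_of_int j * \<theta>))"
      using infsum_uminus[of "\<lambda>j. a j * sin (real_of_int j * \<theta>)" UNIV] by (simp add: even)
    finally show ?thesis by simp
  qed
  have "conv a b n = (\<Sum>\<^sub>\<infinity>j. a j * b (n - j))"
    using infsum_reindex_bij_betw[OF bij, of "\<lambda>j. a (n - j) * b j"] by (simp add: conv_def)
  also have "\<dots> = (\<Sum>\<^sub>\<infinity>j. a j * circ (\<lambda>\<theta>. B \<theta> * cos (real_of_int (n - j) * \<theta>)))"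
    by (simp add: b)
  also have "\<dots> = circ (\<lambda>\<theta>. \<Sum>\<^sub>\<infinity>j. a j * (B \<theta> * cos (real_of_int (n - j) * \<theta>)))"
  proof (rule circ_infsum[OF a, where B=C, symmetric])
    fix j :: int and \<theta> :: real assume \<theta>: "\<theta> \<in> {0..2 * pi}"
    have "\<bar>B \<theta>\<bar> * \<bar>cos (real_of_int (n - j) * \<theta>)\<bar> \<le> \<bar>B \<theta>\<bar> * 1" by (intro mult_left_mono) auto
    then show "\<bar>B \<theta> * cos (real_of_int (n - j) * \<theta>)\<bar> \<le> C" using C[OF \<theta>] by (simp add: abs_mult)
  qed (intro continuous_intros B)
  also have "(\<lambda>\<theta>. \<Sum>\<^sub>\<infinity>j. a j * (B \<theta> * cos (real_of_int (n - j) * \<theta>)))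
    = (\<lambda>\<theta>. (\<Sum>\<^sub>\<infinity>j. a j * cos (real_of_int j * \<theta>)) * B \<theta> * cos (real_of_int n * \<theta>))"
  proof
    fix \<theta>
    have "(\<Sum>\<^sub>\<infinity>j. a j * (B \<theta> * cos (real_of_int (n - j) * \<theta>)))
      = (\<Sum>\<^sub>\<infinity>j. (B \<theta> * cos (real_of_int n * \<theta>)) * (a j * cos (real_of_int j * \<theta>))
            + (B \<theta> * sin (real_of_int n * \<theta>)) * (a j * sin (real_of_int j * \<theta>)))"
      by (simp add: left_diff_distrib cos_diff algebra_simps)
    also have "\<dots> = (B \<theta> * cos (real_of_int n * \<theta>)) * (\<Sum>\<^sub>\<infinity>j. a j * cos (real_of_int j * \<theta>))"
      using s[of \<theta>] s'[of \<theta>] odd[of \<theta>] by (subst infsum_add) (simp_all add: infsum_cmult_right summable_on_cmult_right)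
    finally show "(\<Sum>\<^sub>\<infinity>j. a j * (B \<theta> * cos (real_of_int (n - j) * \<theta>)))
      = (\<Sum>\<^sub>\<infinity>j. a j * cos (real_of_int j * \<theta>)) * B \<theta> * cos (real_of_int n * \<theta>)" by simp
  qed
  finally show ?thesis .
qed

lemma has_real_derivative_circ_exp:
  assumes \<phi>: "continuous_on UNIV \<phi>" and \<psi>: "continuous_on UNIV \<psi>"
  shows "((\<lambda>s. circ (\<lambda>\<theta>. exp (- (s * \<phi> \<theta>)) * \<psi> \<theta>)) has_real_derivative
     circ (\<lambda>\<theta>. exp (- (s * \<phi> \<theta>)) * (- \<phi> \<theta> * \<psi> \<theta>))) (at s)"
proof -
  have "((\<lambda>s. integral (cbox 0 (2 * pi)) (\<lambda>\<theta>. exp (- (s * \<phi> \<theta>)) * \<psi> \<theta>)) has_field_derivative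
     integral (cbox 0 (2 * pi)) (\<lambda>\<theta>. exp (- (s * \<phi> \<theta>)) * (- \<phi> \<theta> * \<psi> \<theta>))) (at s within UNIV)"
  proof (rule leibniz_rule_field_derivative)
    fix s :: real
    show "(\<lambda>\<theta>. exp (- (s * \<phi> \<theta>)) * \<psi> \<theta>) integrable_on cbox 0 (2 * pi)"
      by (intro integrable_continuous continuous_intros continuous_on_subset[OF \<phi>] continuous_on_subset[OF \<psi>]) auto
    fix \<theta>
    show "((\<lambda>s. exp (- (s * \<phi> \<theta>)) * \<psi> \<theta>) has_field_derivative exp (- (s * \<phi> \<theta>)) * (- \<phi> \<theta> * \<psi> \<theta>)) (at s within UNIV)"
      by (auto intro!: derivative_eq_intros)
  next
    show "continuous_on (UNIV \<times> cbox 0 (2 * pi)) (\<lambda>(s, \<theta>). exp (- (s * \<phi> \<theta>)) * (- \<phi> \<theta> * \<psi> \<theta>))"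
      unfolding case_prod_beta'
      by (intro continuous_intros continuous_on_compose2[OF \<phi>] continuous_on_compose2[OF \<psi>]) auto
  qed auto
  then show ?thesis unfolding circ_def cbox_interval by (rule DERIV_cdivide)
qed

lemma circ_cong: "(\<And>\<theta>. \<theta> \<in> {0..2 * pi} \<Longrightarrow> f \<theta> = g \<theta>) \<Longrightarrow> circ f = circ g"
  unfolding circ_def by (intro arg_cong2[where f="(/)"] integral_cong) auto

lemma circ_add:
  "continuous_on {0..2 * pi} f \<Longrightarrow> continuous_on {0..2 * pi} g \<Longrightarrow> circ (\<lambda>\<theta>. f \<theta> + g \<theta>) = circ f + circ g"
  unfolding circ_def
  by (subst Henstock_Kurzweil_Integration.integral_add)
     (auto intro: integrable_continuous_interval simp: add_divide_distrib)

lemma circ_cmult: "circ (\<lambda>\<theta>. c * f \<theta>) = c * circ f"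
  unfolding circ_def by simp

lemma laplacian_symbol:
  fixes \<theta> x :: real
  shows
  "- (4 * (sin (\<theta> / 2))\<^sup>2) * cos (x * \<theta>) = cos ((x + 1) * \<theta>) - 2 * cos (x * \<theta>) + cos ((x - 1) * \<theta>)"
proof -
  have "cos \<theta> = 1 - 2 * (sin (\<theta> / 2))\<^sup>2"
    using cos_double_sin[of "\<theta> / 2 :: real"] by simp
  then have "4 * (sin (\<theta> / 2))\<^sup>2 = 2 - 2 * cos \<theta>" by simp
  moreover have "cos ((x + 1) * \<theta>) + cos ((x - 1) * \<theta>) = 2 * cos (x * \<theta>) * cos \<theta>"
    by (simp add: algebra_simps cos_add cos_diff)
  moreover have "- (2 - 2 * cos \<theta>) * cos (x * \<theta>) = 2 * cos (x * \<theta>) * cos \<theta> - 2 * cos (x * \<theta>)"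
    by (simp add: algebra_simps)
  ultimately show ?thesis by simp
qed

lemma laplacian_circ:
  assumes "continuous_on {0..2 * pi} B"
  shows "laplacian (\<lambda>n. circ (\<lambda>\<theta>. B \<theta> * cos (real_of_int n * \<theta>))) n
     = circ (\<lambda>\<theta>. B \<theta> * (- (4 * (sin (\<theta> / 2))\<^sup>2) * cos (real_of_int n * \<theta>)))"
proof -
  have c: "continuous_on {0..2 * pi} (\<lambda>\<theta>. B \<theta> * cos (x * \<theta>))" for x by (intro continuous_intros assms)
  have "circ (\<lambda>\<theta>. B \<theta> * (- (4 * (sin (\<theta> / 2))\<^sup>2) * cos (real_of_int n * \<theta>)))
    = circ (\<lambda>\<theta>. (B \<theta> * cos ((real_of_int n + 1) * \<theta>) + (- 2) * (B \<theta> * cos (real_of_int n * \<theta>)))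
          + B \<theta> * cos ((real_of_int n - 1) * \<theta>))"
    unfolding laplacian_symbol by (intro circ_cong) (simp add: algebra_simps)
  also have "\<dots> = circ (\<lambda>\<theta>. B \<theta> * cos ((real_of_int n + 1) * \<theta>)) + (- 2) * circ (\<lambda>\<theta>. B \<theta> * cos (real_of_int n * \<theta>))
       + circ (\<lambda>\<theta>. B \<theta> * cos ((real_of_int n - 1) * \<theta>))"
    by (simp only: circ_add circ_cmult c continuous_on_add continuous_on_mult_left)
  finally show ?thesis by (simp add: laplacian_def)
qed

section \<open>The heat kernel as a correlation of Poisson weights\<close>

text \<open>Poisson weights extended by 0 to negative indices, so that shifts and convolutions live
  on the integers.\<close>

definition pois :: "real \<Rightarrow> int \<Rightarrow> real" where
  "pois t i = (if i < 0 then 0 else exp (- t) * t ^ nat i / fact (nat i))"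

lemma pois_nonneg: "t \<ge> 0 \<Longrightarrow> pois t i \<ge> 0"
  by (simp add: pois_def)

text \<open>Valid at every integer, since both sides vanish for i <= 0. It yields the moments and
  also expresses the difference of neighbouring weights as a multiple of one weight.\<close>

lemma pois_shift: "real_of_int i * pois t i = t * pois t (i - 1)"
proof -
  consider "i < 0" | "i = 0" | m where "i = int (Suc m)"
    by (metis int_cases linorder_not_less of_nat_0 not0_implies_Suc of_nat_less_0_iff zero_le_imp_eq_int not_le)
  then show ?thesis
  proof cases
    case 3
    then have i: "nat i = Suc m" "nat (i - 1) = m" "real_of_int i = real (Suc m)" by auto
    have "real (Suc m) * (exp (- t) * t ^ Suc m / fact (Suc m)) = t * (exp (- t) * t ^ m / fact m)"
      unfolding fact_Suc by (simp del: of_nat_Suc)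
    then show ?thesis using 3 unfolding pois_def i by simp
  qed (auto simp: pois_def)
qed

lemma has_sum_int_of_nat:
  fixes h :: "int \<Rightarrow> 'a::banach"
  assumes "\<And>i. i < 0 \<Longrightarrow> h i = 0" "summable (\<lambda>n. norm (h (int n)))" "(\<lambda>n. h (int n)) sums S"
  shows "(h has_sum S) UNIV"
proof -
  have "((\<lambda>n. h (int n)) has_sum S) UNIV" using assms(2,3) by (rule norm_summable_imp_has_sum)
  then have "(h has_sum S) (range int)" by (subst has_sum_reindex) (auto simp: o_def)
  moreover have "(h has_sum S) (range int) \<longleftrightarrow> (h has_sum S) UNIV"
  proof (rule has_sum_cong_neutral)
    fix x :: int assume "x \<in> UNIV - range int"
    then have "x < 0" by (metis DiffD2 rangeI zero_le_imp_eq_int not_le)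
    then show "h x = 0" by (rule assms(1))
  qed auto
  ultimately show ?thesis by simp
qed

text \<open>The generating function; \<open>z = 1\<close> gives the total mass and
  \<open>z = cis \<theta>\<close> the characteristic function.\<close>

lemma pois_has_sum_complex:
  "((\<lambda>i. of_real (pois t i) * z powi i) has_sum exp (of_real t * (z - 1))) UNIV" for z :: complex
proof (rule has_sum_int_of_nat)
  have eq: "of_real (pois t (int n)) * z powi (int n) = exp (- of_real t) * ((of_real t * z) ^ n /\<^sub>R fact n)" for n
    by (simp add: pois_def exp_of_real[symmetric] power_mult_distrib scaleR_conv_of_real field_simps)
  have "summable (\<lambda>n. norm (exp (- complex_of_real t)) * norm ((of_real t * z) ^ n /\<^sub>R fact n))"
    by (intro summable_mult summable_norm_exp)
  then show "summable (\<lambda>n. norm (of_real (pois t (int n)) * z powi (int n)))"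
    unfolding eq norm_mult .
  have "(\<lambda>n. exp (- of_real t) * ((of_real t * z) ^ n /\<^sub>R fact n)) sums (exp (- of_real t) * exp (of_real t * z))"
    by (intro sums_mult exp_converges)
  also have "exp (- of_real t) * exp (of_real t * z) = exp (of_real t * (z - 1))"
    by (simp add: exp_add[symmetric] algebra_simps)
  finally show "(\<lambda>n. of_real (pois t (int n)) * z powi (int n)) sums exp (of_real t * (z - 1))"
    unfolding eq .
qed (auto simp: pois_def)

lemma pois_has_sum: "(pois t has_sum 1) UNIV"
proof -
  have "((\<lambda>i. Re (of_real (pois t i) * 1 powi i)) has_sum Re (exp (of_real t * (1 - 1)))) UNIV"
    by (intro has_sum_Re pois_has_sum_complex)
  then show ?thesis by simp
qed

lemma pois_summable: "pois t summable_on UNIV"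
  using pois_has_sum by (rule has_sum_imp_summable)

lemma pois_le_1: assumes "t \<ge> 0" shows "pois t i \<le> 1"
proof -
  have "sum (pois t) {i} \<le> infsum (pois t) UNIV"
    by (rule finite_sum_le_infsum) (auto simp: pois_summable pois_nonneg assms)
  also have "\<dots> = 1" by (rule infsumI[OF pois_has_sum])
  finally show ?thesis by simp
qed

lemma has_sum_int_shift: "((\<lambda>i. f (i + c)) has_sum S) UNIV \<longleftrightarrow> (f has_sum S) (UNIV :: int set)"
  by (rule has_sum_reindex_bij_betw) (intro bij_betwI[where g="\<lambda>k. k - c"], auto)

lemma pois_mean: "((\<lambda>i. real_of_int i * pois t i) has_sum t) UNIV"
proof -
  have "((\<lambda>i. pois t (i + (- 1))) has_sum 1) UNIV" unfolding has_sum_int_shift by (rule pois_has_sum)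
  from has_sum_cmult_right[OF this, of t] show ?thesis by (simp add: pois_shift)
qed

lemma pois_second_moment: "((\<lambda>i. (real_of_int i)\<^sup>2 * pois t i) has_sum (t\<^sup>2 + t)) UNIV"
proof -
  have "((\<lambda>i. real_of_int (i + (- 1)) * pois t (i + (- 1))) has_sum t) UNIV"
    by (subst has_sum_int_shift[of "\<lambda>i. real_of_int i * pois t i"]) (rule pois_mean)
  from has_sum_add[OF has_sum_cmult_right[OF this, of t] pois_mean[of t]]
  have "((\<lambda>i. t * (real_of_int (i + (- 1)) * pois t (i + (- 1))) + real_of_int i * pois t i) has_sum (t * t + t)) UNIV" .
  moreover have "t * (real_of_int (i + (- 1)) * pois t (i + (- 1))) + real_of_int i * pois t i = (real_of_int i)\<^sup>2 * pois t i" for i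
  proof -
    have "t * (real_of_int (i + (- 1)) * pois t (i + (- 1))) = real_of_int (i - 1) * (real_of_int i * pois t i)"
      by (simp add: pois_shift[of i t])
    then show ?thesis by (simp add: algebra_simps power2_eq_square)
  qed
  ultimately show ?thesis by (simp add: power2_eq_square)
qed

text \<open>The parameter \<open>s\<close> may differ from the normalisation \<open>t\<close>
  because an exponential tilt by \<open>w\<close> moves the parameter from \<open>t\<close> to
  \<open>t * w\<close>.\<close>

lemma pois_deviation:
  assumes t: "t > 0" and s: "s > 0"
  shows "((\<lambda>i. pois s i * (real_of_int i / t - 1)\<^sup>2) has_sum ((s / t - 1)\<^sup>2 + s / t\<^sup>2)) UNIV"
proof -
  have "((\<lambda>i. (1 / t\<^sup>2) * ((real_of_int i)\<^sup>2 * pois s i) + ((- 2 / t) * (real_of_int i * pois s i) + pois s i))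
     has_sum ((1 / t\<^sup>2) * (s\<^sup>2 + s) + ((- 2 / t) * s + 1))) UNIV"
    by (intro has_sum_add has_sum_cmult_right pois_mean pois_second_moment pois_has_sum)
  moreover have "(1 / t\<^sup>2) * ((real_of_int i)\<^sup>2 * pois s i) + ((- 2 / t) * (real_of_int i * pois s i) + pois s i)
     = pois s i * (real_of_int i / t - 1)\<^sup>2" for i
    using t by (simp add: power2_eq_square field_simps)
  moreover have "(1 / t\<^sup>2) * (s\<^sup>2 + s) + ((- 2 / t) * s + 1) = (s / t - 1)\<^sup>2 + s / t\<^sup>2"
    using t by (simp add: power2_eq_square field_simps)
  ultimately show ?thesis by simp
qed

text \<open>Weighted l^1 norm with values in \<open>[0, \<infinity>]\<close>. The weights used are
  the one-sided tilts \<open>w powi i\<close> and the two-sided ones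
  \<open>w ^ nat \<bar>i\<bar>\<close>.\<close>

definition wnorm :: "(int \<Rightarrow> real) \<Rightarrow> (int \<Rightarrow> real) \<Rightarrow> ennreal" where
  "wnorm v k = (\<integral>\<^sup>+j. ennreal (\<bar>k j\<bar> * v j) \<partial>count_space UNIV)"

text \<open>A submultiplicative weight makes the weighted l^1 space a convolution algebra, so tilted
  bounds multiply over the factors of a convolution.\<close>

lemma wnorm_conv_le:
  assumes s: "\<And>n. (\<lambda>j. k (n - j) * f j) summable_on UNIV"
    and v: "\<And>i. v i \<ge> 0" "\<And>i j. v (i + j) \<le> v i * v j"
  shows "wnorm v (conv k f) \<le> wnorm v k * wnorm v f"
proof -
  have b: "bij_betw (\<lambda>n. n - j) UNIV (UNIV::int set)" for j
    by (intro bij_betwI[where g="\<lambda>k. k + j"]) auto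
  have "ennreal (\<bar>conv k f n\<bar> * v n)
     \<le> (\<integral>\<^sup>+j. ennreal (\<bar>k (n - j)\<bar> * v (n - j)) * ennreal (\<bar>f j\<bar> * v j) \<partial>count_space UNIV)" for n
  proof -
    have "ennreal (\<bar>conv k f n\<bar> * v n) = ennreal \<bar>conv k f n\<bar> * ennreal (v n)"
      using v by (simp add: ennreal_mult)
    also have "\<dots> \<le> (\<integral>\<^sup>+j. ennreal \<bar>k (n - j) * f j\<bar> \<partial>count_space UNIV) * ennreal (v n)"
      unfolding conv_def by (intro mult_right_mono abs_infsum_le_nn_integral s) auto
    also have "\<dots> = (\<integral>\<^sup>+j. ennreal (\<bar>k (n - j) * f j\<bar> * v n) \<partial>count_space UNIV)"
      using v by (simp add: nn_integral_multc ennreal_mult)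
    also have "\<dots> \<le> (\<integral>\<^sup>+j. ennreal (\<bar>k (n - j)\<bar> * v (n - j)) * ennreal (\<bar>f j\<bar> * v j) \<partial>count_space UNIV)"
    proof (intro nn_integral_mono)
      fix j
      have "\<bar>k (n - j) * f j\<bar> * v n \<le> \<bar>k (n - j) * f j\<bar> * (v (n - j) * v j)"
        using v(2)[of "n - j" j] by (intro mult_left_mono) auto
      also have "\<dots> = (\<bar>k (n - j)\<bar> * v (n - j)) * (\<bar>f j\<bar> * v j)" by (simp add: abs_mult mult_ac)
      finally show "ennreal (\<bar>k (n - j) * f j\<bar> * v n) \<le> ennreal (\<bar>k (n - j)\<bar> * v (n - j)) * ennreal (\<bar>f j\<bar> * v j)"
        using v(1) by (subst ennreal_mult[symmetric]) (auto intro!: ennreal_leI mult_nonneg_nonneg)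
    qed
    finally show ?thesis .
  qed
  then have "wnorm v (conv k f) \<le> (\<integral>\<^sup>+n. \<integral>\<^sup>+j. ennreal (\<bar>k (n - j)\<bar> * v (n - j)) * ennreal (\<bar>f j\<bar> * v j) \<partial>count_space UNIV \<partial>count_space UNIV)"
    unfolding wnorm_def by (intro nn_integral_mono)
  also have "\<dots> = (\<integral>\<^sup>+j. \<integral>\<^sup>+n. ennreal (\<bar>k (n - j)\<bar> * v (n - j)) * ennreal (\<bar>f j\<bar> * v j) \<partial>count_space UNIV \<partial>count_space UNIV)"
    by (rule nn_integral_count_space_nn_integral) auto
  also have "\<dots> = (\<integral>\<^sup>+j. wnorm v k * ennreal (\<bar>f j\<bar> * v j) \<partial>count_space UNIV)"
    using nn_integral_bij_count_space[OF b, of "\<lambda>n. ennreal (\<bar>k n\<bar> * v n)"]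
    by (simp add: nn_integral_multc wnorm_def)
  also have "\<dots> = wnorm v k * wnorm v f" by (simp add: nn_integral_cmult wnorm_def)
  finally show ?thesis .
qed

text \<open>Exponentially tilted Poisson weights are again Poisson weights up to a factor, so every
  tilted moment reduces to an ordinary one.\<close>

lemma pois_powi: assumes "w > 0" shows "pois t i * w powi i = exp (t * (w - 1)) * pois (t * w) i"
proof -
  have "exp (- t) = exp (t * (w - 1)) * exp (- (t * w))"
    by (simp add: exp_add[symmetric] algebra_simps)
  then show ?thesis by (auto simp: pois_def power_mult_distrib power_int_def)
qed

lemma wnorm_pois:
  assumes "t > 0" "w > 0"
  shows "wnorm (\<lambda>i. w powi i) (pois t) = ennreal (exp (t * (w - 1)))"
    and "wnorm (\<lambda>i. w powi i) (\<lambda>i. pois t (- i)) = ennreal (exp (t * (1 / w - 1)))"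
proof -
  have *: "wnorm (\<lambda>i. w powi i) (pois t) = ennreal (exp (t * (w - 1)))" if "w > 0" for w
  proof -
    have hs: "((\<lambda>i. \<bar>pois t i\<bar> * w powi i) has_sum (exp (t * (w - 1)) * 1)) UNIV"
      using has_sum_cmult_right[OF pois_has_sum, of "exp (t * (w - 1))" "t * w"] assms(1)
      by (simp add: pois_powi[OF that] pois_nonneg)
    show ?thesis unfolding wnorm_def
      using nn_integral_count_space_eq_infsum[OF has_sum_imp_summable[OF hs]] infsumI[OF hs] that by simp
  qed
  show "wnorm (\<lambda>i. w powi i) (pois t) = ennreal (exp (t * (w - 1)))" using assms by (intro *)
  have bm: "bij_betw (\<lambda>j. - j) UNIV (UNIV::int set)" by (intro bij_betwI[where g="\<lambda>k. - k"]) auto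
  have "wnorm (\<lambda>i. w powi i) (\<lambda>i. pois t (- i)) = wnorm (\<lambda>i. (1 / w) powi i) (pois t)"
    unfolding wnorm_def
    using nn_integral_bij_count_space[OF bm, of "\<lambda>n. ennreal (\<bar>pois t n\<bar> * (1 / w) powi n)"]
    by (simp add: power_int_minus power_int_one_over inverse_eq_divide)
  then show "wnorm (\<lambda>i. w powi i) (\<lambda>i. pois t (- i)) = ennreal (exp (t * (1 / w - 1)))"
    using * assms by simp
qed

text \<open>Since \<open>pois t (i - 1) - pois t i = (i / t - 1) * pois t i\<close>, the variation of the Poisson weights is
  a first absolute moment, which \<open>2 * \<bar>x\<bar> \<le> sqrt t * x\<^sup>2 + 1 / sqrt t\<close> reduces to the variance.\<close>

lemma wnorm_delta_pois:
  assumes t: "t > 0" and w: "w > 0"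
  shows "wnorm (\<lambda>i. w powi i) (delta_right (pois t))
    \<le> ennreal (exp (t * (w - 1)) * ((sqrt t * ((w - 1)\<^sup>2 + w / t) + 1 / sqrt t) / 2) / w)"
proof -
  define s where "s = t * w"
  have s: "s > 0" using t w by (simp add: s_def)
  have b: "bij_betw (\<lambda>n. n - 1) UNIV (UNIV::int set)"
    by (intro bij_betwI[where g="\<lambda>k. k + 1"]) auto
  define E where "E = exp (t * (w - 1))"
  have E: "E > 0" by (simp add: E_def)
  \<comment> \<open>The pointwise majorant given by the quadratic bound; \<open>E\<close> comes from
    the tilt and 1/w from moving the index by one in the power of \<open>w\<close>.\<close>
  define g where "g i = E / w * ((sqrt t / 2) * (pois s i * (real_of_int i / t - 1)\<^sup>2) + (1 / (2 * sqrt t)) * pois s i)" for i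
  have hs: "(g has_sum (E / w * ((sqrt t / 2) * ((s / t - 1)\<^sup>2 + s / t\<^sup>2) + (1 / (2 * sqrt t)) * 1))) UNIV"
    unfolding g_def by (intro has_sum_add has_sum_cmult_right pois_deviation pois_has_sum t s)
  have g0: "g i \<ge> 0" for i unfolding g_def using E w t s by (simp add: pois_nonneg)
  have "wnorm (\<lambda>i. w powi i) (delta_right (pois t))
     = (\<integral>\<^sup>+i. ennreal (\<bar>pois t (i - 1) - pois t i\<bar> * w powi (i - 1)) \<partial>count_space UNIV)"
    unfolding wnorm_def
    using nn_integral_bij_count_space[OF b, of "\<lambda>i. ennreal (\<bar>delta_right (pois t) i\<bar> * w powi i)"]
    by (simp add: delta_right_def)
  also have "\<dots> \<le> (\<integral>\<^sup>+i. ennreal (g i) \<partial>count_space UNIV)"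
  proof (intro nn_integral_mono ennreal_leI)
    fix i :: int
    define x where "x = real_of_int i / t - 1"
    have "pois t (i - 1) - pois t i = x * pois t i"
      using pois_shift[of i t] t by (simp add: x_def field_simps)
    then have "\<bar>pois t (i - 1) - pois t i\<bar> * w powi (i - 1) = \<bar>x\<bar> * (pois t i * w powi i) / w"
      using w t by (simp add: abs_mult pois_nonneg power_int_diff)
    also have "\<dots> = E / w * (\<bar>x\<bar> * pois s i)" by (simp add: pois_powi[OF w] E_def s_def)
    also have "\<bar>x\<bar> * pois s i \<le> (sqrt t / 2 * x\<^sup>2 + 1 / (2 * sqrt t)) * pois s i"
    proof (intro mult_right_mono)
      have "0 \<le> (sqrt t * \<bar>x\<bar> - 1)\<^sup>2 / (2 * sqrt t)" using t by simp
      also have "\<dots> = (t * x\<^sup>2 - 2 * (sqrt t * \<bar>x\<bar>) + 1) / (2 * sqrt t)"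
        using t by (simp add: power2_diff power_mult_distrib)
      also have "\<dots> = sqrt t / 2 * x\<^sup>2 + 1 / (2 * sqrt t) - \<bar>x\<bar>"
        using t by (simp add: field_simps)
      finally show "\<bar>x\<bar> \<le> sqrt t / 2 * x\<^sup>2 + 1 / (2 * sqrt t)" by simp
    qed (use s in \<open>simp add: pois_nonneg\<close>)
    finally show "\<bar>pois t (i - 1) - pois t i\<bar> * w powi (i - 1) \<le> g i"
      unfolding g_def x_def[symmetric] using E w by (simp add: algebra_simps divide_right_mono)
  qed
  also have "\<dots> = ennreal (infsum g UNIV)"
    by (rule nn_integral_count_space_eq_infsum[OF has_sum_imp_summable[OF hs]]) (use g0 in auto)
  also have "infsum g UNIV = E / w * ((sqrt t / 2) * ((s / t - 1)\<^sup>2 + s / t\<^sup>2) + (1 / (2 * sqrt t)) * 1)"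
    by (rule infsumI[OF hs])
  also have "\<dots> = E * ((sqrt t * ((w - 1)\<^sup>2 + w / t) + 1 / sqrt t) / 2) / w"
    using t w by (simp add: s_def power2_eq_square field_simps)
  finally show ?thesis by (simp add: E_def)
qed

text \<open>Splitting exp(- 2t) evenly between two factors turns the k-th term of the Bessel series
  into the probability that the two Poisson variables equal \<open>n + k\<close> and
  \<open>k\<close>.\<close>

lemma heat_kernel_eq_correlation:
  assumes t: "t > 0"
  shows "(\<lambda>k. pois t (n + k) * pois t k) summable_on UNIV"
    and "heat_kernel t n = (\<Sum>\<^sub>\<infinity>k. pois t (n + k) * pois t k)"
proof -
  show s: "(\<lambda>k. pois t (n + k) * pois t k) summable_on UNIV"
    by (rule summable_on_real_comparison[OF pois_summable[of t]])
      (use t pois_nonneg[of t] pois_le_1[of t] in \<open>auto simp: abs_mult mult_left_le_one_le\<close>)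
  have term_eq: "exp (- 2 * t) * (rGamma (of_int (n + int k + 1)) / fact k * (2 * t / 2) powi (n + 2 * int k))
      = pois t (n + int k) * pois t (int k)" for k
  \<comment> \<open>In this case the reciprocal Gamma function is evaluated at an integer <= 0 and
    vanishes, as does the Poisson weight at a negative index.\<close>
  proof (cases "n + int k < 0")
    case True
    then have "(of_int (n + int k + 1) :: real) \<in> \<int>\<^sub>\<le>\<^sub>0" by (intro nonpos_Ints_of_int) auto
    then have "rGamma (of_int (n + int k + 1) :: real) = 0" by (simp only: rGamma_eq_zero_iff)
    then show ?thesis using True by (simp only: pois_def) simp
  next
    case False
    define m where "m = nat (n + int k)"
    have m: "n + int k = int m" using False by (simp add: m_def)
    have "(of_int (n + int k + 1) :: real) = 1 + of_nat m" using m by simp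
    then have "rGamma (of_int (n + int k + 1) :: real) = 1 / fact m"
      by (simp only: rGamma_inverse_Gamma Gamma_fact) (simp add: inverse_eq_divide)
    moreover have "(2 * t / 2) powi (n + 2 * int k) = t ^ m * t ^ k"
    proof -
      have "n + 2 * int k = int (m + k)" using m by simp
      then show ?thesis by (simp add: power_add del: of_nat_add)
    qed
    moreover have "exp (- 2 * t) = exp (- t) * exp (- t)" by (simp add: exp_add[symmetric])
    ultimately show ?thesis using m by (simp add: pois_def)
  qed
  have "((\<lambda>k. pois t (n + k) * pois t k) has_sum (\<Sum>\<^sub>\<infinity>k. pois t (n + k) * pois t k)) UNIV"
    using s by (rule has_sum_infsum)
  also have "?this \<longleftrightarrow> ((\<lambda>k. pois t (n + k) * pois t k) has_sum (\<Sum>\<^sub>\<infinity>k. pois t (n + k) * pois t k)) (range int)"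
  proof (rule has_sum_cong_neutral)
    fix x :: int assume "x \<in> UNIV - range int"
    then have "x < 0" by (metis DiffD2 rangeI zero_le_imp_eq_int not_le)
    then show "pois t (n + x) * pois t x = 0" by (simp add: pois_def)
  qed auto
  finally have "((\<lambda>k. pois t (n + int k) * pois t (int k)) has_sum (\<Sum>\<^sub>\<infinity>k. pois t (n + k) * pois t k)) UNIV"
    by (subst (asm) has_sum_reindex) (auto simp: o_def)
  then have sums: "(\<lambda>k. pois t (n + int k) * pois t (int k)) sums (\<Sum>\<^sub>\<infinity>k. pois t (n + k) * pois t k)"
    by (rule has_sum_imp_sums)
  then have "(\<lambda>k. exp (2 * t) * (exp (- 2 * t) * (rGamma (of_int (n + int k + 1)) / fact k * (2 * t / 2) powi (n + 2 * int k))))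
     sums (exp (2 * t) * (\<Sum>\<^sub>\<infinity>k. pois t (n + k) * pois t k))"
    unfolding term_eq by (intro sums_mult)
  moreover have "exp (2 * t) * (exp (- 2 * t) * x) = x" for x
    by (simp add: mult.assoc[symmetric] exp_add[symmetric])
  ultimately have "(\<lambda>k. rGamma (of_int (n + int k + 1)) / fact k * (2 * t / 2) powi (n + 2 * int k))
     sums (exp (2 * t) * (\<Sum>\<^sub>\<infinity>k. pois t (n + k) * pois t k))" by (simp only:)
  then have "bessel_I n (2 * t) = exp (2 * t) * (\<Sum>\<^sub>\<infinity>k. pois t (n + k) * pois t k)"
    unfolding bessel_I_def by (rule sums_unique[symmetric])
  then show "heat_kernel t n = (\<Sum>\<^sub>\<infinity>k. pois t (n + k) * pois t k)"
    by (simp add: heat_kernel_def mult.assoc[symmetric] exp_add[symmetric])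
qed

lemma heat_kernel_nonneg: "t > 0 \<Longrightarrow> heat_kernel t n \<ge> 0"
  by (simp add: heat_kernel_eq_correlation infsum_nonneg pois_nonneg)

lemma heat_kernel_minus: assumes "t > 0" shows "heat_kernel t (- n) = heat_kernel t n"
proof -
  have b: "bij_betw (\<lambda>k. k - n) UNIV (UNIV::int set)"
    by (intro bij_betwI[where g="\<lambda>k. k + n"]) auto
  show ?thesis
    using infsum_reindex_bij_betw[OF b, of "\<lambda>k. pois t (n + k) * pois t k"]
    by (simp add: heat_kernel_eq_correlation(2) assms mult.commute)
qed

lemma heat_kernel_eq_conv_pois:
  assumes "t > 0" shows "heat_kernel t = conv (pois t) (\<lambda>i. pois t (- i))"
proof
  fix n
  have b: "bij_betw (\<lambda>k. - k) UNIV (UNIV::int set)"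
    by (intro bij_betwI[where g="\<lambda>k. - k"]) auto
  show "heat_kernel t n = conv (pois t) (\<lambda>i. pois t (- i)) n"
    using infsum_reindex_bij_betw[OF b, of "\<lambda>k. pois t (n + k) * pois t k"]
    by (simp add: heat_kernel_eq_correlation(2) assms conv_def)
qed

lemma pois_minus_summable: "(\<lambda>i. pois t (- i)) summable_on UNIV"
proof -
  have b: "bij_betw (\<lambda>k. - k) UNIV (UNIV::int set)"
    by (intro bij_betwI[where g="\<lambda>k. - k"]) auto
  show ?thesis using summable_on_reindex_bij_betw[OF b, of "pois t"] pois_summable by simp
qed

lemma powi_subadd: "w > 0 \<Longrightarrow> (w::real) powi (i + j) \<le> w powi i * w powi j"
  by (simp add: power_int_add)

text \<open>The linear terms of the two tilts cancel: (w - 1) + (1/w - 1) = (w - 1)^2 / w. Being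
  quadratic in w - 1, the exponent allows a tilt of size 1/sqrt t at bounded cost.\<close>

lemma wnorm_heat_kernel:
  assumes "t > 0" "w > 0"
  shows "wnorm (\<lambda>i. w powi i) (heat_kernel t) \<le> ennreal (exp (t * ((w - 1)\<^sup>2 / w)))"
proof -
  have "wnorm (\<lambda>i. w powi i) (heat_kernel t)
     \<le> wnorm (\<lambda>i. w powi i) (pois t) * wnorm (\<lambda>i. w powi i) (\<lambda>i. pois t (- i))"
    unfolding heat_kernel_eq_conv_pois[OF assms(1)] using assms
    by (intro wnorm_conv_le summable_on_bounded_mult[where B=1] powi_subadd pois_minus_summable)
       (auto simp: pois_nonneg pois_le_1)
  also have "\<dots> = ennreal (exp (t * (w - 1)) * exp (t * (1 / w - 1)))"
    using assms by (simp add: wnorm_pois ennreal_mult)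
  also have "exp (t * (w - 1)) * exp (t * (1 / w - 1)) = exp (t * ((w - 1)\<^sup>2 / w))"
    using assms by (simp add: exp_add[symmetric] power2_eq_square field_simps)
  finally show ?thesis .
qed

text \<open>The difference falls on one Poisson factor, whose variation is controlled, while the
  other keeps its exponential moment.\<close>

lemma delta_heat_kernel:
  assumes "t > 0" shows "delta_right (heat_kernel t) = conv (delta_right (pois t)) (\<lambda>i. pois t (- i))"
proof
  fix n
  have s: "(\<lambda>j. pois t (m - j) * pois t (- j)) summable_on UNIV" for m
    using assms by (intro summable_on_bounded_mult[where B=1] pois_minus_summable) (auto simp: pois_nonneg pois_le_1)
  have "conv (delta_right (pois t)) (\<lambda>i. pois t (- i)) n
     = (\<Sum>\<^sub>\<infinity>j. pois t (n - j) * pois t (- j) - pois t (n + 1 - j) * pois t (- j))"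
    by (simp add: conv_def delta_right_def algebra_simps)
  also have "\<dots> = conv (pois t) (\<lambda>i. pois t (- i)) n - conv (pois t) (\<lambda>i. pois t (- i)) (n + 1)"
    unfolding conv_def
    using infsumI[OF has_sum_add[OF has_sum_infsum[OF s[of n]] has_sum_cmult_right[OF has_sum_infsum[OF s[of "n + 1"]], of "- 1"]]]
    by simp
  finally show "delta_right (heat_kernel t) n = conv (delta_right (pois t)) (\<lambda>i. pois t (- i)) n"
    unfolding heat_kernel_eq_conv_pois[OF assms] by (simp add: delta_right_def)
qed

lemma wnorm_delta_heat_kernel:
  assumes t: "t > 0" and w: "w > 0"
  shows "wnorm (\<lambda>i. w powi i) (delta_right (heat_kernel t))
    \<le> ennreal (exp (t * ((w - 1)\<^sup>2 / w)) * ((sqrt t * ((w - 1)\<^sup>2 + w / t) + 1 / sqrt t) / 2) / w)"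
proof -
  define X where "X = (sqrt t * ((w - 1)\<^sup>2 + w / t) + 1 / sqrt t) / 2"
  have X: "X \<ge> 0" using t w by (simp add: X_def)
  have "\<bar>delta_right (pois t) i\<bar> \<le> 2" for i
    using pois_nonneg[of t i] pois_nonneg[of t "i + 1"] pois_le_1[of t i] pois_le_1[of t "i + 1"] t
    by (simp add: delta_right_def abs_le_iff)
  then have "wnorm (\<lambda>i. w powi i) (delta_right (heat_kernel t))
     \<le> wnorm (\<lambda>i. w powi i) (delta_right (pois t)) * wnorm (\<lambda>i. w powi i) (\<lambda>i. pois t (- i))"
    unfolding delta_heat_kernel[OF t] using w
    by (intro wnorm_conv_le summable_on_bounded_mult[where B=2] powi_subadd pois_minus_summable) auto
  also have "\<dots> \<le> ennreal (exp (t * (w - 1)) * X / w) * ennreal (exp (t * (1 / w - 1)))"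
    using wnorm_delta_pois[OF t w] wnorm_pois(2)[OF t w] unfolding X_def by (intro mult_mono) auto
  also have "\<dots> = ennreal (exp (t * (w - 1)) * exp (t * (1 / w - 1)) * X / w)"
    using X w by (subst ennreal_mult[symmetric]) (auto simp: mult_ac)
  also have "exp (t * (w - 1)) * exp (t * (1 / w - 1)) = exp (t * ((w - 1)\<^sup>2 / w))"
    using t w by (simp add: exp_add[symmetric] power2_eq_square field_simps)
  finally show ?thesis by (simp add: X_def)
qed

text \<open>The case \<open>w = 1\<close>, in which the variance term and the constant term each
  contribute 1/(2 sqrt t).\<close>

lemma l1_delta_heat_kernel:
  assumes "t > 0"
  shows "(\<integral>\<^sup>+j. ennreal \<bar>delta_right (heat_kernel t) j\<bar> \<partial>count_space UNIV) \<le> ennreal (t powr (- 1 / 2))"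
proof -
  have "sqrt t / t = 1 / sqrt t" using assms by (simp add: field_simps)
  then show ?thesis
    using wnorm_delta_heat_kernel[OF assms, of 1] assms
    by (simp add: wnorm_def powr_minus_divide powr_half_sqrt)
qed

section \<open>The heat kernel: Fourier representation and decay\<close>

lemma correlation_infsum:
  fixes A B :: "int \<Rightarrow> real"
  assumes A: "A summable_on UNIV" and B: "B summable_on UNIV"
  shows "((\<lambda>n. \<Sum>\<^sub>\<infinity>k. A (n + k) * B k) has_sum (infsum A UNIV * infsum B UNIV)) UNIV"
proof -
  have b: "bij_betw (\<lambda>n. n + k) UNIV (UNIV::int set)" for k
    by (intro bij_betwI[where g="\<lambda>n. n - k"]) auto
  have As: "(\<lambda>n. A (n + k)) summable_on UNIV" for k
    using summable_on_reindex_bij_betw[OF b, of A] A by simp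
  have Ai: "(\<Sum>\<^sub>\<infinity>n. A (n + k)) = infsum A UNIV" for k by (rule infsum_reindex_bij_betw[OF b])
  have Ai': "(\<Sum>\<^sub>\<infinity>n. \<bar>A (n + k)\<bar>) = (\<Sum>\<^sub>\<infinity>n. \<bar>A n\<bar>)" for k by (rule infsum_reindex_bij_betw[OF b])
  let ?F = "\<lambda>(k, n). A (n + k) * B k"
  have "Infinite_Sum.abs_summable_on ?F (UNIV \<times> UNIV)"
    unfolding Infinite_Sum.abs_summable_on_Sigma_iff
  proof (intro conjI ballI)
    fix k :: int
    show "Infinite_Sum.abs_summable_on (\<lambda>n. ?F (k, n)) UNIV"
      using summable_on_abs_real[OF summable_on_cmult_left[OF As]] by simp
  next
    have eq: "(\<Sum>\<^sub>\<infinity>n. norm (?F (k, n))) = \<bar>B k\<bar> * (\<Sum>\<^sub>\<infinity>n. \<bar>A n\<bar>)" for k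
      using infsum_cmult_left[OF summable_on_abs_real[OF As[of k]], of "\<bar>B k\<bar>"] by (simp add: abs_mult Ai')
    have "(\<lambda>k. \<bar>\<bar>B k\<bar> * (\<Sum>\<^sub>\<infinity>n. \<bar>A n\<bar>)\<bar>) summable_on UNIV"
      by (intro summable_on_abs_real summable_on_cmult_left B)
    then show "Infinite_Sum.abs_summable_on (\<lambda>k. \<Sum>\<^sub>\<infinity>n. norm (?F (k, n))) UNIV"
      unfolding eq unfolding real_norm_def .
  qed
  then have s: "?F summable_on (UNIV \<times> UNIV)" by (rule abs_summable_summable)
  have "(\<Sum>\<^sub>\<infinity>n. \<Sum>\<^sub>\<infinity>k. A (n + k) * B k) = (\<Sum>\<^sub>\<infinity>k. \<Sum>\<^sub>\<infinity>n. A (n + k) * B k)"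
    using infsum_swap_banach[OF s] by simp
  also have "\<dots> = (\<Sum>\<^sub>\<infinity>k. infsum A UNIV * B k)"
    by (intro infsum_cong) (simp add: infsum_cmult_left As Ai)
  also have "\<dots> = infsum A UNIV * infsum B UNIV" by (rule infsum_cmult_right) (use B in simp)
  finally have eq: "(\<Sum>\<^sub>\<infinity>n. \<Sum>\<^sub>\<infinity>k. A (n + k) * B k) = infsum A UNIV * infsum B UNIV" .
  have "bij_betw prod.swap (UNIV \<times> UNIV :: (int \<times> int) set) (UNIV \<times> UNIV)"
    by (simp add: bij_betw_def)
  then have "(\<lambda>(n, k). A (n + k) * B k) summable_on (UNIV \<times> UNIV)"
    using s summable_on_reindex_bij_betw[of prod.swap "UNIV \<times> UNIV" "UNIV \<times> UNIV" ?F]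
    by (simp add: case_prod_beta')
  then have "(\<lambda>n. \<Sum>\<^sub>\<infinity>k. A (n + k) * B k) summable_on UNIV" by (rule summable_on_Sigma_banach)
  from has_sum_infsum[OF this] show ?thesis unfolding eq .
qed

text \<open>The characteristic function of a difference of two independent copies is the squared
  modulus of that of one copy. In real terms the correlations of the cosine and of the sine series
  add up by the addition formula.\<close>

lemma heat_kernel_fourier:
  assumes t: "t > 0"
  shows "((\<lambda>n. heat_kernel t n * cos (real_of_int n * \<theta>)) has_sum exp (- (t * (4 * (sin (\<theta> / 2))\<^sup>2)))) UNIV"
proof -
  have cis: "cis \<theta> powi i = cis (real_of_int i * \<theta>)" for i
    by (cases i rule: int_cases2) (auto simp: power_int_minus Complex.DeMoivre)
  note hs = pois_has_sum_complex[of t "cis \<theta>", unfolded cis]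
  define z where "z = exp (of_real t * (cis \<theta> - 1))"
  have c: "((\<lambda>i. pois t i * cos (real_of_int i * \<theta>)) has_sum Re z) UNIV"
    using has_sum_Re[OF hs] by (simp add: z_def)
  have s: "((\<lambda>i. pois t i * sin (real_of_int i * \<theta>)) has_sum Im z) UNIV"
    using has_sum_Im[OF hs] by (simp add: z_def)
  have "(Re z)\<^sup>2 + (Im z)\<^sup>2 = (norm z)\<^sup>2" by (simp add: cmod_power2)
  also have "norm z = exp (t * (cos \<theta> - 1))" by (simp add: z_def)
  also have "(exp (t * (cos \<theta> - 1)))\<^sup>2 = exp (- (t * (4 * (sin (\<theta> / 2))\<^sup>2)))"
  proof -
    have 4: "4 * (sin (\<theta> / 2))\<^sup>2 = 2 - 2 * cos \<theta>" using cos_double_sin[of "\<theta> / 2 :: real"] by simp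
    have "(exp (t * (cos \<theta> - 1)))\<^sup>2 = exp (t * (cos \<theta> - 1) + t * (cos \<theta> - 1))"
      by (simp only: power2_eq_square exp_add)
    also have "t * (cos \<theta> - 1) + t * (cos \<theta> - 1) = - (t * (2 - 2 * cos \<theta>))" by (simp add: algebra_simps)
    finally show ?thesis unfolding 4 .
  qed
  finally have z2: "Re z * Re z + Im z * Im z = exp (- (t * (4 * (sin (\<theta> / 2))\<^sup>2)))"
    by (simp add: power2_eq_square)
  let ?c = "\<lambda>i. pois t i * cos (real_of_int i * \<theta>)" and ?s = "\<lambda>i. pois t i * sin (real_of_int i * \<theta>)"
  have b1: "\<bar>?c i\<bar> \<le> 1" "\<bar>?s i\<bar> \<le> 1" for i
    using t pois_nonneg[of t i] pois_le_1[of t i] by (auto simp: abs_mult intro!: mult_le_one)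
  have "((\<lambda>n. (\<Sum>\<^sub>\<infinity>k. ?c (n + k) * ?c k) + (\<Sum>\<^sub>\<infinity>k. ?s (n + k) * ?s k)) has_sum (Re z * Re z + Im z * Im z)) UNIV"
    using has_sum_add[OF correlation_infsum[OF has_sum_imp_summable[OF c] has_sum_imp_summable[OF c]]
        correlation_infsum[OF has_sum_imp_summable[OF s] has_sum_imp_summable[OF s]]]
    by (simp only: infsumI[OF c] infsumI[OF s])
  moreover have "(\<Sum>\<^sub>\<infinity>k. ?c (n + k) * ?c k) + (\<Sum>\<^sub>\<infinity>k. ?s (n + k) * ?s k)
     = heat_kernel t n * cos (real_of_int n * \<theta>)" for n
  proof -
    have "(\<Sum>\<^sub>\<infinity>k. ?c (n + k) * ?c k) + (\<Sum>\<^sub>\<infinity>k. ?s (n + k) * ?s k)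
      = (\<Sum>\<^sub>\<infinity>k. ?c (n + k) * ?c k + ?s (n + k) * ?s k)"
      by (intro infsum_add[symmetric] summable_on_bounded_mult[where B=1] b1 has_sum_imp_summable[OF c] has_sum_imp_summable[OF s])
    also have "\<dots> = (\<Sum>\<^sub>\<infinity>k. pois t (n + k) * pois t k * cos (real_of_int n * \<theta>))"
    proof (intro infsum_cong)
      fix k
      have "cos (real_of_int n * \<theta>) = cos (real_of_int (n + k) * \<theta> - real_of_int k * \<theta>)"
        by (simp add: algebra_simps)
      also have "\<dots> = cos (real_of_int (n + k) * \<theta>) * cos (real_of_int k * \<theta>)
          + sin (real_of_int (n + k) * \<theta>) * sin (real_of_int k * \<theta>)" by (rule cos_diff)
      finally show "?c (n + k) * ?c k + ?s (n + k) * ?s k = pois t (n + k) * pois t k * cos (real_of_int n * \<theta>)"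
        by (simp only: algebra_simps)
    qed
    also have "\<dots> = heat_kernel t n * cos (real_of_int n * \<theta>)"
      using heat_kernel_eq_correlation[OF t, of n] by (simp add: infsum_cmult_left)
    finally show ?thesis .
  qed
  ultimately show ?thesis unfolding z2 by simp
qed

lemma heat_kernel_has_sum: "t > 0 \<Longrightarrow> (heat_kernel t has_sum 1) UNIV"
  using heat_kernel_fourier[of t 0] by simp

lemma heat_kernel_summable: "t > 0 \<Longrightarrow> heat_kernel t summable_on UNIV"
  using heat_kernel_has_sum by (rule has_sum_imp_summable)

lemma heat_kernel_circ:
  assumes "t > 0"
  shows "heat_kernel t n = circ (\<lambda>\<theta>. exp (- (t * (4 * (sin (\<theta> / 2))\<^sup>2))) * cos (real_of_int n * \<theta>))"
  using fourier_coeff[OF heat_kernel_summable[OF assms] heat_kernel_minus[OF assms], of n]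
  by (simp add: infsumI[OF heat_kernel_fourier[OF assms]])

lemma heat_kernel_semigroup:
  assumes "s > 0" "t > 0" shows "conv (heat_kernel s) (heat_kernel t) = heat_kernel (s + t)"
proof
  fix n
  have "conv (heat_kernel s) (heat_kernel t) n
    = circ (\<lambda>\<theta>. exp (- (s * (4 * (sin (\<theta> / 2))\<^sup>2))) * exp (- (t * (4 * (sin (\<theta> / 2))\<^sup>2))) * cos (real_of_int n * \<theta>))"
    by (subst fourier_conv[OF heat_kernel_summable heat_kernel_minus _ heat_kernel_circ[OF assms(2)]])
      (auto intro!: continuous_intros assms simp: infsumI[OF heat_kernel_fourier[OF assms(1)]])
  also have "\<dots> = heat_kernel (s + t) n"
    using assms by (simp add: heat_kernel_circ exp_add[symmetric] algebra_simps)
  finally show "conv (heat_kernel s) (heat_kernel t) n = heat_kernel (s + t) n" .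
qed

lemma heat_kernel_deriv:
  assumes "t > 0"
  shows "((\<lambda>s. heat_kernel s n) has_real_derivative laplacian (heat_kernel t) n) (at t)"
proof -
  have "((\<lambda>s. circ (\<lambda>\<theta>. exp (- (s * (4 * (sin (\<theta> / 2))\<^sup>2))) * cos (real_of_int n * \<theta>))) has_real_derivative
     circ (\<lambda>\<theta>. exp (- (t * (4 * (sin (\<theta> / 2))\<^sup>2))) * (- (4 * (sin (\<theta> / 2))\<^sup>2) * cos (real_of_int n * \<theta>)))) (at t)"
    by (intro has_real_derivative_circ_exp) (auto intro!: continuous_intros)
  also have "circ (\<lambda>\<theta>. exp (- (t * (4 * (sin (\<theta> / 2))\<^sup>2))) * (- (4 * (sin (\<theta> / 2))\<^sup>2) * cos (real_of_int n * \<theta>)))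
     = laplacian (heat_kernel t) n"
    unfolding heat_kernel_circ[OF assms, abs_def]
    by (rule laplacian_circ[symmetric]) (auto intro!: continuous_intros)
  finally show ?thesis
  proof (rule has_field_derivative_transform_within_open)
    fix s :: real assume "s \<in> {0<..}"
    then show "circ (\<lambda>\<theta>. exp (- (s * (4 * (sin (\<theta> / 2))\<^sup>2))) * cos (real_of_int n * \<theta>)) = heat_kernel s n"
      by (simp add: heat_kernel_circ)
  qed (use assms in auto)
qed

section \<open>Pointwise decay of the heat kernel and its differences\<close>

lemma powr_le_exp:
  assumes "a > 0" "x \<ge> (0::real)"
  shows "(1 + x) powr a \<le> (1 + 2 * a) powr a * exp (x / 2)"
proof -
  \<comment> \<open>The scale 2a is chosen so that the power \<open>a\<close> of exp(x / (2a)) is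
    exp(x / 2).\<close>
  have "1 + x \<le> (1 + 2 * a) * (1 + x / (2 * a))"
    using assms by (simp add: field_simps)
  also have "\<dots> \<le> (1 + 2 * a) * exp (x / (2 * a))"
    using assms by (intro mult_left_mono exp_ge_add_one_self) auto
  finally have "(1 + x) powr a \<le> ((1 + 2 * a) * exp (x / (2 * a))) powr a"
    using assms by (intro powr_mono2) auto
  also have "\<dots> = (1 + 2 * a) powr a * exp (x / (2 * a)) powr a" by (rule powr_mult)
  also have "exp (x / (2 * a)) powr a = exp (x / 2)"
    using assms by (simp add: powr_def)
  finally show ?thesis .
qed

lemma wnorm_ge_point: "ennreal (\<bar>k j\<bar> * v j) \<le> wnorm v k"
  unfolding wnorm_def by (rule nn_integral_ge_point) simp

lemma exp_half_le_two: "exp (1 / 2 :: real) \<le> 2"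
  using exp_bound[of "1/2::real"] by (simp add: power2_eq_square)

text \<open>The tilt \<open>w = 2\<close> costs exp(t/2), and exp(1/2) <= 2; the symmetry of the
  kernel covers negative \<open>n\<close>. The growth in \<open>t\<close> does no harm where only
  local uniformity in time is used.\<close>

lemma heat_kernel_le_exp:
  assumes t: "t > 0" shows "heat_kernel t n \<le> exp (t / 2) * exp (- \<bar>real_of_int n\<bar> / 2)"
proof -
  have *: "heat_kernel t n \<le> exp (t / 2) * exp (- real_of_int n / 2)" if "n \<ge> 0" for n
  proof -
    have "ennreal (\<bar>heat_kernel t n\<bar> * 2 powi n) \<le> ennreal (exp (t * ((2 - 1)\<^sup>2 / 2)))"
      using wnorm_ge_point wnorm_heat_kernel[OF t, of 2] by (rule order_trans) simp
    then have 1: "heat_kernel t n * 2 powi n \<le> exp (t / 2)"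
      using heat_kernel_nonneg[OF t] by (simp add: power2_eq_square)
    have "exp (real_of_int n / 2) = exp (1 / 2) ^ nat n"
      using that by (simp add: exp_of_nat_mult[symmetric])
    also have "\<dots> \<le> 2 ^ nat n" by (intro power_mono exp_half_le_two) simp
    also have "\<dots> = 2 powi n" using that by (simp add: power_int_def)
    finally have "heat_kernel t n * exp (real_of_int n / 2) \<le> exp (t / 2)"
      using mult_left_mono[OF _ heat_kernel_nonneg[OF t], of "exp (real_of_int n / 2)" "2 powi n" n] 1 by linarith
    then show ?thesis by (simp add: exp_minus field_simps)
  qed
  show ?thesis
  proof (cases "n \<ge> 0")
    case True then show ?thesis using *[of n] by simp
  next
    case False then show ?thesis using *[of "- n"] heat_kernel_minus[OF t, of n] by simp
  qed
qed

lemma heat_kernel_le_weight: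
  assumes a: "a > 0"
  shows "\<exists>C\<ge>0. \<forall>t>0. \<forall>n. \<bar>heat_kernel t n\<bar> \<le> exp (t / 2) * C * weight a n"
proof (intro exI[of _ "(1 + 2 * a) powr a"] conjI allI impI)
  fix t :: real and n assume t: "t > 0"
  have "(1 + \<bar>real_of_int n\<bar>) powr a * exp (- \<bar>real_of_int n\<bar> / 2) \<le> (1 + 2 * a) powr a"
    using powr_le_exp[OF a, of "\<bar>real_of_int n\<bar>"] by (simp add: exp_minus field_simps)
  then have "exp (- \<bar>real_of_int n\<bar> / 2) \<le> (1 + 2 * a) powr a * weight a n"
    by (simp add: weight_def powr_minus_divide field_simps add_pos_nonneg)
  then have "exp (t / 2) * exp (- \<bar>real_of_int n\<bar> / 2) \<le> exp (t / 2) * ((1 + 2 * a) powr a * weight a n)"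
    by (intro mult_left_mono) auto
  then show "\<bar>heat_kernel t n\<bar> \<le> exp (t / 2) * (1 + 2 * a) powr a * weight a n"
    using heat_kernel_le_exp[OF t, of n] heat_kernel_nonneg[OF t, of n]
    by (metis abs_of_nonneg mult.assoc order_trans)
qed simp

lemma decaying_heat_kernel: "a > 0 \<Longrightarrow> t > 0 \<Longrightarrow> decaying a (heat_kernel t)"
  using heat_kernel_le_weight[of a] unfolding decaying_def by blast

lemma wnorm_abs_le:
  assumes "w > 0"
  shows "wnorm (\<lambda>i. w ^ nat \<bar>i\<bar>) k \<le> wnorm (\<lambda>i. w powi i) k + wnorm (\<lambda>i. (1 / w) powi i) k"
proof -
  have "w ^ nat \<bar>i\<bar> \<le> w powi i + (1 / w) powi i" for i
    using assms by (auto simp: power_int_def power_one_over inverse_eq_divide)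
  then have le: "\<bar>k i\<bar> * w ^ nat \<bar>i\<bar> \<le> \<bar>k i\<bar> * w powi i + \<bar>k i\<bar> * (1 / w) powi i" for i
    using mult_left_mono[of "w ^ nat \<bar>i\<bar>" "w powi i + (1 / w) powi i" "\<bar>k i\<bar>"] by (simp add: distrib_left)
  have "wnorm (\<lambda>i. w ^ nat \<bar>i\<bar>) k \<le> (\<integral>\<^sup>+i. ennreal (\<bar>k i\<bar> * w powi i) + ennreal (\<bar>k i\<bar> * (1 / w) powi i) \<partial>count_space UNIV)"
    unfolding wnorm_def using assms le
    by (intro nn_integral_mono) (simp flip: ennreal_plus)
  also have "\<dots> = wnorm (\<lambda>i. w powi i) k + wnorm (\<lambda>i. (1 / w) powi i) k"
    unfolding wnorm_def by (rule nn_integral_add) auto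
  finally show ?thesis .
qed

text \<open>The tilt 1 + 1/sqrt t corresponds to the diffusive scale. For it and for its reciprocal
  the exponential factor is at most exp 1, hence at most 3.\<close>

lemma wnorm_abs_delta_heat_kernel:
  assumes t: "t \<ge> 1"
  shows "wnorm (\<lambda>i. (1 + 1 / sqrt t) ^ nat \<bar>i\<bar>) (delta_right (heat_kernel t)) \<le> ennreal (15 / sqrt t)"
proof -
  define w where "w = 1 + 1 / sqrt t"
  have w: "1 < w" "w \<le> 2" using t by (auto simp: w_def)
  then have w: "1 < w" "w \<le> 2" "w > 0" by auto
  have t0: "t > 0" using t by simp
  have w1: "(w - 1)\<^sup>2 = 1 / t" using t by (simp add: w_def power_divide)
  have w2: "(1 / w - 1)\<^sup>2 = 1 / t / w\<^sup>2"
  proof -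
    have "1 / w - 1 = - ((w - 1) / w)" using w by (simp add: field_simps)
    then show ?thesis by (simp only: power2_minus power_divide w1)
  qed
  have st: "sqrt t / t = 1 / sqrt t" "sqrt t > 0" using t by (auto simp: field_simps)
  have e3: "exp (1::real) \<le> 3" by (rule exp_le)
  have e: "exp (t * ((w - 1)\<^sup>2 / w)) \<le> 3"
  proof -
    have "t * ((w - 1)\<^sup>2 / w) \<le> 1" unfolding w1 using t w by simp
    then show ?thesis using e3 by (meson exp_le_cancel_iff order_trans)
  qed
  have e': "exp (t * ((1 / w - 1)\<^sup>2 / (1 / w))) \<le> 3"
  proof -
    have "t * ((1 / w - 1)\<^sup>2 / (1 / w)) \<le> 1" unfolding w2 using t w by (simp add: power2_eq_square)
    then show ?thesis using e3 by (meson exp_le_cancel_iff order_trans)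
  qed
  have x: "(sqrt t * ((w - 1)\<^sup>2 + w / t) + 1 / sqrt t) / 2 / w \<le> 2 / sqrt t"
  proof -
    have "(sqrt t * ((w - 1)\<^sup>2 + w / t) + 1 / sqrt t) / 2 = (w + 2) / 2 * (1 / sqrt t)"
      unfolding w1 st(1)[symmetric] using t0 by (simp add: field_simps)
    also have "\<dots> / w = ((w + 2) / 2 / w) * (1 / sqrt t)" by simp
    also have "\<dots> \<le> 2 * (1 / sqrt t)" using w st by (intro mult_right_mono) (auto simp: field_simps)
    finally show ?thesis by simp
  qed
  have x': "(sqrt t * ((1 / w - 1)\<^sup>2 + (1 / w) / t) + 1 / sqrt t) / 2 / (1 / w) \<le> 3 / sqrt t"
  proof -
    have "(sqrt t * ((1 / w - 1)\<^sup>2 + (1 / w) / t) + 1 / sqrt t) / 2 / (1 / w) = ((1 / w + 1 + w) / 2) * (1 / sqrt t)"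
      unfolding w2 st(1)[symmetric] using t0 w by (simp add: field_simps power2_eq_square)
    also have "\<dots> \<le> 3 * (1 / sqrt t)"
    proof (intro mult_right_mono)
      define u where "u = 1 / w"
      have "u \<le> 1" using w by (simp add: u_def)
      then show "(1 / w + 1 + w) / 2 \<le> 3" using w unfolding u_def[symmetric] by simp
    qed (use st in auto)
    finally show ?thesis by simp
  qed
  \<comment> \<open>The constant 15 is 3 * 2 + 3 * 3, one product for each direction of the
    tilt.\<close>
  have "wnorm (\<lambda>i. w ^ nat \<bar>i\<bar>) (delta_right (heat_kernel t)) \<le> ennreal (3 * (2 / sqrt t)) + ennreal (3 * (3 / sqrt t))"
  proof (rule order_trans[OF wnorm_abs_le[OF w(3)]], rule add_mono)
    have "exp (t * ((w - 1)\<^sup>2 / w)) * ((sqrt t * ((w - 1)\<^sup>2 + w / t) + 1 / sqrt t) / 2) / w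
      = exp (t * ((w - 1)\<^sup>2 / w)) * ((sqrt t * ((w - 1)\<^sup>2 + w / t) + 1 / sqrt t) / 2 / w)" by simp
    also have "\<dots> \<le> 3 * (2 / sqrt t)" using w t by (intro mult_mono e x) auto
    finally show "wnorm (\<lambda>i. w powi i) (delta_right (heat_kernel t)) \<le> ennreal (3 * (2 / sqrt t))"
      by (intro order_trans[OF wnorm_delta_heat_kernel[OF t0 w(3)]] ennreal_leI)
  next
    have "exp (t * ((1 / w - 1)\<^sup>2 / (1 / w))) * ((sqrt t * ((1 / w - 1)\<^sup>2 + (1 / w) / t) + 1 / sqrt t) / 2) / (1 / w)
      = exp (t * ((1 / w - 1)\<^sup>2 / (1 / w))) * ((sqrt t * ((1 / w - 1)\<^sup>2 + (1 / w) / t) + 1 / sqrt t) / 2 / (1 / w))" by simp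
    also have "\<dots> \<le> 3 * (3 / sqrt t)" using w t by (intro mult_mono e' x') auto
    finally show "wnorm (\<lambda>i. (1 / w) powi i) (delta_right (heat_kernel t)) \<le> ennreal (3 * (3 / sqrt t))"
      using w by (intro order_trans[OF wnorm_delta_heat_kernel[OF t0]] ennreal_leI) auto
  qed
  also have "\<dots> = ennreal (15 / sqrt t)" using t by (simp flip: ennreal_plus add: field_simps)
  finally show ?thesis unfolding w_def .
qed

lemma decaying_funpow_delta_right:
  "a \<ge> 0 \<Longrightarrow> decaying a k \<Longrightarrow> decaying a ((delta_right ^^ m) k)"
  by (induction m) (auto intro: decaying_delta_right)

text \<open>By the semigroup property the kernel at time (m + 1) s is a convolution of m + 1 kernels
  at time s. Each absorbs one difference, and the two-sided weight is submultiplicative.\<close>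

lemma wnorm_funpow_delta_heat_kernel:
  assumes s: "s \<ge> 1"
  shows "wnorm (\<lambda>i. (1 + 1 / sqrt s) ^ nat \<bar>i\<bar>) ((delta_right ^^ Suc m) (heat_kernel (real (Suc m) * s)))
     \<le> ennreal ((15 / sqrt s) ^ Suc m)"
proof (induction m)
  case 0
  then show ?case using wnorm_abs_delta_heat_kernel[OF s] by simp
next
  case (Suc m)
  have s0: "s > 0" using s by simp
  define w where "w = 1 + 1 / sqrt s"
  have w: "w \<ge> 1" using s by (simp add: w_def)
  let ?G = "heat_kernel (real (Suc m) * s)"
  have pos: "real (Suc m) * s > 0" using s0 by simp
  \<comment> \<open>Any exponent above 1 serves here; the decay only justifies the manipulation of
    convolutions.\<close>
  have d: "decaying 2 (heat_kernel s)" using s0 by (intro decaying_heat_kernel) auto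
  have d': "decaying 2 ((delta_right ^^ j) ?G)" for j
    using pos by (intro decaying_funpow_delta_right decaying_heat_kernel) auto
  have T: "tempered 2 ((delta_right ^^ j) ?G)" for j by (intro decaying_imp_tempered d') simp
  have "heat_kernel (real (Suc (Suc m)) * s) = conv (heat_kernel s) ?G"
    using heat_kernel_semigroup[OF s0 pos] by (simp add: algebra_simps)
  moreover have "(delta_right ^^ j) (conv (heat_kernel s) ?G) = conv (heat_kernel s) ((delta_right ^^ j) ?G)" for j
    by (induction j) (simp_all add: delta_right_conv_right[OF _ d T, simplified])
  ultimately have "(delta_right ^^ Suc (Suc m)) (heat_kernel (real (Suc (Suc m)) * s))
     = delta_right (conv (heat_kernel s) ((delta_right ^^ Suc m) ?G))"
    by (simp only: funpow.simps(2)[of "Suc m"] o_apply)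
  also have "\<dots> = conv (delta_right (heat_kernel s)) ((delta_right ^^ Suc m) ?G)"
    by (rule delta_right_conv_left[OF _ d T]) simp
  finally have eq: "(delta_right ^^ Suc (Suc m)) (heat_kernel (real (Suc (Suc m)) * s))
     = conv (delta_right (heat_kernel s)) ((delta_right ^^ Suc m) ?G)" .
  have "wnorm (\<lambda>i. w ^ nat \<bar>i\<bar>) (conv (delta_right (heat_kernel s)) ((delta_right ^^ Suc m) ?G))
     \<le> wnorm (\<lambda>i. w ^ nat \<bar>i\<bar>) (delta_right (heat_kernel s)) * wnorm (\<lambda>i. w ^ nat \<bar>i\<bar>) ((delta_right ^^ Suc m) ?G)"
  proof (rule wnorm_conv_le)
    show "(\<lambda>j. delta_right (heat_kernel s) (n - j) * (delta_right ^^ Suc m) ?G j) summable_on UNIV" for n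
      by (rule conv_summable[OF _ decaying_delta_right[OF _ d] T]) auto
    show "0 \<le> w ^ nat \<bar>i\<bar>" for i using w by simp
    show "w ^ nat \<bar>i + j\<bar> \<le> w ^ nat \<bar>i\<bar> * w ^ nat \<bar>j\<bar>" for i j
      unfolding power_add[symmetric] using w by (intro power_increasing) auto
  qed
  also have "\<dots> \<le> ennreal (15 / sqrt s) * ennreal ((15 / sqrt s) ^ Suc m)"
    unfolding w_def by (intro mult_mono Suc wnorm_abs_delta_heat_kernel s) auto
  also have "\<dots> = ennreal ((15 / sqrt s) ^ Suc (Suc m))"
    using s0 by (subst ennreal_mult[symmetric]) auto
  finally show ?case unfolding eq w_def .
qed

text \<open>\<open>k j\<close> is a telescoping sum of its differences from \<open>j\<close>
  outwards. Moving away from 0 the weight only grows, so the value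
  \<open>w ^ nat \<bar>j\<bar>\<close> can be replaced by the weight of each difference.\<close>

lemma sup_le_wnorm_delta:
  assumes a: "a > 0" and k: "decaying a k" and w: "w \<ge> 1"
  shows "ennreal (\<bar>k j\<bar> * w ^ nat \<bar>j\<bar>) \<le> wnorm (\<lambda>i. w ^ nat \<bar>i\<bar>) (delta_right k)" (is "_ \<le> ?W")
proof (cases "?W = top")
  case False
  obtain W where W: "?W = ennreal W" "W \<ge> 0" using False by (metis ennreal_cases)
  have fin: "(\<Sum>i\<in>A. \<bar>delta_right k i\<bar> * w ^ nat \<bar>i\<bar>) \<le> W" if "finite A" for A
  proof -
    have "ennreal (\<Sum>i\<in>A. \<bar>delta_right k i\<bar> * w ^ nat \<bar>i\<bar>) = (\<Sum>i\<in>A. ennreal (\<bar>delta_right k i\<bar> * w ^ nat \<bar>i\<bar>))"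
      using w by (intro sum_ennreal[symmetric]) auto
    also have "\<dots> = (\<integral>\<^sup>+i. ennreal (\<bar>delta_right k i\<bar> * w ^ nat \<bar>i\<bar>) \<partial>count_space A)"
      using that by (simp add: nn_integral_count_space_finite)
    also have "\<dots> \<le> ?W" unfolding wnorm_def
      by (subst nn_integral_count_space_indicator) (auto intro!: nn_integral_mono split: split_indicator)
    finally show ?thesis using W by simp
  qed
  obtain C where C: "C \<ge> 0" "\<And>j. \<bar>k j\<bar> \<le> C * weight a j" using decaying_bound[OF k] by blast
  \<comment> \<open>The decay of \<open>k\<close> is used only to make the far end of the
    telescoping sum vanish in both directions.\<close>
  have kn: "(\<lambda>N. k (j + s * int N)) \<longlonglongrightarrow> 0" if "s = 1 \<or> s = -1" for s
  proof (rule Lim_null_comparison)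
    show "eventually (\<lambda>N. norm (k (j + s * int N)) \<le> C * (1 + \<bar>real N - \<bar>real_of_int j\<bar>\<bar>) powr (- a)) sequentially"
    proof (intro always_eventually allI)
      fix N
      have "\<bar>real N - \<bar>real_of_int j\<bar>\<bar> \<le> \<bar>real_of_int (j + s * int N)\<bar>" using that by auto
      then have "weight a (j + s * int N) \<le> (1 + \<bar>real N - \<bar>real_of_int j\<bar>\<bar>) powr (- a)"
        unfolding weight_def using a by (intro powr_mono2') (auto simp: add_pos_nonneg)
      then show "norm (k (j + s * int N)) \<le> C * (1 + \<bar>real N - \<bar>real_of_int j\<bar>\<bar>) powr (- a)"
        using C(2)[of "j + s * int N"] mult_left_mono[OF _ C(1)] by (metis order_trans real_norm_def)
    qed
    have "(\<lambda>N. (1 + \<bar>real N - \<bar>real_of_int j\<bar>\<bar>) powr (- a)) \<longlonglongrightarrow> 0"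
    proof (rule tendsto_neg_powr)
      have "filterlim (\<lambda>N. (1 - \<bar>real_of_int j\<bar>) + real N) at_top sequentially"
        by (rule filterlim_tendsto_add_at_top[OF tendsto_const filterlim_real_sequentially])
      then show "filterlim (\<lambda>N. 1 + \<bar>real N - \<bar>real_of_int j\<bar>\<bar>) at_top sequentially"
        by (rule filterlim_at_top_mono) (auto intro!: always_eventually)
    qed (use a in auto)
    from tendsto_mult_left[OF this, of C]
    show "(\<lambda>N. C * (1 + \<bar>real N - \<bar>real_of_int j\<bar>\<bar>) powr (- a)) \<longlonglongrightarrow> 0" by simp
  qed
  have "\<bar>k j\<bar> * w ^ nat \<bar>j\<bar> \<le> W"
  proof (cases "j \<ge> 0")
    case True
    have le: "\<bar>k j - k (j + 1 * int N)\<bar> * w ^ nat \<bar>j\<bar> \<le> W" for N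
    proof -
      have "k j - k (j + int N) = (\<Sum>i<N. delta_right k (j + int i))"
        by (induction N) (auto simp: delta_right_def algebra_simps)
      then have "\<bar>k j - k (j + int N)\<bar> * w ^ nat \<bar>j\<bar> \<le> (\<Sum>i<N. \<bar>delta_right k (j + int i)\<bar>) * w ^ nat \<bar>j\<bar>"
        using w by (intro mult_right_mono) auto
      also have "\<dots> \<le> (\<Sum>i<N. \<bar>delta_right k (j + int i)\<bar> * w ^ nat \<bar>j + int i\<bar>)"
        unfolding sum_distrib_right using True w by (intro sum_mono mult_left_mono power_increasing) auto
      also have "\<dots> = (\<Sum>i\<in>(\<lambda>i. j + int i) ` {..<N}. \<bar>delta_right k i\<bar> * w ^ nat \<bar>i\<bar>)"
        by (subst sum.reindex) (auto simp: inj_on_def)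
      also have "\<dots> \<le> W" by (rule fin) simp
      finally show ?thesis by simp
    qed
    have "(\<lambda>N. \<bar>k j - k (j + 1 * int N)\<bar> * w ^ nat \<bar>j\<bar>) \<longlonglongrightarrow> \<bar>k j - 0\<bar> * w ^ nat \<bar>j\<bar>"
      by (intro tendsto_intros kn) simp
    then show ?thesis using le by (intro LIMSEQ_le_const2) auto
  next
    case False
    \<comment> \<open>To the left the first difference used has index \<open>j - 1\<close>, one step
      farther from 0 than \<open>j\<close>.\<close>
    have le: "\<bar>k (j + (-1) * int N) - k j\<bar> * w ^ nat \<bar>j\<bar> \<le> W" for N
    proof -
      have "k (j - int N) - k j = (\<Sum>i<N. delta_right k (j - 1 - int i))"
        by (induction N) (auto simp: delta_right_def algebra_simps)
      then have "\<bar>k (j - int N) - k j\<bar> * w ^ nat \<bar>j\<bar> \<le> (\<Sum>i<N. \<bar>delta_right k (j - 1 - int i)\<bar>) * w ^ nat \<bar>j\<bar>"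
        using w by (intro mult_right_mono) auto
      also have "\<dots> \<le> (\<Sum>i<N. \<bar>delta_right k (j - 1 - int i)\<bar> * w ^ nat \<bar>j - 1 - int i\<bar>)"
        unfolding sum_distrib_right using False w by (intro sum_mono mult_left_mono power_increasing) auto
      also have "\<dots> = (\<Sum>i\<in>(\<lambda>i. j - 1 - int i) ` {..<N}. \<bar>delta_right k i\<bar> * w ^ nat \<bar>i\<bar>)"
        by (subst sum.reindex) (auto simp: inj_on_def)
      also have "\<dots> \<le> W" by (rule fin) simp
      finally show ?thesis by simp
    qed
    have "(\<lambda>N. \<bar>k (j + (-1) * int N) - k j\<bar> * w ^ nat \<bar>j\<bar>) \<longlonglongrightarrow> \<bar>0 - k j\<bar> * w ^ nat \<bar>j\<bar>"
      by (intro tendsto_intros kn) simp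
    then have "\<bar>0 - k j\<bar> * w ^ nat \<bar>j\<bar> \<le> W" using le by (intro LIMSEQ_le_const2) auto
    then show ?thesis by simp
  qed
  then show ?thesis using W by (simp add: ennreal_leI)
qed simp

lemma exp_half_le_one_plus: assumes "0 \<le> x" "x \<le> (1::real)" shows "exp (x / 2) \<le> 1 + x"
proof -
  have "exp (x / 2) \<le> 1 + x / 2 + (x / 2)\<^sup>2" using assms by (intro exp_bound) auto
  also have "(x / 2)\<^sup>2 \<le> x / 2" 
    using assms mult_left_mono[of x 2 x] by (simp add: power2_eq_square)
  finally show ?thesis by simp
qed

text \<open>One more difference in l^1 bounds the supremum, which gives t^(-(k + 1)/2). Trading the
  localisation at scale sqrt t for the polynomial weight costs t^(a/2).\<close>

lemma funpow_delta_heat_kernel_le_weight: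
  assumes a: "a > 0"
  shows "\<exists>C. \<forall>t\<ge>real (Suc k). \<forall>j. \<bar>(delta_right ^^ k) (heat_kernel t) j\<bar>
     \<le> C * t powr ((a - real k - 1) / 2) * weight a j"
proof -
  define D where "D = (15 * sqrt (real (Suc k))) ^ Suc k"
  define E where "E = (1 + 2 * a) powr a"
  have "\<bar>(delta_right ^^ k) (heat_kernel t) j\<bar> \<le> D * E * t powr ((a - real k - 1) / 2) * weight a j"
    if t: "t \<ge> real (Suc k)" for t j
  proof -
    \<comment> \<open>The time is cut into \<open>Suc k\<close> equal pieces, one for each
      difference; the lower bound on \<open>t\<close> gives \<open>s \<ge> 1\<close>.\<close>
    define s where "s = t / real (Suc k)"
    have s: "s \<ge> 1" "s > 0" "s \<le> t" "t = real (Suc k) * s" "t \<ge> 1" "t > 0"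
      using t by (auto simp: s_def field_simps)
    define w where "w = 1 + 1 / sqrt s"
    define X where "X = \<bar>(delta_right ^^ k) (heat_kernel t) j\<bar>"
    define n where "n = nat \<bar>j\<bar>"
    have w: "w \<ge> 1" using s by (simp add: w_def)
    have "ennreal (X * w ^ n) \<le> wnorm (\<lambda>i. w ^ nat \<bar>i\<bar>) (delta_right ((delta_right ^^ k) (heat_kernel t)))"
      unfolding X_def n_def using a s by (intro sup_le_wnorm_delta[OF a] decaying_funpow_delta_right decaying_heat_kernel w) auto
    also have "\<dots> \<le> ennreal ((15 / sqrt s) ^ Suc k)"
      using wnorm_funpow_delta_heat_kernel[OF s(1), of k] unfolding w_def s(4) by simp
    finally have "X * w ^ n \<le> (15 / sqrt s) ^ Suc k" using s by (subst (asm) ennreal_le_iff) auto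
    also have "15 / sqrt s = (15 * sqrt (real (Suc k))) * t powr (- 1/2)"
      using s(6) by (simp add: s_def real_sqrt_divide powr_minus_divide powr_half_sqrt)
    also have "((15 * sqrt (real (Suc k))) * t powr (- 1/2)) ^ Suc k = D * t powr (- (real k + 1) / 2)"
    proof -
      have "(t powr (- 1/2)) ^ Suc k = t powr (- 1/2 * real (Suc k))"
        using s(6) by (simp only: powr_realpow[symmetric] powr_powr powr_gt_zero)
      also have "- 1/2 * real (Suc k) = - (real k + 1) / 2" by (simp add: field_simps)
      finally show ?thesis by (simp only: power_mult_distrib D_def)
    qed
    finally have 1: "X * w ^ n \<le> D * t powr (- (real k + 1) / 2)" .
    \<comment> \<open>The position is measured in units of sqrt t: 1 + n <= sqrt t (1 + n / sqrt t),
      and the second factor is beaten by the exponential gain from the tilt.\<close>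
    have 2: "(1 + real n) powr a \<le> t powr (a / 2) * (E * w ^ n)"
    proof -
      have st: "sqrt t \<ge> 1" using s(5) by simp
      have "sqrt t * (1 + real n / sqrt t) = sqrt t + real n" using st by (simp add: distrib_left)
      then have "1 + real n \<le> sqrt t * (1 + real n / sqrt t)" using st by simp
      then have "(1 + real n) powr a \<le> (sqrt t * (1 + real n / sqrt t)) powr a"
        using a by (intro powr_mono2) auto
      also have "\<dots> = t powr (a / 2) * (1 + real n / sqrt t) powr a"
        using s(6) by (simp add: powr_mult powr_half_sqrt[symmetric] powr_powr)
      also have "\<dots> \<le> t powr (a / 2) * (E * exp (real n / sqrt t / 2))"
        unfolding E_def using s(6) by (intro mult_left_mono powr_le_exp a) auto
      also have "exp (real n / sqrt t / 2) = exp (1 / sqrt t / 2) ^ n"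
        by (simp add: exp_of_nat_mult[symmetric])
      also have "\<dots> \<le> w ^ n"
      proof (intro power_mono)
        have "exp (1 / sqrt t / 2) \<le> 1 + 1 / sqrt t" using st by (intro exp_half_le_one_plus) auto
        \<comment> \<open>Since s <= t, the tilt used at scale sqrt s is the stronger one.\<close>
        also have "\<dots> \<le> w" unfolding w_def using s(2,3) by (auto intro!: divide_left_mono)
        finally show "exp (1 / sqrt t / 2) \<le> w" .
      qed simp
      finally show ?thesis by (simp add: E_def mult_left_mono)
    qed
    have X0: "X \<ge> 0" by (simp add: X_def)
    have "X * (1 + real n) powr a \<le> t powr (a / 2) * E * (X * w ^ n)"
      using mult_left_mono[OF 2 X0] by (simp add: mult_ac)
    also have "\<dots> \<le> t powr (a / 2) * E * (D * t powr (- (real k + 1) / 2))"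
      using 1 by (intro mult_left_mono) (auto simp: E_def)
    also have "\<dots> = D * E * (t powr (a / 2) * t powr (- (real k + 1) / 2))" by simp
    also have "t powr (a / 2) * t powr (- (real k + 1) / 2) = t powr ((a - real k - 1) / 2)"
      unfolding powr_add[symmetric] by (simp add: field_simps)
    finally have "X * (1 + real n) powr a \<le> D * E * t powr ((a - real k - 1) / 2)" .
    then have "X \<le> D * E * t powr ((a - real k - 1) / 2) / (1 + real n) powr a"
      by (simp add: pos_le_divide_eq add_pos_nonneg)
    also have "\<dots> = D * E * t powr ((a - real k - 1) / 2) * weight a j"
      by (simp add: weight_def n_def powr_minus_divide)
    finally show ?thesis by (simp add: X_def)
  qed
  then show ?thesis by (intro exI[of _ "D * E"] allI impI)
qed

section \<open>The Poisson kernel\<close>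

abbreviation posreal :: "real measure" where "posreal \<equiv> restrict_space lborel {0<..}"

text \<open>For nonnegative integrands, finite limits of an antiderivative give integrability
  together with the value.\<close>

lemma halfline_FTC:
  fixes f F :: "real \<Rightarrow> real"
  assumes F: "\<And>t. t > 0 \<Longrightarrow> (F has_real_derivative f t) (at t)"
    and f: "continuous_on {0<..} f" and nonneg: "\<And>t. t > 0 \<Longrightarrow> f t \<ge> 0"
    and A: "(F \<longlongrightarrow> A) (at_right 0)" and B: "(F \<longlongrightarrow> B) at_top"
  shows "has_bochner_integral posreal f (B - A)"
proof -
  have c: "isCont f x" if "ereal 0 < ereal x" for x
    using f that by (auto simp: continuous_on_eq_continuous_at)
  have A': "((F \<circ> real_of_ereal) \<longlongrightarrow> A) (at_right (ereal 0))" by (simp only: ereal_tendsto_simps A)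
  have B': "((F \<circ> real_of_ereal) \<longlongrightarrow> B) (at_left \<infinity>)" by (simp only: ereal_tendsto_simps B)
  have F': "(F has_real_derivative f x) (at x)" if "ereal 0 < ereal x" for x using F that by simp
  have n: "AE x in lborel. ereal 0 < ereal x \<longrightarrow> ereal x < \<infinity> \<longrightarrow> 0 \<le> f x" using nonneg by auto
  note I = interval_integral_FTC_nonneg[OF _ F' c n A' B', simplified]
  have "integrable posreal f"
    using I(1) by (simp add: integrable_restrict_space set_integrable_def)
  moreover have "integral\<^sup>L posreal f = B - A"
    using I(2) by (simp add: interval_lebesgue_integral_def integral_restrict_space set_lebesgue_integral_def)
  ultimately show ?thesis by (simp add: has_bochner_integral_iff)
qed

text \<open>The error function up to the factor sqrt pi / 2.\<close>

definition gauss_prim :: "real \<Rightarrow> real" where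
  "gauss_prim x = (LBINT s=ereal 0..ereal x. exp (- s\<^sup>2))"

lemma gauss_prim_deriv: "(gauss_prim has_real_derivative exp (- x\<^sup>2)) (at x)"
proof -
  have "((\<lambda>u. LBINT s=ereal 0..ereal u. exp (- s\<^sup>2)) has_vector_derivative exp (- x\<^sup>2))
     (at x within {- (\<bar>x\<bar> + 1)..\<bar>x\<bar> + 1})"
    by (rule interval_integral_FTC2) (auto intro!: continuous_intros)
  moreover have "at x within {- (\<bar>x\<bar> + 1)..\<bar>x\<bar> + 1} = at x" by (rule at_within_Icc_at) auto
  ultimately show ?thesis
    by (simp add: gauss_prim_def [abs_def] has_real_derivative_iff_has_vector_derivative)
qed

lemma gauss_prim_at_top: "(gauss_prim \<longlongrightarrow> sqrt pi / 2) at_top"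
proof -
  have "((\<lambda>y::real. \<integral>x. indicator {..y} x *\<^sub>R (indicator {0..} x *\<^sub>R exp (- x\<^sup>2)) \<partial>lborel)
     \<longlongrightarrow> (\<integral>x. indicator {0::real..} x *\<^sub>R exp (- x\<^sup>2) \<partial>lborel)) at_top"
    by (rule tendsto_integral_at_top[OF sets_lborel]) (use gaussian_moment_0 in \<open>simp only: has_bochner_integral_iff\<close>)
  then have *: "((\<lambda>y. \<integral>x. indicator {..y} x *\<^sub>R (indicator {0..} x *\<^sub>R exp (- x\<^sup>2)) \<partial>lborel)
     \<longlongrightarrow> sqrt pi / 2) at_top"
    by (simp only: has_bochner_integral_integral_eq[OF gaussian_moment_0])
  have "eventually (\<lambda>y. (\<integral>x. indicator {..y} x *\<^sub>R (indicator {0..} x *\<^sub>R exp (- x\<^sup>2)) \<partial>lborel) = gauss_prim y) at_top"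
    using eventually_ge_at_top[of 0]
  proof eventually_elim
    case (elim y)
    have "gauss_prim y = (LBINT s:{0..y}. exp (- s\<^sup>2))"
      unfolding gauss_prim_def by (rule interval_integral_Icc) (rule elim)
    also have "\<dots> = (\<integral>x. indicator {..y} x *\<^sub>R (indicator {0..} x *\<^sub>R exp (- x\<^sup>2)) \<partial>lborel)"
      unfolding set_lebesgue_integral_def by (intro Bochner_Integration.integral_cong) (auto split: split_indicator)
    finally show ?case by simp
  qed
  with * show ?thesis by (rule Lim_transform_eventually)
qed

lemma gauss_prim_0 [simp]: "gauss_prim 0 = 0"
  by (simp add: gauss_prim_def interval_integral_endpoints_same)

lemma gauss_prim_minus: "gauss_prim (- x) = - gauss_prim x"
proof -
  have "((\<lambda>x. gauss_prim x + gauss_prim (- x)) has_real_derivative 0) (at y)" for y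
    by (auto intro!: derivative_eq_intros DERIV_chain2[OF gauss_prim_deriv] gauss_prim_deriv)
  then have "gauss_prim x + gauss_prim (- x) = gauss_prim 0 + gauss_prim (- 0)"
    by (rule DERIV_isconst_all[rule_format])
  then show ?thesis by simp
qed

lemma gauss_prim_at_bot: "(gauss_prim \<longlongrightarrow> - (sqrt pi / 2)) at_bot"
  unfolding filterlim_at_bot_mirror gauss_prim_minus by (intro tendsto_minus gauss_prim_at_top)

text \<open>The Levy density, that is the one-sided stable law of index 1/2, which subordinates the
  Poisson semigroup to the heat semigroup.\<close>

definition eta :: "real \<Rightarrow> real \<Rightarrow> real" where
  "eta y t = y / (2 * sqrt pi) * (exp (- (y\<^sup>2 / (4 * t))) / t powr (3 / 2))"

lemma eta_nonneg: "y > 0 \<Longrightarrow> eta y t \<ge> 0"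
  by (simp add: eta_def)

lemma eta_continuous: "continuous_on {0<..} (eta y)"
  unfolding eta_def by (auto intro!: continuous_intros)

text \<open>The integrand has an antiderivative in terms of the error function.\<close>

lemma eta_laplace:
  assumes y: "y > 0" and \<mu>: "\<mu> \<ge> 0"
  shows "has_bochner_integral posreal (\<lambda>t. eta y t * exp (- (t * \<mu>\<^sup>2))) (exp (- (y * \<mu>)))"
proof -
  define L where "L = sqrt pi / 2"
  \<comment> \<open>Completing the square in two ways: both - y \<mu> - a^2 and y \<mu> - b^2 equal
    - y^2/(4t) - t \<mu>^2, so the two branches carry the same exponential.\<close>
  define a where "a t = \<mu> * sqrt t - y / (2 * sqrt t)" for t
  define b where "b t = - \<mu> * sqrt t - y / (2 * sqrt t)" for t
  \<comment> \<open>Adding \<open>L\<close> to each error function makes \<open>F\<close> vanish at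
    0, where both arguments tend to minus infinity.\<close>
  define F where "F t = (exp (- (y * \<mu>)) * (gauss_prim (a t) + L) + exp (y * \<mu>) * (gauss_prim (b t) + L)) / sqrt pi" for t
  have lim_top: "filterlim (\<lambda>t::real. sqrt t) at_top at_top" by (rule sqrt_at_top)
  have lim0: "((\<lambda>t. sqrt t) \<longlongrightarrow> 0) (at_right 0)"
    using tendsto_real_sqrt[of "\<lambda>t. t" 0 "at_right (0::real)"] by (simp add: tendsto_ident_at)
  have inv0: "filterlim (\<lambda>t. y / (2 * sqrt t)) at_top (at_right 0)"
  proof -
    have "filterlim (\<lambda>t::real. inverse (sqrt t)) at_top (at_right 0)"
      using lim0 by (intro filterlim_inverse_at_top) (auto simp: eventually_at_right_less eventually_at_filter)
    then have "filterlim (\<lambda>t::real. (y / 2) * inverse (sqrt t)) at_top (at_right 0)"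
      using y by (intro filterlim_tendsto_pos_mult_at_top[OF tendsto_const]) auto
    then show ?thesis by (simp add: field_simps)
  qed
  have inv_top: "((\<lambda>t. y / (2 * sqrt t)) \<longlongrightarrow> 0) at_top"
  proof -
    have "((\<lambda>t::real. (y / 2) * inverse (sqrt t)) \<longlongrightarrow> (y / 2) * 0) at_top"
      by (intro tendsto_mult tendsto_const tendsto_inverse_0_at_top lim_top)
    then show ?thesis by (simp add: field_simps)
  qed
  have a0: "filterlim a at_bot (at_right 0)"
  proof -
    have "filterlim (\<lambda>t. - (\<mu> * sqrt t) + y / (2 * sqrt t)) at_top (at_right 0)"
      by (rule filterlim_tendsto_add_at_top[OF _ inv0]) (auto intro!: tendsto_eq_intros lim0)
    then show ?thesis unfolding a_def filterlim_uminus_at_bot by simp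
  qed
  have b0: "filterlim b at_bot (at_right 0)"
  proof -
    have "filterlim (\<lambda>t. (\<mu> * sqrt t) + y / (2 * sqrt t)) at_top (at_right 0)"
      by (rule filterlim_tendsto_add_at_top[OF _ inv0]) (auto intro!: tendsto_eq_intros lim0)
    then show ?thesis unfolding b_def filterlim_uminus_at_bot by (simp add: add.commute)
  qed
  have F0: "(F \<longlongrightarrow> 0) (at_right 0)"
  proof -
    have "(F \<longlongrightarrow> (exp (- (y * \<mu>)) * (- (sqrt pi / 2) + L) + exp (y * \<mu>) * (- (sqrt pi / 2) + L)) / sqrt pi) (at_right 0)"
      unfolding F_def
      by (intro tendsto_intros filterlim_compose[OF gauss_prim_at_bot a0] filterlim_compose[OF gauss_prim_at_bot b0]) auto
    then show ?thesis by (simp add: L_def)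
  qed
  have Ft: "(F \<longlongrightarrow> exp (- (y * \<mu>))) at_top"
  \<comment> \<open>For \<mu> = 0 both arguments tend to 0 instead of to opposite infinities, so the
    limit has to be taken separately.\<close>
  proof (cases "\<mu> = 0")
    case True
    have c: "isCont gauss_prim 0" using gauss_prim_deriv by (rule DERIV_isCont)
    have "((\<lambda>t. - (y / (2 * sqrt t))) \<longlongrightarrow> - 0) at_top" by (intro tendsto_minus inv_top)
    then have "((\<lambda>t. gauss_prim (- (y / (2 * sqrt t)))) \<longlongrightarrow> gauss_prim 0) at_top"
      by (intro isCont_tendsto_compose[OF c]) simp
    then have "((\<lambda>t. (1 * (gauss_prim (- (y / (2 * sqrt t))) + L) + 1 * (gauss_prim (- (y / (2 * sqrt t))) + L)) / sqrt pi)
        \<longlongrightarrow> (1 * (gauss_prim 0 + L) + 1 * (gauss_prim 0 + L)) / sqrt pi) at_top"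
      by (intro tendsto_intros) auto
    then show ?thesis using True by (simp add: F_def [abs_def] a_def b_def L_def)
  next
    case False
    then have m: "\<mu> > 0" using \<mu> by simp
    have ms: "filterlim (\<lambda>t. \<mu> * sqrt t) at_top at_top"
      using m by (intro filterlim_tendsto_pos_mult_at_top[OF tendsto_const] lim_top)
    have at: "filterlim a at_top at_top"
    proof -
      have "filterlim (\<lambda>t. - (y / (2 * sqrt t)) + \<mu> * sqrt t) at_top at_top"
        by (rule filterlim_tendsto_add_at_top[OF tendsto_minus[OF inv_top] ms])
      then show ?thesis unfolding a_def by simp
    qed
    have bt: "filterlim b at_bot at_top"
    proof -
      have "filterlim (\<lambda>t. y / (2 * sqrt t) + \<mu> * sqrt t) at_top at_top"
        by (rule filterlim_tendsto_add_at_top[OF inv_top ms])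
      then show ?thesis unfolding b_def filterlim_uminus_at_bot by (simp add: add.commute)
    qed
    have "(F \<longlongrightarrow> (exp (- (y * \<mu>)) * (sqrt pi / 2 + L) + exp (y * \<mu>) * (- (sqrt pi / 2) + L)) / sqrt pi) at_top"
      unfolding F_def
      by (intro tendsto_intros filterlim_compose[OF gauss_prim_at_top at] filterlim_compose[OF gauss_prim_at_bot bt]) auto
    then show ?thesis by (simp add: L_def)
  qed
  have dF: "(F has_real_derivative eta y t * exp (- (t * \<mu>\<^sup>2))) (at t)" if t: "t > 0" for t
  proof -
    define s where "s = sqrt t"
    have s: "s > 0" "t = s\<^sup>2" using t by (auto simp: s_def)
    have ds: "(sqrt has_real_derivative 1 / (2 * s)) (at t)"
      using DERIV_real_sqrt[OF t] by (simp add: s_def field_simps)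
    have "((\<lambda>s. \<mu> * s - y / (2 * s)) has_real_derivative (\<mu> + y / (2 * s\<^sup>2))) (at s)"
      using s(1) by (auto intro!: derivative_eq_intros simp: power2_eq_square field_simps)
    from DERIV_chain2[OF this[unfolded s_def] ds, folded s_def]
    have da: "(a has_real_derivative (\<mu> + y / (2 * s\<^sup>2)) / (2 * s)) (at t)"
      unfolding a_def by simp
    have "((\<lambda>s. - \<mu> * s - y / (2 * s)) has_real_derivative (- \<mu> + y / (2 * s\<^sup>2))) (at s)"
      using s(1) by (auto intro!: derivative_eq_intros simp: power2_eq_square field_simps)
    from DERIV_chain2[OF this[unfolded s_def] ds, folded s_def]
    have db: "(b has_real_derivative (- \<mu> + y / (2 * s\<^sup>2)) / (2 * s)) (at t)"
      unfolding b_def by simp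
    \<comment> \<open>With the common exponential factored out, the \<mu> terms of the two inner
      derivatives cancel and y / s^2 / (2s) remains.\<close>
    have "(F has_real_derivative
        (exp (- (y * \<mu>)) * (exp (- (a t)\<^sup>2) * ((\<mu> + y / (2 * s\<^sup>2)) / (2 * s)))
       + exp (y * \<mu>) * (exp (- (b t)\<^sup>2) * ((- \<mu> + y / (2 * s\<^sup>2)) / (2 * s)))) / sqrt pi) (at t)"
      using DERIV_cdivide[OF DERIV_add[OF
          DERIV_cmult[OF DERIV_add[OF DERIV_chain2[OF gauss_prim_deriv da] DERIV_const], of "exp (- (y * \<mu>))" L]
          DERIV_cmult[OF DERIV_add[OF DERIV_chain2[OF gauss_prim_deriv db] DERIV_const], of "exp (y * \<mu>)" L]], of "sqrt pi"]
      unfolding F_def by simp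
    moreover have "exp (- (y * \<mu>)) * exp (- (a t)\<^sup>2) = exp (- (y\<^sup>2 / (4 * t)) - t * \<mu>\<^sup>2)"
    proof -
      have "- (y * \<mu>) - (a t)\<^sup>2 = - (y\<^sup>2 / (4 * t)) - t * \<mu>\<^sup>2"
        unfolding a_def s_def[symmetric] s(2) using s(1) by (simp add: power2_eq_square field_simps)
      then show ?thesis by (simp add: exp_add[symmetric])
    qed
    moreover have "exp (y * \<mu>) * exp (- (b t)\<^sup>2) = exp (- (y\<^sup>2 / (4 * t)) - t * \<mu>\<^sup>2)"
    proof -
      have "y * \<mu> - (b t)\<^sup>2 = - (y\<^sup>2 / (4 * t)) - t * \<mu>\<^sup>2"
        unfolding b_def s_def[symmetric] s(2) using s(1) by (simp add: power2_eq_square field_simps)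
      then show ?thesis by (simp add: exp_add[symmetric])
    qed
    moreover have "eta y t * exp (- (t * \<mu>\<^sup>2))
       = exp (- (y\<^sup>2 / (4 * t)) - t * \<mu>\<^sup>2) * (y / s\<^sup>2 / (2 * s)) / sqrt pi"
    proof -
      have "t powr (3 / 2) = t powr (1 + 1 / 2)" by simp
      also have "\<dots> = t * s" unfolding powr_add using t by (simp add: powr_half_sqrt s_def)
      finally have "t powr (3 / 2) = s\<^sup>2 * s" using s(2) by simp
      then show ?thesis unfolding eta_def exp_diff exp_minus by (simp add: field_simps)
    qed
    moreover have "E * X * A + E * Y * A = E * ((X + Y) * A)" for E X Y A :: real by (simp add: algebra_simps)
    ultimately show ?thesis
      by (simp add: mult.assoc[symmetric]) (simp add: distrib_left[symmetric] add_divide_distrib[symmetric] mult.assoc)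
  qed
  have "has_bochner_integral posreal (\<lambda>t. eta y t * exp (- (t * \<mu>\<^sup>2))) (exp (- (y * \<mu>)) - 0)"
    using y by (intro halfline_FTC[OF dF _ _ F0 Ft] continuous_intros eta_continuous) (auto simp: eta_nonneg)
  then show ?thesis by simp
qed

lemma eta_integral:
  assumes "y > 0" shows "integrable posreal (eta y)" "integral\<^sup>L posreal (eta y) = 1"
  using eta_laplace[OF assms, of 0] by (auto simp: has_bochner_integral_iff)

text \<open>The average of t^(-1/2) under the subordinating law; it converts the rate t^(-1/2) of
  the heat kernel into the rate 1/y. The integrand has an elementary antiderivative.\<close>

lemma eta_moment:
  assumes y: "y > 0"
  shows "has_bochner_integral posreal (\<lambda>t. eta y t * t powr (- 1 / 2)) (2 / (sqrt pi * y))"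
proof -
  define F where "F t = 2 / (sqrt pi * y) * exp (- (y\<^sup>2 / (4 * t)))" for t
  have inv0: "filterlim (\<lambda>t. y\<^sup>2 / (4 * t)) at_top (at_right 0)"
  proof -
    have "filterlim (\<lambda>t::real. (y\<^sup>2 / 4) * inverse t) at_top (at_right 0)"
      using y by (intro filterlim_tendsto_pos_mult_at_top[OF tendsto_const]) (auto simp: filterlim_inverse_at_top_right)
    then show ?thesis by (simp add: field_simps)
  qed
  have inv_top: "((\<lambda>t. y\<^sup>2 / (4 * t)) \<longlongrightarrow> 0) at_top"
  proof -
    have "((\<lambda>t::real. (y\<^sup>2 / 4) * inverse t) \<longlongrightarrow> (y\<^sup>2 / 4) * 0) at_top"
      by (intro tendsto_mult tendsto_const tendsto_inverse_0_at_top filterlim_ident)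
    then show ?thesis by (simp add: field_simps)
  qed
  have F0: "(F \<longlongrightarrow> 2 / (sqrt pi * y) * 0) (at_right 0)" unfolding F_def
    using inv0 by (intro tendsto_mult tendsto_const filterlim_compose[OF exp_at_bot]) (simp add: filterlim_uminus_at_top)
  have Ft: "(F \<longlongrightarrow> 2 / (sqrt pi * y) * exp (- 0)) at_top" unfolding F_def
    by (intro tendsto_intros inv_top)
  have dF: "(F has_real_derivative eta y t * t powr (- 1 / 2)) (at t)" if t: "t > 0" for t
  proof -
    have "(F has_real_derivative 2 / (sqrt pi * y) * (exp (- (y\<^sup>2 / (4 * t))) * (y\<^sup>2 / (4 * t\<^sup>2)))) (at t)"
      unfolding F_def using t
      by (auto intro!: derivative_eq_intros simp: power2_eq_square field_simps)
    also have "2 / (sqrt pi * y) * (exp (- (y\<^sup>2 / (4 * t))) * (y\<^sup>2 / (4 * t\<^sup>2)))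
       = y / (2 * sqrt pi) * (exp (- (y\<^sup>2 / (4 * t))) * (1 / t\<^sup>2))"
      using y t by (simp add: power2_eq_square field_simps)
    also have "1 / t\<^sup>2 = 1 / t powr (3 / 2) * t powr (- 1 / 2)"
    proof -
      have "1 / t powr (3 / 2) * t powr (- 1 / 2) = t powr (- 3 / 2 + - 1 / 2)"
        unfolding powr_add by (simp add: powr_minus_divide)
      also have "\<dots> = 1 / t\<^sup>2" using t by (simp add: powr_minus_divide)
      finally show ?thesis by simp
    qed
    finally show ?thesis by (simp add: eta_def mult_ac)
  qed
  have "has_bochner_integral posreal (\<lambda>t. eta y t * t powr (- 1 / 2)) (2 / (sqrt pi * y) * exp (- 0) - 2 / (sqrt pi * y) * 0)"
    using y by (intro halfline_FTC[OF dF _ _ F0 Ft] continuous_intros eta_continuous) (auto simp: eta_nonneg)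
  then show ?thesis by simp
qed

section \<open>The Poisson kernel and its Fourier symbol\<close>

definition poisson_kernel :: "real \<Rightarrow> int \<Rightarrow> real" where
  "poisson_kernel y n = (\<integral>t. eta y t * heat_kernel t n \<partial>posreal)"

lemma heat_kernel_continuous: "continuous_on {0<..} (\<lambda>t. heat_kernel t n)"
  by (intro continuous_at_imp_continuous_on) (auto intro: DERIV_isCont heat_kernel_deriv)

lemma measurable_posreal:
  fixes f :: "real \<Rightarrow> real"
  assumes "continuous_on {0<..} f" shows "f \<in> borel_measurable posreal"
  using borel_measurable_continuous_on_restrict[OF assms]
  by (subst measurable_cong_sets[OF sets_restrict_space_cong refl, of _ borel]) auto

lemma space_posreal [simp]: "space posreal = {0<..}"
  by (simp add: space_restrict_space)

lemma heat_kernel_le_1: assumes "t > 0" shows "heat_kernel t n \<le> 1"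
proof -
  have "sum (heat_kernel t) {n} \<le> infsum (heat_kernel t) UNIV"
    by (rule finite_sum_le_infsum) (auto simp: heat_kernel_summable heat_kernel_nonneg assms)
  also have "\<dots> = 1" by (rule infsumI[OF heat_kernel_has_sum[OF assms]])
  finally show ?thesis by simp
qed

lemma eta_heat_kernel_integrable:
  assumes y: "y > 0" shows "integrable posreal (\<lambda>t. eta y t * heat_kernel t n)"
proof (rule Bochner_Integration.integrable_bound[OF eta_integral(1)[OF y]])
  show "(\<lambda>t. eta y t * heat_kernel t n) \<in> borel_measurable posreal"
    by (intro measurable_posreal continuous_intros eta_continuous heat_kernel_continuous)
  show "AE t in posreal. norm (eta y t * heat_kernel t n) \<le> norm (eta y t)"
    using y by (intro AE_I2) (auto simp: abs_mult heat_kernel_nonneg heat_kernel_le_1 eta_nonneg mult_left_le)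
qed

lemma poisson_kernel_nonneg: "y > 0 \<Longrightarrow> poisson_kernel y n \<ge> 0"
  unfolding poisson_kernel_def by (intro integral_nonneg_AE AE_I2) (auto simp: eta_nonneg heat_kernel_nonneg)

lemma ennreal_poisson_kernel:
  assumes "y > 0"
  shows "ennreal (poisson_kernel y n) = (\<integral>\<^sup>+t. ennreal (eta y t * heat_kernel t n) \<partial>posreal)"
  unfolding poisson_kernel_def using assms
  by (intro nn_integral_eq_integral[symmetric] eta_heat_kernel_integrable AE_I2) (auto simp: eta_nonneg heat_kernel_nonneg)

text \<open>By Tonelli the total mass is that of \<open>eta y\<close>, because each heat kernel has
  mass 1.\<close>

lemma poisson_kernel_summable:
  assumes y: "y > 0" shows "poisson_kernel y summable_on UNIV"
proof (rule nn_integral_finite_imp_summable_on)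
  have m: "(\<lambda>t. ennreal (eta y t * heat_kernel t n)) \<in> borel_measurable posreal" for n
    by (intro measurable_compose[OF _ measurable_ennreal] measurable_posreal continuous_intros eta_continuous heat_kernel_continuous)
  have "(\<integral>\<^sup>+n. ennreal \<bar>poisson_kernel y n\<bar> \<partial>count_space UNIV)
    = (\<integral>\<^sup>+n. \<integral>\<^sup>+t. ennreal (eta y t * heat_kernel t n) \<partial>posreal \<partial>count_space UNIV)"
    using y by (simp add: poisson_kernel_nonneg ennreal_poisson_kernel)
  also have "\<dots> = (\<integral>\<^sup>+t. \<integral>\<^sup>+n. ennreal (eta y t * heat_kernel t n) \<partial>count_space UNIV \<partial>posreal)"
    by (rule nn_integral_count_space_nn_integral[symmetric]) (auto simp: m)
  also have "\<dots> = (\<integral>\<^sup>+t. ennreal (eta y t) \<partial>posreal)"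
  proof (rule nn_integral_cong)
    fix t assume "t \<in> space posreal"
    then have t: "t > 0" by simp
    have "(\<integral>\<^sup>+n. ennreal (eta y t * heat_kernel t n) \<partial>count_space UNIV)
      = ennreal (\<Sum>\<^sub>\<infinity>n. eta y t * heat_kernel t n)"
      using y t by (intro nn_integral_count_space_eq_infsum summable_on_cmult_right heat_kernel_summable)
        (auto simp: eta_nonneg heat_kernel_nonneg)
    also have "(\<Sum>\<^sub>\<infinity>n. eta y t * heat_kernel t n) = eta y t"
      using infsumI[OF has_sum_cmult_right[OF heat_kernel_has_sum[OF t], of "eta y t"]] by simp
    finally show "(\<integral>\<^sup>+n. ennreal (eta y t * heat_kernel t n) \<partial>count_space UNIV) = ennreal (eta y t)" .
  qed
  also have "\<dots> = ennreal (integral\<^sup>L posreal (eta y))"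
    using y by (intro nn_integral_eq_integral eta_integral AE_I2) (auto simp: eta_nonneg)
  also have "\<dots> < top" by simp
  finally show "(\<integral>\<^sup>+n. ennreal \<bar>poisson_kernel y n\<bar> \<partial>count_space UNIV) < top" .
qed

lemma poisson_kernel_minus: assumes "y > 0" shows "poisson_kernel y (- n) = poisson_kernel y n"
  unfolding poisson_kernel_def
  by (rule Bochner_Integration.integral_cong) (auto simp: heat_kernel_minus)

text \<open>The heat symbol involves 4 sin^2(\<theta>/2) = (2 |sin(\<theta>/2)|)^2, so the Laplace
  transform of \<open>eta\<close> is evaluated at the modulus.\<close>

lemma poisson_kernel_fourier:
  assumes y: "y > 0"
  shows "(\<Sum>\<^sub>\<infinity>n. poisson_kernel y n * cos (real_of_int n * \<theta>)) = exp (- (y * (2 * \<bar>sin (\<theta> / 2)\<bar>)))"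
proof -
  let ?F = "\<lambda>n t. eta y t * heat_kernel t n * cos (real_of_int n * \<theta>)"
  have int: "integrable posreal (?F n)" for n
    using eta_heat_kernel_integrable[OF y] by simp
  have s: "(\<lambda>n. ?F n t) summable_on UNIV" if "t \<in> space posreal" for t
    using that summable_on_cmult_right[OF has_sum_imp_summable[OF heat_kernel_fourier[of t \<theta>]], of "eta y t"]
    by (simp add: mult.assoc)
  have b: "(\<lambda>n. \<integral>t. \<bar>?F n t\<bar> \<partial>posreal) summable_on UNIV"
  proof (rule summable_on_real_comparison[OF poisson_kernel_summable[OF y]])
    fix n
    have "(\<integral>t. \<bar>?F n t\<bar> \<partial>posreal) \<le> (\<integral>t. eta y t * heat_kernel t n \<partial>posreal)"
    proof (rule integral_mono[OF integrable_abs[OF int] eta_heat_kernel_integrable[OF y]])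
      fix t assume "t \<in> space posreal"
      then have "0 \<le> eta y t * heat_kernel t n" using y by (simp add: eta_nonneg heat_kernel_nonneg)
      then show "\<bar>?F n t\<bar> \<le> eta y t * heat_kernel t n"
        unfolding abs_mult[of "eta y t * heat_kernel t n"] by (simp add: mult_left_le del: abs_mult)
    qed
    then show "\<bar>\<integral>t. \<bar>?F n t\<bar> \<partial>posreal\<bar> \<le> poisson_kernel y n" unfolding poisson_kernel_def by simp
  qed
  have "(\<Sum>\<^sub>\<infinity>n. poisson_kernel y n * cos (real_of_int n * \<theta>)) = (\<Sum>\<^sub>\<infinity>n. \<integral>t. ?F n t \<partial>posreal)"
    unfolding poisson_kernel_def by simp
  also have "\<dots> = (\<integral>t. (\<Sum>\<^sub>\<infinity>n. ?F n t) \<partial>posreal)"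
    by (rule integral_infsum(2)[OF int s b, symmetric])
  also have "\<dots> = (\<integral>t. eta y t * exp (- (t * (2 * \<bar>sin (\<theta> / 2)\<bar>)\<^sup>2)) \<partial>posreal)"
  proof (rule Bochner_Integration.integral_cong)
    fix t assume "t \<in> space posreal"
    then have t: "t > 0" by simp
    show "(\<Sum>\<^sub>\<infinity>n. ?F n t) = eta y t * exp (- (t * (2 * \<bar>sin (\<theta> / 2)\<bar>)\<^sup>2))"
      using infsumI[OF has_sum_cmult_right[OF heat_kernel_fourier[OF t, of \<theta>], of "eta y t"]]
      by (simp add: mult.assoc power_mult_distrib)
  qed simp
  also have "\<dots> = exp (- (y * (2 * \<bar>sin (\<theta> / 2)\<bar>)))"
    by (rule has_bochner_integral_integral_eq[OF eta_laplace[OF y]]) simp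
  finally show ?thesis .
qed

lemma sin_half_nonneg: "\<theta> \<in> {0..2 * pi} \<Longrightarrow> sin (\<theta> / 2) \<ge> 0"
  by (intro sin_ge_zero) auto

text \<open>Unlike the subordination integral this makes sense as a kernel at \<open>y = 0\<close>,
  where it is the unit mass at 0. On the interval of integration sin(\<theta>/2) is nonnegative, so
  the modulus disappears and the integrand is smooth there.\<close>

definition poisson_circ :: "real \<Rightarrow> int \<Rightarrow> real" where
  "poisson_circ y n = circ (\<lambda>\<theta>. exp (- (y * (2 * sin (\<theta> / 2)))) * cos (real_of_int n * \<theta>))"

definition poisson_kernel' :: "real \<Rightarrow> int \<Rightarrow> real" where
  "poisson_kernel' y n = circ (\<lambda>\<theta>. exp (- (y * (2 * sin (\<theta> / 2)))) * (- (2 * sin (\<theta> / 2)) * cos (real_of_int n * \<theta>)))"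

lemma poisson_kernel_circ: assumes "y > 0" shows "poisson_kernel y n = poisson_circ y n"
proof -
  have "poisson_kernel y n = circ (\<lambda>\<theta>. exp (- (y * (2 * \<bar>sin (\<theta> / 2)\<bar>))) * cos (real_of_int n * \<theta>))"
    using fourier_coeff[OF poisson_kernel_summable[OF assms] poisson_kernel_minus[OF assms], of n]
    by (simp add: poisson_kernel_fourier[OF assms])
  also have "\<dots> = poisson_circ y n"
    unfolding poisson_circ_def by (intro circ_cong) (use sin_half_nonneg in auto)
  finally show ?thesis .
qed

lemma poisson_kernel_conv_circ:
  assumes s: "s > 0" and B: "continuous_on {0..2 * pi} B"
  shows "conv (poisson_kernel s) (\<lambda>n. circ (\<lambda>\<theta>. B \<theta> * cos (real_of_int n * \<theta>))) n
    = circ (\<lambda>\<theta>. exp (- (s * (2 * sin (\<theta> / 2)))) * B \<theta> * cos (real_of_int n * \<theta>))"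
proof -
  have "conv (poisson_kernel s) (\<lambda>n. circ (\<lambda>\<theta>. B \<theta> * cos (real_of_int n * \<theta>))) n
    = circ (\<lambda>\<theta>. exp (- (s * (2 * \<bar>sin (\<theta> / 2)\<bar>))) * B \<theta> * cos (real_of_int n * \<theta>))"
    using fourier_conv[OF poisson_kernel_summable[OF s] poisson_kernel_minus[OF s] B refl, of n]
    by (simp add: poisson_kernel_fourier[OF s])
  also have "\<dots> = circ (\<lambda>\<theta>. exp (- (s * (2 * sin (\<theta> / 2)))) * B \<theta> * cos (real_of_int n * \<theta>))"
    by (intro circ_cong) (use sin_half_nonneg in auto)
  finally show ?thesis .
qed

lemma poisson_kernel_semigroup:
  assumes "s > 0" "t > 0"
  shows "conv (poisson_kernel s) (poisson_kernel t) = poisson_kernel (s + t)"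
    and "conv (poisson_kernel s) (poisson_kernel' t) = poisson_kernel' (s + t)"
proof -
  have P: "poisson_kernel t = (\<lambda>n. circ (\<lambda>\<theta>. exp (- (t * (2 * sin (\<theta> / 2)))) * cos (real_of_int n * \<theta>)))"
    using assms by (simp add: poisson_kernel_circ poisson_circ_def fun_eq_iff)
  have Q: "poisson_kernel' t = (\<lambda>n. circ (\<lambda>\<theta>. (exp (- (t * (2 * sin (\<theta> / 2)))) * - (2 * sin (\<theta> / 2))) * cos (real_of_int n * \<theta>)))"
    by (simp add: poisson_kernel'_def fun_eq_iff mult.assoc)
  show "conv (poisson_kernel s) (poisson_kernel t) = poisson_kernel (s + t)"
    unfolding P
  proof (rule ext, subst poisson_kernel_conv_circ[OF assms(1)])
    fix n
    show "circ (\<lambda>\<theta>. exp (- (s * (2 * sin (\<theta> / 2)))) * exp (- (t * (2 * sin (\<theta> / 2)))) * cos (real_of_int n * \<theta>)) = poisson_kernel (s + t) n"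
      using assms by (simp add: poisson_kernel_circ poisson_circ_def exp_add[symmetric] algebra_simps)
  qed (auto intro!: continuous_intros)
  show "conv (poisson_kernel s) (poisson_kernel' t) = poisson_kernel' (s + t)"
    unfolding Q
  proof (rule ext, subst poisson_kernel_conv_circ[OF assms(1)])
    fix n
    have "exp (- (s * (2 * sin (\<theta> / 2)))) * (exp (- (t * (2 * sin (\<theta> / 2)))) * - (2 * sin (\<theta> / 2))) * cos (real_of_int n * \<theta>)
      = exp (- ((s + t) * (2 * sin (\<theta> / 2)))) * (- (2 * sin (\<theta> / 2)) * cos (real_of_int n * \<theta>))" for \<theta>
    proof -
      have "exp (- ((s + t) * (2 * sin (\<theta> / 2)))) = exp (- (s * (2 * sin (\<theta> / 2)))) * exp (- (t * (2 * sin (\<theta> / 2))))"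
        by (simp add: exp_add[symmetric] algebra_simps)
      then show ?thesis by simp
    qed
    then show "circ (\<lambda>\<theta>. exp (- (s * (2 * sin (\<theta> / 2)))) * (exp (- (t * (2 * sin (\<theta> / 2)))) * - (2 * sin (\<theta> / 2))) * cos (real_of_int n * \<theta>)) = poisson_kernel' (s + t) n"
      by (simp only: poisson_kernel'_def)
  qed (auto intro!: continuous_intros)
qed

lemma poisson_circ_deriv:
  "((\<lambda>y. poisson_circ y n) has_real_derivative poisson_kernel' y n) (at y)"
  unfolding poisson_circ_def poisson_kernel'_def
  by (intro has_real_derivative_circ_exp) (auto intro!: continuous_intros)

lemma poisson_kernel_deriv:
  assumes "y > 0" shows "((\<lambda>y. poisson_kernel y n) has_real_derivative poisson_kernel' y n) (at y)"
  using poisson_circ_deriv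
  by (rule has_field_derivative_transform_within_open[of _ _ _ "{0<..}"]) (use assms in \<open>auto simp: poisson_kernel_circ\<close>)

lemma poisson_kernel'_deriv:
  assumes "y > 0"
  shows "((\<lambda>y. poisson_kernel' y n) has_real_derivative - laplacian (poisson_kernel y) n) (at y)"
proof -
  have "((\<lambda>y. poisson_kernel' y n) has_real_derivative
    circ (\<lambda>\<theta>. exp (- (y * (2 * sin (\<theta> / 2)))) * (- (2 * sin (\<theta> / 2)) * (- (2 * sin (\<theta> / 2)) * cos (real_of_int n * \<theta>))))) (at y)"
    unfolding poisson_kernel'_def
    by (intro has_real_derivative_circ_exp) (auto intro!: continuous_intros)
  also have "circ (\<lambda>\<theta>. exp (- (y * (2 * sin (\<theta> / 2)))) * (- (2 * sin (\<theta> / 2)) * (- (2 * sin (\<theta> / 2)) * cos (real_of_int n * \<theta>))))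
    = circ (\<lambda>\<theta>. (- 1) * (exp (- (y * (2 * sin (\<theta> / 2)))) * (- (4 * (sin (\<theta> / 2))\<^sup>2) * cos (real_of_int n * \<theta>))))"
    by (intro circ_cong) (simp add: power2_eq_square)
  also have "\<dots> = (- 1) * circ (\<lambda>\<theta>. exp (- (y * (2 * sin (\<theta> / 2)))) * (- (4 * (sin (\<theta> / 2))\<^sup>2) * cos (real_of_int n * \<theta>)))"
    by (rule circ_cmult)
  also have "\<dots> = (- 1) * laplacian (poisson_circ y) n"
    unfolding poisson_circ_def by (subst laplacian_circ) (auto intro!: continuous_intros)
  also have "poisson_circ y = poisson_kernel y" using assms by (simp add: fun_eq_iff poisson_kernel_circ)
  finally show ?thesis by simp
qed

text \<open>With g = 2 s B, \<open>H\<close> is g sin(n \<theta>)/n + g' cos(n \<theta>)/n^2. Its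
  derivative is g cos(n \<theta>) + g'' cos(n \<theta>)/n^2, so two integrations by parts are done
  at once.\<close>

lemma poisson_kernel'_integrand_deriv:
  fixes y n :: real
  assumes n: "n \<noteq> 0"
  defines "s \<equiv> \<lambda>\<theta>. sin (\<theta> / 2)" and "c \<equiv> \<lambda>\<theta>. cos (\<theta> / 2)" and "B \<equiv> \<lambda>\<theta>. exp (- (y * (2 * sin (\<theta> / 2))))"
  defines "H \<equiv> \<lambda>\<theta>. 2 * s \<theta> * B \<theta> * sin (n * \<theta>) / n + c \<theta> * B \<theta> * (1 - 2 * y * s \<theta>) * cos (n * \<theta>) / n\<^sup>2"
  shows "(H has_real_derivative 2 * s \<theta> * B \<theta> * cos (n * \<theta>)
    + B \<theta> * (- s \<theta> / 2 + y * (s \<theta>)\<^sup>2 - 2 * y * (c \<theta>)\<^sup>2 + 2 * y\<^sup>2 * s \<theta> * (c \<theta>)\<^sup>2) * cos (n * \<theta>) / n\<^sup>2) (at \<theta>)"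
proof -
  have ds: "(s has_real_derivative c \<theta> / 2) (at \<theta>)"
    unfolding s_def c_def by (auto intro!: derivative_eq_intros)
  have dc: "(c has_real_derivative - s \<theta> / 2) (at \<theta>)"
    unfolding s_def c_def by (auto intro!: derivative_eq_intros)
  have dB: "(B has_real_derivative - (y * c \<theta>) * B \<theta>) (at \<theta>)"
    unfolding B_def c_def by (auto intro!: derivative_eq_intros)
  have d1: "((\<lambda>\<theta>. 2 * s \<theta> * B \<theta>) has_real_derivative c \<theta> * B \<theta> * (1 - 2 * y * s \<theta>)) (at \<theta>)"
    by (rule derivative_eq_intros ds dB refl)+ (simp add: algebra_simps)
  have d2: "((\<lambda>\<theta>. c \<theta> * B \<theta> * (1 - 2 * y * s \<theta>)) has_real_derivative
      B \<theta> * (- s \<theta> / 2 + y * (s \<theta>)\<^sup>2 - 2 * y * (c \<theta>)\<^sup>2 + 2 * y\<^sup>2 * s \<theta> * (c \<theta>)\<^sup>2)) (at \<theta>)"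
    by (rule derivative_eq_intros ds dc dB refl)+ (simp add: algebra_simps power2_eq_square)
  have dsn: "((\<lambda>\<theta>. sin (n * \<theta>)) has_real_derivative n * cos (n * \<theta>)) (at \<theta>)"
    by (auto intro!: derivative_eq_intros)
  have dcn: "((\<lambda>\<theta>. cos (n * \<theta>)) has_real_derivative - (n * sin (n * \<theta>))) (at \<theta>)"
    by (auto intro!: derivative_eq_intros)
  show ?thesis unfolding H_def
  proof (rule DERIV_cong[OF DERIV_add[OF DERIV_cdivide[OF DERIV_mult[OF d1 dsn], of n] DERIV_cdivide[OF DERIV_mult[OF d2 dcn], of "n\<^sup>2"]]])
    have "(g1 * S + n * R * g0) / n + (g2 * R + - (n * S) * g1) / n\<^sup>2 = g0 * R + g2 * R / n\<^sup>2"
      for g0 g1 g2 S R :: real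
      using n by (simp add: power2_eq_square add_divide_distrib diff_divide_distrib)
    then show "(c \<theta> * B \<theta> * (1 - 2 * y * s \<theta>) * sin (n * \<theta>) + n * cos (n * \<theta>) * (2 * s \<theta> * B \<theta>)) / n
      + (B \<theta> * (- s \<theta> / 2 + y * (s \<theta>)\<^sup>2 - 2 * y * (c \<theta>)\<^sup>2 + 2 * y\<^sup>2 * s \<theta> * (c \<theta>)\<^sup>2) * cos (n * \<theta>)
        + - (n * sin (n * \<theta>)) * (c \<theta> * B \<theta> * (1 - 2 * y * s \<theta>))) / n\<^sup>2
      = 2 * s \<theta> * B \<theta> * cos (n * \<theta>)
        + B \<theta> * (- s \<theta> / 2 + y * (s \<theta>)\<^sup>2 - 2 * y * (c \<theta>)\<^sup>2 + 2 * y\<^sup>2 * s \<theta> * (c \<theta>)\<^sup>2) * cos (n * \<theta>) / n\<^sup>2" .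
  qed
qed

lemma mult_exp_minus_le_1: "(x::real) * exp (- x) \<le> 1"
proof -
  have "x \<le> exp x" using exp_ge_add_one_self[of x] by linarith
  then show ?thesis by (simp add: exp_minus field_simps)
qed

text \<open>The integrand is the modulus of the derivative of 2 exp(- y sin(\<theta>/2)), which
  falls on \<open>{0..pi}\<close> and rises afterwards. The value stays below 4 for all
  \<open>y\<close>, the uniformity that the second derivative needs.\<close>

lemma abs_cos_half_exp_integral:
  assumes y: "y > (0::real)"
  shows "((\<lambda>\<theta>. y * \<bar>cos (\<theta> / 2)\<bar> * exp (- (y * sin (\<theta> / 2)))) has_integral (4 - 4 * exp (- y))) {0..2 * pi}"
proof -
  have d: "((\<lambda>\<theta>. - 2 * exp (- (y * sin (\<theta> / 2)))) has_real_derivative y * cos (\<theta> / 2) * exp (- (y * sin (\<theta> / 2)))) (at \<theta> within X)" for \<theta> X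
    by (auto intro!: derivative_eq_intros)
  have i1: "((\<lambda>\<theta>. y * cos (\<theta> / 2) * exp (- (y * sin (\<theta> / 2)))) has_integral
      (- 2 * exp (- (y * sin (pi / 2))) - - 2 * exp (- (y * sin (0 / 2))))) {0..pi}"
    by (rule fundamental_theorem_of_calculus, simp, unfold has_real_derivative_iff_has_vector_derivative[symmetric], rule d)
  have i1': "((\<lambda>\<theta>. y * \<bar>cos (\<theta> / 2)\<bar> * exp (- (y * sin (\<theta> / 2)))) has_integral (2 - 2 * exp (- y))) {0..pi}"
  proof (rule has_integral_eq_rhs[OF has_integral_eq[OF _ i1]])
    fix \<theta> assume "\<theta> \<in> {0..pi}"
    then have "cos (\<theta> / 2) \<ge> 0" by (intro cos_ge_zero) auto
    then show "y * cos (\<theta> / 2) * exp (- (y * sin (\<theta> / 2))) = y * \<bar>cos (\<theta> / 2)\<bar> * exp (- (y * sin (\<theta> / 2)))" by simp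
  qed simp
  have i2: "((\<lambda>\<theta>. y * cos (\<theta> / 2) * exp (- (y * sin (\<theta> / 2)))) has_integral
      (- 2 * exp (- (y * sin (2 * pi / 2))) - - 2 * exp (- (y * sin (pi / 2))))) {pi..2 * pi}"
    by (rule fundamental_theorem_of_calculus, simp, unfold has_real_derivative_iff_has_vector_derivative[symmetric], rule d)
  have i2': "((\<lambda>\<theta>. y * \<bar>cos (\<theta> / 2)\<bar> * exp (- (y * sin (\<theta> / 2)))) has_integral (2 - 2 * exp (- y))) {pi..2 * pi}"
  proof (rule has_integral_eq_rhs[OF has_integral_eq[OF _ has_integral_neg[OF i2]]])
    fix \<theta> assume "\<theta> \<in> {pi..2 * pi}"
    then have "cos (\<theta> / 2 - pi) \<ge> 0" by (intro cos_ge_zero) auto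
    then have "cos (\<theta> / 2) \<le> 0" by (simp add: cos_diff)
    then show "- (y * cos (\<theta> / 2) * exp (- (y * sin (\<theta> / 2)))) = y * \<bar>cos (\<theta> / 2)\<bar> * exp (- (y * sin (\<theta> / 2)))" by simp
  qed simp
  have "((\<lambda>\<theta>. y * \<bar>cos (\<theta> / 2)\<bar> * exp (- (y * sin (\<theta> / 2)))) has_integral ((2 - 2 * exp (- y)) + (2 - 2 * exp (- y)))) {0..2 * pi}"
    by (rule has_integral_combine[OF _ _ i1' i2']) auto
  then show ?thesis by simp
qed

text \<open>Two integrations by parts; the second derivative of \<open>2 sin (\<theta>/2) exp (- 2 y sin (\<theta>/2))\<close> is
  bounded in \<open>L\<^sup>1\<close> uniformly in \<open>y\<close>.\<close>

lemma poisson_kernel'_le_weight: "\<exists>C\<ge>0. \<forall>y>0. \<forall>n. \<bar>poisson_kernel' y n\<bar> \<le> C * weight 2 n"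
proof -
  \<comment> \<open>The constant 40 is 4 * 10: (18 + 4 pi)/(2 pi) <= 10 from the integrations by
    parts, and (1 + |n|)^2 <= 4 n^2 for nonzero \<open>n\<close>.\<close>
  have main: "\<bar>poisson_kernel' y n\<bar> \<le> 40 * weight 2 n" if y: "y > 0" for y n
  proof (cases "n = 0")
    case True
    have "\<bar>poisson_kernel' y n\<bar> \<le> 2"
      unfolding poisson_kernel'_def
    proof (rule abs_circ_le)
      fix \<theta> assume \<theta>: "\<theta> \<in> {0..2 * pi}"
      have s: "0 \<le> sin (\<theta> / 2)" by (rule sin_half_nonneg[OF \<theta>])
      have "exp (- (y * (2 * sin (\<theta> / 2)))) * \<bar>- (2 * sin (\<theta> / 2)) * cos (real_of_int n * \<theta>)\<bar> \<le> 1 * (2 * 1)"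
        using s y mult_le_one[of "sin (\<theta> / 2)" "\<bar>cos (real_of_int n * \<theta>)\<bar>"] by (intro mult_mono) (auto simp: abs_mult)
      then show "\<bar>exp (- (y * (2 * sin (\<theta> / 2)))) * (- (2 * sin (\<theta> / 2)) * cos (real_of_int n * \<theta>))\<bar> \<le> 2"
        by (simp add: abs_mult)
    qed (auto intro!: continuous_intros)
    then show ?thesis using True by (simp add: weight_def)
  next
    case False
    define N where "N = real_of_int n"
    have N: "N \<noteq> 0" using False by (simp add: N_def)
    let ?s = "\<lambda>\<theta>::real. sin (\<theta> / 2)" and ?c = "\<lambda>\<theta>::real. cos (\<theta> / 2)" and ?B = "\<lambda>\<theta>. exp (- (y * (2 * sin (\<theta> / 2))))"
    define g'' where "g'' \<theta> = ?B \<theta> * (- ?s \<theta> / 2 + y * (?s \<theta>)\<^sup>2 - 2 * y * (?c \<theta>)\<^sup>2 + 2 * y\<^sup>2 * ?s \<theta> * (?c \<theta>)\<^sup>2)" for \<theta>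
    have i1: "((\<lambda>\<theta>. 2 * ?s \<theta> * ?B \<theta> * cos (N * \<theta>) + g'' \<theta> * cos (N * \<theta>) / N\<^sup>2) has_integral
       ((2 * ?s (2 * pi) * ?B (2 * pi) * sin (N * (2 * pi)) / N + ?c (2 * pi) * ?B (2 * pi) * (1 - 2 * y * ?s (2 * pi)) * cos (N * (2 * pi)) / N\<^sup>2)
       - (2 * ?s 0 * ?B 0 * sin (N * 0) / N + ?c 0 * ?B 0 * (1 - 2 * y * ?s 0) * cos (N * 0) / N\<^sup>2))) {0..2 * pi}"
      using poisson_kernel'_integrand_deriv[OF N, of y] unfolding g''_def
      by (intro fundamental_theorem_of_calculus)
         (auto simp: has_real_derivative_iff_has_vector_derivative[symmetric] intro: has_field_derivative_at_within)
    have cosN: "cos (N * (2 * pi)) = 1"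
      unfolding N_def using cos_int_2pin[of n] by (simp add: mult.commute)
    have cg: "continuous_on {0..2 * pi} g''" unfolding g''_def by (auto intro!: continuous_intros)
    \<comment> \<open>The exponential is split as \<open>e * e\<close> with e = exp(- y s). Factors
      \<open>y * s\<close> are absorbed by one \<open>e\<close>, and the terms with the cosine keep
      the other one together with a single \<open>y * c\<close>.\<close>
    have g''le: "\<bar>g'' \<theta> * cos (N * \<theta>)\<bar> \<le> 2 + 4 * (y * \<bar>?c \<theta>\<bar> * exp (- (y * ?s \<theta>)))" if \<theta>: "\<theta> \<in> {0..2 * pi}" for \<theta>
    proof -
      define s c e where "s = ?s \<theta>" and "c = \<bar>?c \<theta>\<bar>" and "e = exp (- (y * s))"
      have s: "0 \<le> s" "s \<le> 1" using sin_half_nonneg[OF \<theta>] by (auto simp: s_def)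
      have c: "0 \<le> c" "c \<le> 1" by (auto simp: c_def)
      have e: "0 \<le> e" "e \<le> 1" using s y by (auto simp: e_def)
      have Be: "?B \<theta> = e * e" by (simp add: e_def s_def exp_add[symmetric] algebra_simps)
      have c2: "(?c \<theta>)\<^sup>2 = c * c" by (simp add: c_def power2_eq_square)
      have yse: "y * s * e \<le> 1" "0 \<le> y * s * e" using mult_exp_minus_le_1[of "y * s"] y s e by (auto simp: e_def)
      have ee: "e * e \<le> 1" using e by (simp add: mult_le_one)
      have t1: "e * e * s / 2 \<le> 1 / 2" using mult_mono[OF ee s(2)] s e by simp
      have t2: "e * e * (y * (s * s)) \<le> 1"
      proof -
        have "(y * s * e) * (e * s) \<le> 1 * 1" using e s by (intro mult_mono[OF yse(1) mult_le_one]) auto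
        then show ?thesis by (simp add: mult_ac)
      qed
      have t3: "e * e * (2 * y * (c * c)) \<le> 2 * (y * c * e)"
      proof -
        have "(e * c) * (2 * (y * c * e)) \<le> 1 * (2 * (y * c * e))"
          using e c y by (intro mult_right_mono mult_le_one) auto
        then show ?thesis by (simp add: mult_ac)
      qed
      have t4: "e * e * (2 * y\<^sup>2 * s * (c * c)) \<le> 2 * (y * c * e)"
      proof -
        have "((y * s * e) * c) * (2 * (y * c * e)) \<le> 1 * (2 * (y * c * e))"
          using e c y by (intro mult_right_mono mult_le_one[OF yse(1)]) auto
        then show ?thesis by (simp add: mult_ac power2_eq_square)
      qed
      have nn: "0 \<le> e * e * s / 2" "0 \<le> e * e * (y * (s * s))" "0 \<le> e * e * (2 * y * (c * c))" "0 \<le> e * e * (2 * y\<^sup>2 * s * (c * c))"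
        using e s c y by auto
      have "g'' \<theta> = - (e * e * s / 2) + e * e * (y * (s * s)) - e * e * (2 * y * (c * c)) + e * e * (2 * y\<^sup>2 * s * (c * c))"
        unfolding g''_def Be c2 unfolding s_def[symmetric] by (simp add: power2_eq_square algebra_simps)
      then have "\<bar>g'' \<theta>\<bar> \<le> 2 + 4 * (y * c * e)" using t1 t2 t3 t4 nn unfolding abs_le_iff by linarith
      moreover have "\<bar>g'' \<theta>\<bar> * \<bar>cos (N * \<theta>)\<bar> \<le> \<bar>g'' \<theta>\<bar> * 1" by (intro mult_left_mono) auto
      ultimately show ?thesis by (simp add: abs_mult s_def c_def e_def)
    qed
    have ig: "(\<lambda>\<theta>. g'' \<theta> * cos (N * \<theta>)) integrable_on {0..2 * pi}"
      by (intro integrable_continuous_interval continuous_intros cg)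
    have ib: "((\<lambda>\<theta>. 2 + 4 * (y * \<bar>?c \<theta>\<bar> * exp (- (y * ?s \<theta>)))) has_integral (2 * (2 * pi) + 4 * (4 - 4 * exp (- y)))) {0..2 * pi}"
      using has_integral_add[OF has_integral_const_real[of "2::real" 0 "2 * pi"] has_integral_mult_right[OF abs_cos_half_exp_integral[OF y], of 4]]
      by (simp add: mult.commute)
    have "\<bar>integral {0..2 * pi} (\<lambda>\<theta>. g'' \<theta> * cos (N * \<theta>))\<bar> \<le> 2 * (2 * pi) + 4 * (4 - 4 * exp (- y))"
      using integral_norm_bound_integral[OF ig has_integral_integrable[OF ib]] g''le integral_unique[OF ib] by simp
    also have "\<dots> \<le> 4 * pi + 16" by simp
    finally have G: "\<bar>integral {0..2 * pi} (\<lambda>\<theta>. g'' \<theta> * cos (N * \<theta>))\<bar> \<le> 4 * pi + 16" .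
    \<comment> \<open>The boundary term -2/N^2 comes from cos(\<theta>/2) passing from 1 to -1 over
      the period, the trace of the corner of |sin(\<theta>/2)|.\<close>
    have "((\<lambda>\<theta>. 2 * ?s \<theta> * ?B \<theta> * cos (N * \<theta>)) has_integral
       (- 2 / N\<^sup>2 - integral {0..2 * pi} (\<lambda>\<theta>. g'' \<theta> * cos (N * \<theta>)) / N\<^sup>2)) {0..2 * pi}"
      using has_integral_diff[OF i1 has_integral_divide[OF integrable_integral[OF ig], of "N\<^sup>2"]] cosN by simp
    then have "integral {0..2 * pi} (\<lambda>\<theta>. 2 * ?s \<theta> * ?B \<theta> * cos (N * \<theta>))
       = (- 2 - integral {0..2 * pi} (\<lambda>\<theta>. g'' \<theta> * cos (N * \<theta>))) / N\<^sup>2"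
      by (simp add: integral_unique diff_divide_distrib)
    then have "\<bar>integral {0..2 * pi} (\<lambda>\<theta>. 2 * ?s \<theta> * ?B \<theta> * cos (N * \<theta>))\<bar> \<le> (2 + (4 * pi + 16)) / N\<^sup>2"
      using G N by (simp add: abs_le_iff divide_right_mono)
    from divide_right_mono[OF this, of "2 * pi"]
    have "\<bar>integral {0..2 * pi} (\<lambda>\<theta>. 2 * ?s \<theta> * ?B \<theta> * cos (N * \<theta>)) / (2 * pi)\<bar> \<le> (2 + (4 * pi + 16)) / N\<^sup>2 / (2 * pi)"
      by simp
    moreover have "poisson_kernel' y n = - circ (\<lambda>\<theta>. 2 * ?s \<theta> * ?B \<theta> * cos (N * \<theta>))"
      using circ_cmult[of "- 1" "\<lambda>\<theta>. 2 * ?s \<theta> * ?B \<theta> * cos (N * \<theta>)"]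
      by (simp add: poisson_kernel'_def N_def mult_ac)
    ultimately have "\<bar>poisson_kernel' y n\<bar> \<le> (2 + (4 * pi + 16)) / N\<^sup>2 / (2 * pi)"
      unfolding circ_def by simp
    also have "\<dots> = ((18 + 4 * pi) / (2 * pi)) / N\<^sup>2" by (simp add: field_simps)
    also have "\<dots> \<le> 10 / N\<^sup>2"
      using pi_gt3 by (intro divide_right_mono) (auto simp: field_simps)
    also have "\<dots> \<le> 40 * weight 2 n"
    proof -
      have "1 \<le> \<bar>N\<bar>" using False by (simp add: N_def)
      then have "(1 + \<bar>N\<bar>)\<^sup>2 \<le> (2 * \<bar>N\<bar>)\<^sup>2" by (intro power_mono) auto
      then have "(1 + \<bar>N\<bar>)\<^sup>2 \<le> 4 * N\<^sup>2" by (simp add: power_mult_distrib)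
      moreover have "0 < 4 * N\<^sup>2 * (1 + \<bar>N\<bar>)\<^sup>2" using N by (simp add: add_pos_nonneg)
      ultimately have "10 / (4 * N\<^sup>2) \<le> 10 / (1 + \<bar>N\<bar>)\<^sup>2" by (intro divide_left_mono) auto
      moreover have "weight 2 n = 1 / (1 + \<bar>N\<bar>)\<^sup>2"
        by (simp add: weight_def N_def powr_minus_divide add_pos_nonneg)
      ultimately show ?thesis by simp
    qed
    finally show ?thesis .
  qed
  show ?thesis by (rule exI[of _ 40]) (use main in auto)
qed

lemma abs_poisson_kernel'_le: assumes y: "y > 0" shows "\<bar>poisson_kernel' y n\<bar> \<le> 1 / y"
  unfolding poisson_kernel'_def
proof (rule abs_circ_le)
  fix \<theta> assume \<theta>: "\<theta> \<in> {0..2 * pi}"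
  define x where "x = y * (2 * sin (\<theta> / 2))"
  have s: "0 \<le> sin (\<theta> / 2)" by (rule sin_half_nonneg[OF \<theta>])
  have "\<bar>exp (- x) * (- (2 * sin (\<theta> / 2)) * cos (real_of_int n * \<theta>))\<bar>
     = (x * exp (- x)) * \<bar>cos (real_of_int n * \<theta>)\<bar> / y"
    using s y by (simp add: abs_mult x_def)
  also have "\<dots> \<le> 1 * 1 / y"
    using y s by (intro divide_right_mono mult_mono mult_exp_minus_le_1) (auto simp: x_def)
  finally show "\<bar>exp (- (y * (2 * sin (\<theta> / 2)))) * (- (2 * sin (\<theta> / 2)) * cos (real_of_int n * \<theta>))\<bar> \<le> 1 / y"
    unfolding x_def mult_1 .
qed (auto intro!: continuous_intros)

text \<open>Mean value theorem from the unit mass at \<open>y = 0\<close>. The bound grows with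
  \<open>y\<close>, so it serves summability and local domination, not the limit at
  infinity.\<close>

lemma poisson_kernel_le_weight: "\<exists>C\<ge>0. \<forall>y>0. \<forall>n. \<bar>poisson_kernel y n\<bar> \<le> (1 + C * y) * weight 2 n"
proof -
  obtain C where C: "C \<ge> 0" "\<And>y n. y > 0 \<Longrightarrow> \<bar>poisson_kernel' y n\<bar> \<le> C * weight 2 n"
    using poisson_kernel'_le_weight by blast
  have "\<bar>poisson_kernel y n\<bar> \<le> (1 + C * y) * weight 2 n" if y: "y > 0" for y n
  proof -
    obtain z where z: "0 < z" "z < y" "poisson_circ y n - poisson_circ 0 n = (y - 0) * poisson_kernel' z n"
      using MVT2[OF y, of "\<lambda>y. poisson_circ y n" "\<lambda>y. poisson_kernel' y n"] poisson_circ_deriv by blast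
    have "\<bar>poisson_circ 0 n\<bar> \<le> weight 2 n" by (simp add: poisson_circ_def circ_cos weight_def)
    moreover have "\<bar>y * poisson_kernel' z n\<bar> \<le> y * (C * weight 2 n)"
      using y C(2)[OF z(1), of n] by (simp add: abs_mult)
    ultimately show ?thesis using z(3) y by (simp add: poisson_kernel_circ algebra_simps)
  qed
  then show ?thesis using C(1) by (intro exI[of _ C] conjI allI impI)
qed

lemma decaying_poisson_kernel: "y > 0 \<Longrightarrow> decaying 2 (poisson_kernel y)"
  using poisson_kernel_le_weight unfolding decaying_def by blast

lemma decaying_poisson_kernel': "y > 0 \<Longrightarrow> decaying 2 (poisson_kernel' y)"
  using poisson_kernel'_le_weight unfolding decaying_def by blast

lemma delta_poisson_kernel:
  assumes y: "y > 0"
  shows "integrable posreal (\<lambda>t. eta y t * delta_right (heat_kernel t) n)"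
    and "delta_right (poisson_kernel y) n = (\<integral>t. eta y t * delta_right (heat_kernel t) n \<partial>posreal)"
  using Bochner_Integration.integrable_diff[OF eta_heat_kernel_integrable[OF y, of n] eta_heat_kernel_integrable[OF y, of "n + 1"]]
    Bochner_Integration.integral_diff[OF eta_heat_kernel_integrable[OF y, of n] eta_heat_kernel_integrable[OF y, of "n + 1"]]
  by (simp_all add: delta_right_def poisson_kernel_def right_diff_distrib)

text \<open>The weight 2 is borderline for one difference: the exponent (a - k - 1)/2 is 0, which
  bounds large times uniformly. For t < 2 the exponential bound on the kernel suffices.\<close>

lemma delta_heat_kernel_le_weight: "\<exists>C\<ge>0. \<forall>t>0. \<forall>n. \<bar>delta_right (heat_kernel t) n\<bar> \<le> C * weight 2 n"
proof -
  obtain C1 where C1: "\<And>t j. t \<ge> 2 \<Longrightarrow> \<bar>delta_right (heat_kernel t) j\<bar> \<le> C1 * weight 2 j"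
    using funpow_delta_heat_kernel_le_weight[of 2 1] by auto
  obtain C2 where C2: "C2 \<ge> 0" "\<And>t n. t > 0 \<Longrightarrow> \<bar>heat_kernel t n\<bar> \<le> exp (t / 2) * C2 * weight 2 n"
    using heat_kernel_le_weight[of 2] by auto
  define C3 where "C3 = exp 1 * C2 * (1 + 1 / weight 2 1)"
  have "\<bar>delta_right (heat_kernel t) n\<bar> \<le> max C1 C3 * weight 2 n" if t: "t > 0" for t n
  proof (cases "t \<ge> 2")
    case True
    have "C1 * weight 2 n \<le> max C1 C3 * weight 2 n" by (intro mult_right_mono) auto
    then show ?thesis using C1[OF True, of n] by linarith
  next
    case False
    have "exp (t / 2) * C2 \<le> exp 1 * C2" using False C2(1) by (intro mult_right_mono) auto
    then have *: "\<bar>heat_kernel t m\<bar> \<le> exp 1 * C2 * weight 2 m" for m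
      using C2(2)[OF t, of m] mult_right_mono[of "exp (t / 2) * C2" "exp 1 * C2" "weight 2 m"] by fastforce
    have "\<bar>delta_right (heat_kernel t) n\<bar> \<le> exp 1 * C2 * weight 2 n + exp 1 * C2 * weight 2 (n + 1)"
      using *[of n] *[of "n + 1"] unfolding delta_right_def by linarith
    also have "\<dots> \<le> exp 1 * C2 * weight 2 n + exp 1 * C2 * (weight 2 n / weight 2 1)"
      using C2(1) by (intro add_left_mono mult_left_mono weight_shift_le) auto
    also have "\<dots> = C3 * weight 2 n" by (simp add: C3_def algebra_simps)
    also have "\<dots> \<le> max C1 C3 * weight 2 n" by (intro mult_right_mono) auto
    finally show ?thesis .
  qed
  moreover have "max C1 C3 \<ge> 0" using C2(1) by (auto simp: C3_def intro!: max.coboundedI2)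
  ultimately show ?thesis by (intro exI[of _ "max C1 C3"] conjI allI impI)
qed

text \<open>The bound for the heat kernel does not depend on the time, so averaging against the
  probability density \<open>eta y\<close> preserves it.\<close>

lemma delta_poisson_kernel_le_weight: "\<exists>C\<ge>0. \<forall>y>0. \<forall>n. \<bar>delta_right (poisson_kernel y) n\<bar> \<le> C * weight 2 n"
proof -
  obtain C where C: "C \<ge> 0" "\<And>t n. t > 0 \<Longrightarrow> \<bar>delta_right (heat_kernel t) n\<bar> \<le> C * weight 2 n"
    using delta_heat_kernel_le_weight by blast
  have "\<bar>delta_right (poisson_kernel y) n\<bar> \<le> C * weight 2 n" if y: "y > 0" for y n
  proof -
    have "\<bar>delta_right (poisson_kernel y) n\<bar> \<le> (\<integral>t. \<bar>eta y t * delta_right (heat_kernel t) n\<bar> \<partial>posreal)"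
      unfolding delta_poisson_kernel(2)[OF y] by (rule integral_abs_bound)
    also have "\<dots> \<le> (\<integral>t. eta y t * (C * weight 2 n) \<partial>posreal)"
    proof (rule integral_mono)
      show "integrable posreal (\<lambda>t. eta y t * (C * weight 2 n))"
        using eta_integral(1)[OF y] by simp
      fix t assume "t \<in> space posreal"
      then show "\<bar>eta y t * delta_right (heat_kernel t) n\<bar> \<le> eta y t * (C * weight 2 n)"
        using C(2)[of t n] y by (auto simp: abs_mult eta_nonneg intro!: mult_left_mono)
    qed (use delta_poisson_kernel(1)[OF y] in simp)
    also have "\<dots> = C * weight 2 n" using eta_integral[OF y] by simp
    finally show ?thesis .
  qed
  then show ?thesis using C(1) by (intro exI[of _ C] conjI allI impI)
qed

text \<open>Tonelli reduces the sum to the average of the heat bound t^(-1/2) against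
  \<open>eta y\<close>.\<close>

lemma l1_delta_poisson_kernel:
  assumes y: "y > 0"
  shows "(\<integral>\<^sup>+n. ennreal \<bar>delta_right (poisson_kernel y) n\<bar> \<partial>count_space UNIV) \<le> ennreal (2 / (sqrt pi * y))"
proof -
  have m: "(\<lambda>t. ennreal \<bar>eta y t * delta_right (heat_kernel t) n\<bar>) \<in> borel_measurable posreal" for n
    unfolding delta_right_def
    by (intro measurable_compose[OF _ measurable_ennreal] measurable_posreal continuous_intros eta_continuous heat_kernel_continuous)
  have "(\<integral>\<^sup>+n. ennreal \<bar>delta_right (poisson_kernel y) n\<bar> \<partial>count_space UNIV)
    \<le> (\<integral>\<^sup>+n. \<integral>\<^sup>+t. ennreal \<bar>eta y t * delta_right (heat_kernel t) n\<bar> \<partial>posreal \<partial>count_space UNIV)"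
  proof (intro nn_integral_mono)
    fix n
    have "ennreal \<bar>delta_right (poisson_kernel y) n\<bar> \<le> ennreal (\<integral>t. \<bar>eta y t * delta_right (heat_kernel t) n\<bar> \<partial>posreal)"
      unfolding delta_poisson_kernel(2)[OF y] by (intro ennreal_leI integral_abs_bound)
    also have "\<dots> = (\<integral>\<^sup>+t. ennreal \<bar>eta y t * delta_right (heat_kernel t) n\<bar> \<partial>posreal)"
      by (intro nn_integral_eq_integral[symmetric] integrable_abs delta_poisson_kernel(1)[OF y]) auto
    finally show "ennreal \<bar>delta_right (poisson_kernel y) n\<bar> \<le> (\<integral>\<^sup>+t. ennreal \<bar>eta y t * delta_right (heat_kernel t) n\<bar> \<partial>posreal)" .
  qed
  also have "\<dots> = (\<integral>\<^sup>+t. \<integral>\<^sup>+n. ennreal \<bar>eta y t * delta_right (heat_kernel t) n\<bar> \<partial>count_space UNIV \<partial>posreal)"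
    by (rule nn_integral_count_space_nn_integral[symmetric]) (auto simp: m)
  also have "\<dots> \<le> (\<integral>\<^sup>+t. ennreal (eta y t * t powr (- 1 / 2)) \<partial>posreal)"
  proof (rule nn_integral_mono)
    fix t assume "t \<in> space posreal"
    then have t: "t > 0" by simp
    have "(\<integral>\<^sup>+n. ennreal \<bar>eta y t * delta_right (heat_kernel t) n\<bar> \<partial>count_space UNIV)
      = ennreal (eta y t) * (\<integral>\<^sup>+n. ennreal \<bar>delta_right (heat_kernel t) n\<bar> \<partial>count_space UNIV)"
      using y by (simp add: abs_mult eta_nonneg ennreal_mult nn_integral_cmult)
    also have "\<dots> \<le> ennreal (eta y t) * ennreal (t powr (- 1 / 2))"
      by (intro mult_left_mono l1_delta_heat_kernel t) simp
    finally show "(\<integral>\<^sup>+n. ennreal \<bar>eta y t * delta_right (heat_kernel t) n\<bar> \<partial>count_space UNIV) \<le> ennreal (eta y t * t powr (- 1 / 2))"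
      using y by (simp add: ennreal_mult eta_nonneg)
  qed
  also have "\<dots> = ennreal (2 / (sqrt pi * y))"
    using nn_integral_eq_integral[of posreal "\<lambda>t. eta y t * t powr (- 1 / 2)"] eta_moment[OF y] y
    by (auto simp: has_bochner_integral_iff eta_nonneg intro!: AE_I2)
  finally show ?thesis .
qed

lemma abs_delta_poisson_kernel_le:
  assumes "y > 0" shows "\<bar>delta_right (poisson_kernel y) n\<bar> \<le> 2 / (sqrt pi * y)"
proof -
  have "ennreal \<bar>delta_right (poisson_kernel y) n\<bar> \<le> (\<integral>\<^sup>+n. ennreal \<bar>delta_right (poisson_kernel y) n\<bar> \<partial>count_space UNIV)"
    by (rule nn_integral_ge_point) simp
  also have "\<dots> \<le> ennreal (2 / (sqrt pi * y))" by (rule l1_delta_poisson_kernel[OF assms])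
  finally show ?thesis using assms by (simp add: ennreal_le_iff)
qed

section \<open>The semigroups as convolutions with their kernels\<close>

lemma heat_semigroup_eq_conv: "heat_semigroup t f = conv (heat_kernel t) f"
  by (simp add: fun_eq_iff heat_semigroup_def conv_def)

lemma poisson_semigroup_eq_conv:
  assumes y: "y > 0" and f: "tempered 2 f"
  shows "poisson_semigroup y f n = conv (poisson_kernel y) f n"
proof -
  let ?F = "\<lambda>j t. (eta y t * heat_kernel t (n - j)) * f j"
  have int: "integrable posreal (?F j)" for j
    by (intro integrable_mult_left eta_heat_kernel_integrable y)
  have s: "(\<lambda>j. ?F j t) summable_on UNIV" if "t \<in> space posreal" for t
  proof -
    have "(\<lambda>j. heat_kernel t (n - j) * f j) summable_on UNIV"
      using that by (intro conv_summable[of 2] decaying_heat_kernel f) auto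
    from summable_on_cmult_right[OF this, of "eta y t"] show ?thesis by (simp add: mult.assoc)
  qed
  \<comment> \<open>Both factors of the integrand other than \<open>f j\<close> are nonnegative, so
    integrating moduli gives the modulus of a term of the convolution and Fubini's condition follows
    from its summability.\<close>
  have eq: "(\<integral>t. \<bar>?F j t\<bar> \<partial>posreal) = \<bar>poisson_kernel y (n - j) * f j\<bar>" for j
  proof -
    have "(\<integral>t. \<bar>?F j t\<bar> \<partial>posreal) = (\<integral>t. (eta y t * heat_kernel t (n - j)) * \<bar>f j\<bar> \<partial>posreal)"
      using y by (intro Bochner_Integration.integral_cong) (auto simp: abs_mult eta_nonneg heat_kernel_nonneg)
    then show ?thesis using y by (simp add: poisson_kernel_def[symmetric] abs_mult poisson_kernel_nonneg)
  qed
  have b: "(\<lambda>j. \<integral>t. \<bar>?F j t\<bar> \<partial>posreal) summable_on UNIV"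
    unfolding eq by (intro summable_on_abs_real conv_summable[of 2] decaying_poisson_kernel y f) auto
  have "conv (poisson_kernel y) f n = (\<Sum>\<^sub>\<infinity>j. \<integral>t. ?F j t \<partial>posreal)"
    by (simp add: conv_def poisson_kernel_def)
  also have "\<dots> = (\<integral>t. (\<Sum>\<^sub>\<infinity>j. ?F j t) \<partial>posreal)" by (rule integral_infsum(2)[OF int s b, symmetric])
  also have "\<dots> = (\<integral>t. eta y t * heat_semigroup t f n \<partial>posreal)"
  proof (rule Bochner_Integration.integral_cong)
    fix t assume "t \<in> space posreal"
    then have "(\<lambda>j. heat_kernel t (n - j) * f j) summable_on UNIV"
      by (intro conv_summable[of 2] decaying_heat_kernel f) auto
    then show "(\<Sum>\<^sub>\<infinity>j. ?F j t) = eta y t * heat_semigroup t f n"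
      using infsum_cmult_right[of "eta y t" "\<lambda>j. heat_kernel t (n - j) * f j" UNIV]
      by (simp add: heat_semigroup_def mult.assoc)
  qed simp
  also have "\<dots> = y / (2 * sqrt pi) * (\<integral>t. exp (- (y\<^sup>2 / (4 * t))) / t powr (3 / 2) * heat_semigroup t f n \<partial>posreal)"
    unfolding eta_def mult.assoc by (rule integral_mult_right_zero)
  also have "\<dots> = poisson_semigroup y f n"
    unfolding poisson_semigroup_def set_lebesgue_integral_def
    by (subst integral_restrict_space) auto
  finally show ?thesis by simp
qed

lemma conv_has_real_derivative:
  fixes K K' :: "real \<Rightarrow> int \<Rightarrow> real"
  assumes a: "a \<ge> 0" and f: "tempered a f" and t: "u < t" "t < v"
    and d: "\<And>s j. u < s \<Longrightarrow> s < v \<Longrightarrow> ((\<lambda>s. K s j) has_real_derivative K' s j) (at s)"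
    and K: "\<And>s j. u < s \<Longrightarrow> s < v \<Longrightarrow> \<bar>K s j\<bar> \<le> C * weight a j"
    and K': "\<And>s j. u < s \<Longrightarrow> s < v \<Longrightarrow> \<bar>K' s j\<bar> \<le> C * weight a j"
  shows "((\<lambda>s. conv (K s) f n) has_real_derivative conv (K' t) f n) (at t)"
  unfolding conv_def
proof (rule has_real_derivative_infsum[OF t, where M="\<lambda>j. \<bar>C * (weight a (n - j) * f j)\<bar>"])
  show "(\<lambda>j. \<bar>C * (weight a (n - j) * f j)\<bar>) summable_on UNIV"
    by (intro summable_on_abs_real summable_on_cmult_right conv_summable[OF a decaying_weight f])
  fix j s assume s: "u < s" "s < v"
  show "((\<lambda>s. K s (n - j) * f j) has_real_derivative K' s (n - j) * f j) (at s)"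
    by (rule DERIV_cmult_right[OF d[OF s]])
  have "\<bar>K' s (n - j)\<bar> \<le> \<bar>C * weight a (n - j)\<bar>" using K'[OF s, of "n - j"] by linarith
  then show "\<bar>K' s (n - j) * f j\<bar> \<le> \<bar>C * (weight a (n - j) * f j)\<bar>"
    using mult_right_mono[of _ _ "\<bar>f j\<bar>"] by (fastforce simp: abs_mult mult.assoc[symmetric])
next
  fix s assume s: "u < s" "s < v"
  have "decaying a (K s)" unfolding decaying_def using K[OF s] by blast
  then show "(\<lambda>j. K s (n - j) * f j) summable_on UNIV" by (rule conv_summable[OF a _ f])
qed

text \<open>Dominated convergence for the counting measure; the dominating function is
  \<open>f\<close> times a translate of the weight.\<close>

lemma conv_tendsto_0:
  fixes K :: "real \<Rightarrow> int \<Rightarrow> real"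
  assumes a: "a \<ge> 0" and f: "tempered a f"
    and K: "\<And>s j. s \<ge> T \<Longrightarrow> \<bar>K s j\<bar> \<le> C * weight a j"
    and lim: "\<And>j. ((\<lambda>s. K s j) \<longlongrightarrow> 0) at_top"
  shows "((\<lambda>s. conv (K s) f n) \<longlongrightarrow> 0) at_top"
proof -
  let ?M = "count_space (UNIV :: int set)"
  define w where "w j = \<bar>C * (weight a (n - j) * f j)\<bar>" for j
  have w: "w summable_on UNIV" unfolding w_def
    by (intro summable_on_abs_real summable_on_cmult_right conv_summable[OF a decaying_weight f])
  have le: "\<bar>K s (n - j) * f j\<bar> \<le> w j" if "s \<ge> T" for s j
  proof -
    have "\<bar>K s (n - j)\<bar> \<le> \<bar>C * weight a (n - j)\<bar>" using K[OF that, of "n - j"] by linarith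
    then show ?thesis
      unfolding w_def using mult_right_mono[of _ _ "\<bar>f j\<bar>"] by (fastforce simp: abs_mult mult.assoc[symmetric])
  qed
  have int: "integrable ?M g \<and> integral\<^sup>L ?M g = infsum g UNIV" if "g summable_on UNIV" for g :: "int \<Rightarrow> real"
  proof -
    have "(\<lambda>x. norm (g x)) summable_on UNIV" using summable_on_abs_real[OF that] by simp
    then have "Infinite_Set_Sum.abs_summable_on g UNIV" using abs_summable_equivalent by blast
    then show ?thesis using infsetsum_infsum[of g UNIV] by (simp add: Infinite_Set_Sum.abs_summable_on_def infsetsum_def)
  qed
  have s: "(\<lambda>j. K s (n - j) * f j) summable_on UNIV" if "s \<ge> T" for s
    by (rule summable_on_real_comparison[OF w]) (use le[OF that] in auto)
  have "((\<lambda>s. integral\<^sup>L ?M (\<lambda>j. K s (n - j) * f j)) \<longlongrightarrow> integral\<^sup>L ?M (\<lambda>j. 0)) at_top"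
  proof (rule integral_dominated_convergence_at_top)
    show "integrable ?M w" using int[OF w] by simp
    show "\<forall>\<^sub>F s in at_top. AE j in ?M. norm (K s (n - j) * f j) \<le> w j"
      using eventually_ge_at_top[of T] by eventually_elim (auto simp: le)
    show "AE j in ?M. ((\<lambda>s. K s (n - j) * f j) \<longlongrightarrow> 0) at_top"
      by (intro AE_I2 tendsto_mult_left_zero lim)
  qed auto
  moreover have "\<forall>\<^sub>F s in at_top. integral\<^sup>L ?M (\<lambda>j. K s (n - j) * f j) = conv (K s) f n"
    using eventually_ge_at_top[of T] by eventually_elim (use int[OF s] in \<open>simp add: conv_def\<close>)
  ultimately show ?thesis by (simp add: Lim_transform_eventually)
qed

section \<open>Derivatives and differences of the semigroups\<close>

text \<open>The sign \<open>\<sigma>\<close> is \<open>1\<close> for the heat equation \<open>\<partial>\<^sub>t u = \<Delta> u\<close> and \<open>- 1\<close> for \<open>\<partial>\<^sub>y\<^sup>2 u = - \<Delta> u\<close>.\<close>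

definition signed_laplacian :: "real \<Rightarrow> (int \<Rightarrow> real) \<Rightarrow> int \<Rightarrow> real" where
  "signed_laplacian \<sigma> f n = \<sigma> * laplacian f n"

text \<open>Time derivatives are traded for powers of the Laplacian, which turns a mixed derivative
  into a finite difference operator in \<open>n\<close> that commutes with convolution.\<close>

definition diff_op :: "real \<Rightarrow> nat \<Rightarrow> nat \<Rightarrow> (int \<Rightarrow> real) \<Rightarrow> int \<Rightarrow> real" where
  "diff_op \<sigma> k m f = (signed_laplacian \<sigma> ^^ k) ((delta_right ^^ m) f)"

lemma signed_laplacian_eq_delta_right:
  "signed_laplacian \<sigma> f n = \<sigma> * delta_right (delta_right f) (n - 1)"
  by (simp add: signed_laplacian_def laplacian_def delta_right_def)

lemma funpow_comm:
  assumes "\<And>x. f (g x) = g (f x)" shows "(f ^^ k) (g x) = g ((f ^^ k) x)"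
  by (induction k) (simp_all add: assms)

lemma signed_laplacian_delta_right: "signed_laplacian \<sigma> (delta_right f) = delta_right (signed_laplacian \<sigma> f)"
  by (simp add: fun_eq_iff signed_laplacian_def laplacian_def delta_right_def algebra_simps)

lemma diff_op_Suc_right: "diff_op \<sigma> k (Suc m) f = delta_right (diff_op \<sigma> k m f)"
  unfolding diff_op_def funpow.simps(2) o_apply by (rule funpow_comm) (rule signed_laplacian_delta_right)

lemma diff_op_Suc_left: "diff_op \<sigma> (Suc k) m f = signed_laplacian \<sigma> (diff_op \<sigma> k m f)"
  unfolding diff_op_def by simp

lemma diff_op_laplacian: "diff_op \<sigma> k m (signed_laplacian \<sigma> f) = diff_op \<sigma> (Suc k) m f"
proof -
  have "(delta_right ^^ m) (signed_laplacian \<sigma> f) = signed_laplacian \<sigma> ((delta_right ^^ m) f)"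
    by (rule funpow_comm) (rule signed_laplacian_delta_right[symmetric])
  then show ?thesis unfolding diff_op_def by (simp only: funpow.simps(2) o_apply funpow_swap1)
qed

text \<open>A Laplacian is a shifted second difference, so it can be read as one difference of an
  expression with one difference more; the shift is invisible to the norm in
  \<open>n\<close>.\<close>

lemma diff_op_Suc_left_eq_delta_right:
  "diff_op \<sigma> (Suc k) m f n = \<sigma> * delta_right (diff_op \<sigma> k (Suc m) f) (n - 1)"
  by (simp add: diff_op_Suc_left signed_laplacian_eq_delta_right diff_op_Suc_right)

lemma decaying_signed_laplacian: "a \<ge> 0 \<Longrightarrow> decaying a k \<Longrightarrow> decaying a (signed_laplacian \<sigma> k)"
  unfolding signed_laplacian_def [abs_def] by (intro decaying_cmult decaying_laplacian)

lemma tempered_signed_laplacian: "a \<ge> 0 \<Longrightarrow> tempered a f \<Longrightarrow> tempered a (signed_laplacian \<sigma> f)"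
  using tempered_lincomb[of a "laplacian f" "laplacian f" \<sigma> 0] tempered_laplacian[of a f]
  by (simp add: signed_laplacian_def [abs_def])

lemma decaying_diff_op:
  assumes "a \<ge> 0" "decaying a k" shows "decaying a (diff_op \<sigma> l m k)"
proof (induction l)
  case 0
  show ?case using assms by (simp add: diff_op_def decaying_funpow_delta_right)
qed (simp add: diff_op_Suc_left decaying_signed_laplacian assms)

lemma tempered_diff_op:
  assumes "a \<ge> 0" "tempered a f" shows "tempered a (diff_op \<sigma> l m f)"
proof (induction l)
  case 0
  show ?case by (induction m) (simp_all add: diff_op_Suc_right tempered_delta_right assms, simp add: diff_op_def assms)
qed (simp add: diff_op_Suc_left tempered_signed_laplacian assms)

lemma signed_laplacian_conv_left:
  assumes "a \<ge> 0" "decaying a k" "tempered a f"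
  shows "signed_laplacian \<sigma> (conv k f) = conv (signed_laplacian \<sigma> k) f"
  using conv_lincomb_left[OF assms(1) decaying_laplacian decaying_laplacian assms(3), of k k \<sigma> 0] assms
  by (simp add: signed_laplacian_def [abs_def] laplacian_conv_left[OF assms] fun_eq_iff)

lemma signed_laplacian_conv_right:
  assumes "a \<ge> 0" "decaying a k" "tempered a f"
  shows "signed_laplacian \<sigma> (conv k f) = conv k (signed_laplacian \<sigma> f)"
  using conv_lincomb_right[OF assms(1,2) tempered_laplacian tempered_laplacian, of f f \<sigma> 0] assms
  by (simp add: signed_laplacian_def [abs_def] laplacian_conv_right[OF assms] fun_eq_iff)

lemma diff_op_conv_left:
  assumes "a \<ge> 0" "decaying a k" "tempered a f"
  shows "diff_op \<sigma> l m (conv k f) = conv (diff_op \<sigma> l m k) f"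
proof (induction l)
  case 0
  show ?case
  proof (induction m)
    case (Suc m)
    then show ?case using assms
      by (simp add: diff_op_Suc_right delta_right_conv_left[OF assms(1) decaying_diff_op assms(3)])
  qed (simp add: diff_op_def)
next
  case (Suc l)
  then show ?case using assms
    by (simp add: diff_op_Suc_left signed_laplacian_conv_left[OF assms(1) decaying_diff_op assms(3)])
qed

lemma diff_op_conv_right:
  assumes "a \<ge> 0" "decaying a k" "tempered a f"
  shows "diff_op \<sigma> l m (conv k f) = conv k (diff_op \<sigma> l m f)"
proof (induction l)
  case 0
  show ?case
  proof (induction m)
    case (Suc m)
    then show ?case using assms
      by (simp add: diff_op_Suc_right delta_right_conv_right[OF assms(1,2) tempered_diff_op])
  qed (simp add: diff_op_def)
next
  case (Suc l)
  then show ?case using assms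
    by (simp add: diff_op_Suc_left signed_laplacian_conv_right[OF assms(1,2) tempered_diff_op])
qed

lemma diff_op_deriv:
  assumes "\<And>n. ((\<lambda>s. u s n) has_real_derivative u' n) (at t)"
  shows "((\<lambda>s. diff_op \<sigma> l m (u s) n) has_real_derivative diff_op \<sigma> l m u' n) (at t)"
proof (induction l arbitrary: n)
  case 0
  show ?case
  proof (induction m arbitrary: n)
    case 0
    show ?case using assms by (simp add: diff_op_def)
  next
    case (Suc m)
    show ?case unfolding diff_op_Suc_right delta_right_def by (intro DERIV_diff Suc)
  qed
next
  case (Suc l)
  show ?case unfolding diff_op_Suc_left signed_laplacian_def laplacian_def
    by (intro DERIV_cmult DERIV_add DERIV_diff Suc)
qed

lemma diff_op_tendsto_0:
  assumes "\<And>n. ((\<lambda>s. u s n) \<longlongrightarrow> 0) F"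
  shows "((\<lambda>s. diff_op \<sigma> l m (u s) n) \<longlongrightarrow> 0) F"
proof (induction l arbitrary: n)
  case 0
  show ?case
  proof (induction m arbitrary: n)
    case 0
    show ?case using assms by (simp add: diff_op_def)
  next
    case (Suc m)
    show ?case unfolding diff_op_Suc_right delta_right_def
      using tendsto_diff[OF Suc Suc] by simp
  qed
next
  case (Suc l)
  have "((\<lambda>s. \<sigma> * (diff_op \<sigma> l m (u s) (n + 1) - 2 * diff_op \<sigma> l m (u s) n + diff_op \<sigma> l m (u s) (n - 1))) \<longlongrightarrow> \<sigma> * (0 - 2 * 0 + 0)) F"
    by (intro tendsto_intros Suc)
  then show ?case unfolding diff_op_Suc_left signed_laplacian_def laplacian_def by simp
qed

text \<open>Each Laplacian counts as two differences, so the decay in time is governed by m +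
  2l.\<close>

lemma abs_diff_op:
  assumes "\<bar>\<sigma>\<bar> = 1"
  shows "\<bar>diff_op \<sigma> l m f n\<bar> = \<bar>(delta_right ^^ (m + 2 * l)) f (n - int l)\<bar>"
proof -
  have "diff_op \<sigma> l m f n = \<sigma> ^ l * (delta_right ^^ (m + 2 * l)) f (n - int l)"
  proof (induction l arbitrary: n)
    case (Suc l)
    have "diff_op \<sigma> (Suc l) m f n = \<sigma> * delta_right (delta_right (diff_op \<sigma> l m f)) (n - 1)"
      by (simp add: diff_op_Suc_left signed_laplacian_eq_delta_right)
    also have "diff_op \<sigma> l m f = (\<lambda>n. \<sigma> ^ l * (delta_right ^^ (m + 2 * l)) f (n - int l))"
      using Suc by (simp add: fun_eq_iff)
    also have "\<sigma> * delta_right (delta_right (\<lambda>n. \<sigma> ^ l * (delta_right ^^ (m + 2 * l)) f (n - int l))) (n - 1)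
      = \<sigma> ^ Suc l * delta_right (delta_right ((delta_right ^^ (m + 2 * l)) f)) (n - int (Suc l))"
      by (simp add: delta_right_def algebra_simps)
    finally show ?case by simp
  qed (simp add: diff_op_def)
  then show ?thesis using assms by (simp add: abs_mult power_abs)
qed

lemma lp_norm_delta_semigroup_le:
  assumes p: "1 \<le> p" and a: "a \<ge> 0" and K: "decaying a K" and U: "tempered a U"
    and eq: "V = conv K U" and B: "(\<integral>\<^sup>+j. ennreal \<bar>delta_right K j\<bar> \<partial>count_space UNIV) \<le> ennreal B"
  shows "lp_norm p (delta_right V) \<le> ennreal B * lp_norm p U"
proof -
  have "lp_norm p (delta_right V) = lp_norm p (conv (delta_right K) U)"
    unfolding eq by (simp add: delta_right_conv_left[OF a K U])
  also have "\<dots> \<le> (\<integral>\<^sup>+j. ennreal \<bar>delta_right K j\<bar> \<partial>count_space UNIV) * lp_norm p U"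
    by (rule lp_norm_conv_le[OF p a decaying_delta_right[OF a K] U])
  also have "\<dots> \<le> ennreal B * lp_norm p U" by (intro mult_right_mono B) simp
  finally show ?thesis .
qed

text \<open>Derivatives are local, so the formulas have to be known on the open half-line
  only.\<close>

lemma iterated_deriv_eq:
  fixes H :: "nat \<Rightarrow> real \<Rightarrow> real"
  assumes g: "\<And>s. s > 0 \<Longrightarrow> g s = H 0 s"
    and d: "\<And>l s. s > 0 \<Longrightarrow> (H l has_real_derivative H (Suc l) s) (at s)"
    and t: "t > 0"
  shows "(deriv ^^ l) g t = H l t"
  using t
proof (induction l arbitrary: t)
  case (Suc l)
  have "((deriv ^^ l) g has_real_derivative H (Suc l) t) (at t)"
    by (rule has_field_derivative_transform_within_open[OF d[OF Suc.prems], of "{0<..}"])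
       (use Suc in auto)
  then show ?case by (simp add: DERIV_imp_deriv)
qed (simp add: g)

section \<open>The heat semigroup\<close>

definition heat_diff :: "(int \<Rightarrow> real) \<Rightarrow> nat \<Rightarrow> nat \<Rightarrow> real \<Rightarrow> int \<Rightarrow> real" where
  "heat_diff f l m t = diff_op 1 l m (conv (heat_kernel t) f)"

context
  fixes a :: real and f :: "int \<Rightarrow> real"
  assumes a: "a > 1" and f: "tempered a f"
begin

lemma heat_conv_deriv:
  assumes t: "t > 0"
  shows "((\<lambda>s. conv (heat_kernel s) f n) has_real_derivative signed_laplacian 1 (conv (heat_kernel t) f) n) (at t)"
proof -
  obtain C where C: "C \<ge> 0" "\<And>s n. s > 0 \<Longrightarrow> \<bar>heat_kernel s n\<bar> \<le> exp (s / 2) * C * weight a n"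
    using heat_kernel_le_weight[of a] a by auto
  \<comment> \<open>A bound valid for 0 < s < 2t, where exp(s/2) <= exp t.\<close>
  define D where "D = exp t * C"
  have D: "D \<ge> 0" using C by (simp add: D_def)
  have K: "\<bar>heat_kernel s n\<bar> \<le> D * weight a n" if "0 < s" "s < 2 * t" for s n
  proof -
    have "exp (s / 2) * C * weight a n \<le> exp t * C * weight a n"
      using that C by (intro mult_right_mono) auto
    then show ?thesis using C(2)[OF that(1), of n] by (simp add: D_def)
  qed
  \<comment> \<open>The cost of the three translates in the Laplacian, measured against the
    untranslated weight.\<close>
  define W where "W = 2 + 1 / weight a 1 + 1 / weight a (- 1)"
  have W: "W \<ge> 1" by (simp add: W_def)
  have K1: "\<bar>heat_kernel s j\<bar> \<le> (D * W) * weight a j" if "0 < s" "s < 2 * t" for s j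
  proof -
    have "D * 1 * weight a j \<le> D * W * weight a j" using D W by (intro mult_right_mono mult_left_mono) auto
    then show ?thesis using K[OF that, of j] by simp
  qed
  have K2: "\<bar>laplacian (heat_kernel s) j\<bar> \<le> (D * W) * weight a j" if "0 < s" "s < 2 * t" for s j
  proof -
    have "\<bar>laplacian (heat_kernel s) j\<bar> \<le> D * weight a (j + 1) + 2 * (D * weight a j) + D * weight a (j + - 1)"
      using K[OF that, of "j + 1"] K[OF that, of j] K[OF that, of "j - 1"] by (simp add: laplacian_def abs_le_iff)
    also have "\<dots> \<le> D * (weight a j / weight a 1) + 2 * (D * weight a j) + D * (weight a j / weight a (- 1))"
      using D a by (intro add_mono mult_left_mono weight_shift_le) auto
    also have "\<dots> = (D * W) * weight a j" by (simp add: W_def algebra_simps)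
    finally show ?thesis .
  qed
  have "((\<lambda>s. conv (heat_kernel s) f n) has_real_derivative conv (laplacian (heat_kernel t)) f n) (at t)"
    by (rule conv_has_real_derivative[where u=0 and v="2 * t" and K'="\<lambda>s. laplacian (heat_kernel s)" and C="D * W", OF _ f])
       (use a t heat_kernel_deriv K1 K2 in auto)
  then show ?thesis using a t
    by (simp add: signed_laplacian_def laplacian_conv_left[OF _ decaying_heat_kernel f])
qed

lemma heat_diff_deriv:
  "t > 0 \<Longrightarrow> ((\<lambda>s. heat_diff f l m s n) has_real_derivative heat_diff f (Suc l) m t n) (at t)"
  using diff_op_deriv[where \<sigma>=1 and u="\<lambda>s. conv (heat_kernel s) f", OF heat_conv_deriv]
  by (simp add: heat_diff_def diff_op_laplacian)

lemma heat_deriv_eq: assumes "t > 0" shows "heat_deriv l m f t = heat_diff f l m t"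
proof
  fix n
  show "heat_deriv l m f t n = heat_diff f l m t n"
    unfolding heat_deriv_def
    by (rule iterated_deriv_eq[where H="\<lambda>l s. heat_diff f l m s n", OF _ heat_diff_deriv assms])
       (simp add: heat_diff_def diff_op_def heat_semigroup_eq_conv[abs_def])
qed

lemma tempered_heat_diff: "t > 0 \<Longrightarrow> tempered a (heat_diff f l m t)"
  using a f unfolding heat_diff_def by (intro tempered_diff_op tempered_conv decaying_heat_kernel) auto

lemma heat_diff_semigroup:
  assumes "s > 0" "t > 0" shows "heat_diff f l m (s + t) = conv (heat_kernel s) (heat_diff f l m t)"
proof -
  have d: "decaying a (heat_kernel s)" "decaying a (heat_kernel t)"
    using a assms by (auto intro!: decaying_heat_kernel)
  have "conv (heat_kernel (s + t)) f = conv (heat_kernel s) (conv (heat_kernel t) f)"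
    using conv_conv[OF a d f] by (simp add: fun_eq_iff heat_kernel_semigroup[OF assms])
  then show ?thesis unfolding heat_diff_def
    using a d f by (simp add: diff_op_conv_right[OF _ d(1)] tempered_conv)
qed

lemma lp_norm_delta_heat_diff:
  assumes "1 \<le> p" "t > 0"
  shows "lp_norm p (delta_right (heat_diff f l m t)) \<le> ennreal (sqrt 2 * t powr (1 / 2 - 1)) * lp_norm p (heat_diff f l m (t / 2))"
proof -
  have "lp_norm p (delta_right (heat_diff f l m t)) \<le> ennreal ((t / 2) powr (- 1 / 2)) * lp_norm p (heat_diff f l m (t / 2))"
  proof (rule lp_norm_delta_semigroup_le[OF assms(1)])
    show "heat_diff f l m t = conv (heat_kernel (t / 2)) (heat_diff f l m (t / 2))"
      using heat_diff_semigroup[of "t / 2" "t / 2" l m] assms by simp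
    show "(\<integral>\<^sup>+j. ennreal \<bar>delta_right (heat_kernel (t / 2)) j\<bar> \<partial>count_space UNIV) \<le> ennreal ((t / 2) powr (- 1 / 2))"
      using assms by (intro l1_delta_heat_kernel) simp
  qed (use a assms decaying_heat_kernel[of a "t / 2"] tempered_heat_diff[of "t / 2"] in auto)
  \<comment> \<open>The exponent is kept in the form 1/2 - 1 to match \<open>g = 1 / 2\<close> in
    the transfer lemmas.\<close>
  also have "(t / 2) powr (- 1 / 2) = sqrt 2 * t powr (1 / 2 - 1)"
    using assms by (simp add: powr_divide powr_minus_divide powr_half_sqrt)
  finally show ?thesis .
qed

text \<open>The upper bound on \<open>a\<close> says that the decay rate t^((a - m - 2l - 1)/2) has
  a negative exponent; the lower bounds at work elsewhere only make the convolution
  converge.\<close>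

lemma heat_diff_tendsto_0:
  assumes "a < real m + 2 * real l + 1"
  shows "((\<lambda>t. heat_diff f l m t n) \<longlongrightarrow> 0) at_top"
proof -
  define k where "k = m + 2 * l"
  obtain C where C: "\<And>t j. t \<ge> real (Suc k) \<Longrightarrow> \<bar>(delta_right ^^ k) (heat_kernel t) j\<bar> \<le> C * t powr ((a - real k - 1) / 2) * weight a j"
    using funpow_delta_heat_kernel_le_weight[of a k] a by auto
  define e where "e = (a - real k - 1) / 2"
  have e: "e < 0" using assms by (simp add: e_def k_def)
  \<comment> \<open>Accounts for the shift by \<open>l\<close> that the Laplacians
    introduce.\<close>
  define D where "D = \<bar>C\<bar> / weight a (- int l)"
  have K: "\<bar>diff_op 1 l m (heat_kernel t) j\<bar> \<le> D * t powr e * weight a j" if t: "t \<ge> real (Suc k)" for t j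
  proof -
    have "\<bar>diff_op 1 l m (heat_kernel t) j\<bar> \<le> C * t powr e * weight a (j + - int l)"
      using C[OF t, of "j - int l"] by (simp add: abs_diff_op k_def e_def)
    also have "\<dots> \<le> \<bar>C\<bar> * t powr e * weight a (j + - int l)"
      by (intro mult_right_mono) auto
    also have "\<dots> \<le> \<bar>C\<bar> * t powr e * (weight a j / weight a (- int l))"
      using a by (intro mult_left_mono weight_shift_le) auto
    finally show ?thesis by (simp add: D_def mult_ac)
  qed
  have te: "((\<lambda>t. t powr e) \<longlongrightarrow> 0) at_top"
    using e by (intro tendsto_neg_powr filterlim_ident)
  have "((\<lambda>t. conv (diff_op 1 l m (heat_kernel t)) f n) \<longlongrightarrow> 0) at_top"
  proof (rule conv_tendsto_0[OF _ f, where T="real (Suc k)" and C=D])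
    fix t j assume t: "t \<ge> real (Suc k)"
    have "t powr e \<le> 1" using t e powr_mono[of e 0 t] by simp
    then have "D * t powr e * weight a j \<le> D * 1 * weight a j"
      by (intro mult_right_mono mult_left_mono) (auto simp: D_def)
    then show "\<bar>diff_op 1 l m (heat_kernel t) j\<bar> \<le> D * weight a j" using K[OF t, of j] by simp
  next
    fix j
    show "((\<lambda>t. diff_op 1 l m (heat_kernel t) j) \<longlongrightarrow> 0) at_top"
    proof (rule Lim_null_comparison)
      show "\<forall>\<^sub>F t in at_top. norm (diff_op 1 l m (heat_kernel t) j) \<le> D * t powr e * weight a j"
        using eventually_ge_at_top[of "real (Suc k)"] by eventually_elim (use K in simp)
      have "((\<lambda>t. D * t powr e * weight a j) \<longlongrightarrow> D * 0 * weight a j) at_top"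
        by (intro tendsto_mult tendsto_const te)
      then show "((\<lambda>t. D * t powr e * weight a j) \<longlongrightarrow> 0) at_top" by simp
    qed
  qed (use a in auto)
  moreover have "\<forall>\<^sub>F t in at_top. conv (diff_op 1 l m (heat_kernel t)) f n = heat_diff f l m t n"
    using eventually_gt_at_top[of 0] by eventually_elim
      (use a in \<open>simp add: heat_diff_def diff_op_conv_left[OF _ decaying_heat_kernel f]\<close>)
  ultimately show ?thesis by (rule Lim_transform_eventually)
qed

lemma heat_deriv_continuous: "continuous_on {0<..} (\<lambda>t. heat_deriv l m f t n)"
proof -
  have "continuous_on {0<..} (\<lambda>t. heat_diff f l m t n)"
    by (intro continuous_at_imp_continuous_on) (auto intro: DERIV_isCont heat_diff_deriv)
  then show ?thesis by (rule continuous_on_eq) (simp add: heat_deriv_eq)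
qed

text \<open>No integration in time is involved: the heat equation makes one time derivative a
  difference of the quantity on the right, and a difference gains t^(-1/2).\<close>

lemma heat_time_le_space:
  assumes pq: "1 \<le> p" "1 \<le> q"
  shows "mixed_norm p q (\<lambda>t n. t powr (\<beta> + 1 / 2) * heat_deriv (Suc l) m f t n)
    \<le> ennreal (sqrt 2 * 2 powr \<beta>) * mixed_norm p q (\<lambda>t n. t powr \<beta> * heat_deriv l (m + 1) f t n)"
proof -
  have "mixed_norm p q (\<lambda>t n. t powr (\<beta> + 1 / 2) * heat_deriv (Suc l) m f t n)
    \<le> ennreal (sqrt 2 * 2 powr (\<beta> + 1 / 2 + 1 / 2 - 1)) * mixed_norm p q (\<lambda>t n. t powr (\<beta> + 1 / 2 + 1 / 2 - 1) * heat_deriv l (m + 1) f t n)"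
  proof (rule mixed_norm_le_of_halved_time[OF pq _ heat_deriv_continuous heat_deriv_continuous])
    fix t :: real assume t: "t > 0"
    have "heat_deriv (Suc l) m f t = (\<lambda>n. delta_right (heat_diff f l (Suc m) t) (n + - 1))"
      using t by (simp add: heat_deriv_eq heat_diff_def fun_eq_iff diff_op_Suc_left_eq_delta_right)
    then have "lp_norm p (heat_deriv (Suc l) m f t) = lp_norm p (delta_right (heat_diff f l (Suc m) t))"
      by (simp only: lp_norm_shift)
    also have "\<dots> \<le> ennreal (sqrt 2 * t powr (1 / 2 - 1)) * lp_norm p (heat_diff f l (Suc m) (t / 2))"
      by (rule lp_norm_delta_heat_diff[OF pq(1) t])
    finally show "lp_norm p (heat_deriv (Suc l) m f t) \<le> ennreal (sqrt 2 * t powr (1 / 2 - 1)) * lp_norm p (heat_deriv l (m + 1) f (t / 2))"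
      using t by (simp add: heat_deriv_eq)
  qed simp
  then show ?thesis by simp
qed

text \<open>The time derivative of the left quantity is one difference of the right quantity, so
  Hardy's inequality applies with \<open>g = 1 / 2\<close>.\<close>

lemma heat_space_le_time:
  assumes pq: "1 \<le> p" "1 \<le> q" and \<beta>: "\<beta> > 0" and al: "a < real (Suc m) + 2 * real l + 1"
  shows "mixed_norm p q (\<lambda>t n. t powr \<beta> * heat_deriv l (Suc m) f t n)
    \<le> ennreal (sqrt 2 * 2 powr (\<beta> + 1 / 2) / \<beta>) * mixed_norm p q (\<lambda>t n. t powr (\<beta> + 1 / 2) * heat_deriv (l + 1) m f t n)"
proof (rule mixed_norm_hardy[OF pq _ \<beta>, where v'="heat_deriv (Suc l) (Suc m) f"])
  fix t :: real and n :: int assume t: "t > 0"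
  show "((\<lambda>s. heat_deriv l (Suc m) f s n) has_real_derivative heat_deriv (Suc l) (Suc m) f t n) (at t)"
    unfolding heat_deriv_eq[OF t]
    by (rule has_field_derivative_transform_within_open[OF heat_diff_deriv[OF t], of "{0<..}"])
       (use t in \<open>auto simp: heat_deriv_eq\<close>)
next
  fix n
  show "((\<lambda>t. heat_deriv l (Suc m) f t n) \<longlongrightarrow> 0) at_top"
    by (rule Lim_transform_eventually[OF heat_diff_tendsto_0[OF al, of n]])
       (use eventually_gt_at_top[of 0] in \<open>eventually_elim; simp add: heat_deriv_eq\<close>)
next
  fix t :: real assume t: "t > 0"
  have "heat_deriv (Suc l) (Suc m) f t = delta_right (heat_diff f (Suc l) m t)"
    using t by (simp add: heat_deriv_eq heat_diff_def diff_op_Suc_right)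
  then show "lp_norm p (heat_deriv (Suc l) (Suc m) f t) \<le> ennreal (sqrt 2 * t powr (1 / 2 - 1)) * lp_norm p (heat_deriv (l + 1) m f (t / 2))"
    using lp_norm_delta_heat_diff[OF pq(1) t, of "Suc l" m] t by (simp add: heat_deriv_eq)
qed (auto intro: heat_deriv_continuous)

end

text \<open>The kernel satisfies a second-order equation in \<open>y\<close>: pairs of derivatives
  become powers of minus the Laplacian, and an odd one is left on the kernel.\<close>

definition poisson_diff :: "(int \<Rightarrow> real) \<Rightarrow> nat \<Rightarrow> nat \<Rightarrow> real \<Rightarrow> int \<Rightarrow> real" where
  "poisson_diff f l m y =
     diff_op (- 1) (l div 2) m (conv (if even l then poisson_kernel y else poisson_kernel' y) f)"

context
  fixes f :: "int \<Rightarrow> real"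
  assumes f: "tempered 2 f"
begin

lemma poisson_conv_deriv:
  assumes y: "y > 0"
  shows "((\<lambda>s. conv (poisson_kernel s) f n) has_real_derivative conv (poisson_kernel' y) f n) (at y)"
    and "((\<lambda>s. conv (poisson_kernel' s) f n) has_real_derivative signed_laplacian (- 1) (conv (poisson_kernel y) f) n) (at y)"
proof -
  obtain C where C: "C \<ge> 0" "\<And>s n. s > 0 \<Longrightarrow> \<bar>poisson_kernel s n\<bar> \<le> (1 + C * s) * weight 2 n"
    using poisson_kernel_le_weight by auto
  obtain C' where C': "C' \<ge> 0" "\<And>s n. s > 0 \<Longrightarrow> \<bar>poisson_kernel' s n\<bar> \<le> C' * weight 2 n"
    using poisson_kernel'_le_weight by auto
  \<comment> \<open>Dominates both kernels for 0 < s < 2y.\<close>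
  define D where "D = (1 + C * (2 * y)) + C'"
  have D: "D \<ge> 0" using C C' y by (simp add: D_def)
  have K: "\<bar>poisson_kernel s n\<bar> \<le> D * weight 2 n" if "0 < s" "s < 2 * y" for s n
  proof -
    have "1 + C * s \<le> D" using that C(1) C'(1) mult_left_mono[of s "2 * y" C] by (simp add: D_def)
    then have "(1 + C * s) * weight 2 n \<le> D * weight 2 n" by (intro mult_right_mono) auto
    then show ?thesis using C(2)[OF that(1), of n] by (rule order_trans[rotated])
  qed
  have K': "\<bar>poisson_kernel' s n\<bar> \<le> D * weight 2 n" if "0 < s" "s < 2 * y" for s n
  proof -
    have "C' \<le> D" using C(1) y by (simp add: D_def)
    then have "C' * weight 2 n \<le> D * weight 2 n" by (intro mult_right_mono) auto
    then show ?thesis using C'(2)[OF that(1), of n] by (rule order_trans[rotated])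
  qed
  show "((\<lambda>s. conv (poisson_kernel s) f n) has_real_derivative conv (poisson_kernel' y) f n) (at y)"
    by (rule conv_has_real_derivative[where u=0 and v="2 * y" and K'=poisson_kernel' and C=D, OF _ f])
       (use y poisson_kernel_deriv K K' in auto)
  define W where "W = 2 + 1 / weight 2 1 + 1 / weight 2 (- 1)"
  have W: "W \<ge> 1" by (simp add: W_def)
  have K1: "\<bar>poisson_kernel' s j\<bar> \<le> (D * W) * weight 2 j" if "0 < s" "s < 2 * y" for s j
  proof -
    have "D * 1 * weight 2 j \<le> D * W * weight 2 j" using D W by (intro mult_right_mono mult_left_mono) auto
    then show ?thesis using K'[OF that, of j] by simp
  qed
  have K2: "\<bar>signed_laplacian (- 1) (poisson_kernel s) j\<bar> \<le> (D * W) * weight 2 j" if "0 < s" "s < 2 * y" for s j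
  proof -
    have "\<bar>signed_laplacian (- 1) (poisson_kernel s) j\<bar> \<le> D * weight 2 (j + 1) + 2 * (D * weight 2 j) + D * weight 2 (j + - 1)"
      using K[OF that, of "j + 1"] K[OF that, of j] K[OF that, of "j - 1"]
      by (simp add: signed_laplacian_def laplacian_def abs_le_iff)
    also have "\<dots> \<le> D * (weight 2 j / weight 2 1) + 2 * (D * weight 2 j) + D * (weight 2 j / weight 2 (- 1))"
      using D by (intro add_mono mult_left_mono weight_shift_le) auto
    also have "\<dots> = (D * W) * weight 2 j" by (simp add: W_def algebra_simps)
    finally show ?thesis .
  qed
  have "((\<lambda>s. conv (poisson_kernel' s) f n) has_real_derivative conv (signed_laplacian (- 1) (poisson_kernel y)) f n) (at y)"
    by (rule conv_has_real_derivative[where u=0 and v="2 * y" and K'="\<lambda>s. signed_laplacian (- 1) (poisson_kernel s)" and C="D * W", OF _ f])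
       (use y poisson_kernel'_deriv K1 K2 in \<open>auto simp: signed_laplacian_def\<close>)
  then show "((\<lambda>s. conv (poisson_kernel' s) f n) has_real_derivative signed_laplacian (- 1) (conv (poisson_kernel y) f) n) (at y)"
    using y by (simp add: signed_laplacian_conv_left[OF _ decaying_poisson_kernel f])
qed

lemma poisson_diff_deriv:
  assumes y: "y > 0"
  shows "((\<lambda>s. poisson_diff f l m s n) has_real_derivative poisson_diff f (Suc l) m y n) (at y)"
proof (cases "even l")
  case True
  then show ?thesis
    using diff_op_deriv[where u="\<lambda>s. conv (poisson_kernel s) f", OF poisson_conv_deriv(1)[OF y]]
    by (simp add: poisson_diff_def)
next
  case False
  then have "Suc l div 2 = Suc (l div 2)" by (auto elim!: oddE)
  then show ?thesis using False
    using diff_op_deriv[where \<sigma>="- 1" and u="\<lambda>s. conv (poisson_kernel' s) f", OF poisson_conv_deriv(2)[OF y]]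
    by (simp add: poisson_diff_def diff_op_laplacian)
qed

lemma poisson_deriv_eq: assumes "y > 0" shows "poisson_deriv l m f y = poisson_diff f l m y"
proof
  fix n
  have "(delta_right ^^ m) (poisson_semigroup s f) n = poisson_diff f 0 m s n" if "s > 0" for s
  proof -
    have "poisson_semigroup s f = conv (poisson_kernel s) f"
      using poisson_semigroup_eq_conv[OF that f] by (simp add: fun_eq_iff)
    then show ?thesis by (simp add: poisson_diff_def diff_op_def)
  qed
  then show "poisson_deriv l m f y n = poisson_diff f l m y n"
    unfolding poisson_deriv_def
    by (rule iterated_deriv_eq[where H="\<lambda>l s. poisson_diff f l m s n", OF _ poisson_diff_deriv assms])
qed

lemma tempered_poisson_diff: "y > 0 \<Longrightarrow> tempered 2 (poisson_diff f l m y)"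
  using f unfolding poisson_diff_def
  by (intro tempered_diff_op tempered_conv) (auto intro: decaying_poisson_kernel decaying_poisson_kernel')

lemma poisson_diff_semigroup:
  assumes s: "s > 0" and y: "y > 0"
  shows "poisson_diff f l m (s + y) = conv (poisson_kernel s) (poisson_diff f l m y)"
proof -
  define k where "k z = (if even l then poisson_kernel z else poisson_kernel' z)" for z
  have d: "decaying 2 (poisson_kernel s)" "decaying 2 (k y)"
    using s y by (auto simp: k_def intro: decaying_poisson_kernel decaying_poisson_kernel')
  have "k (s + y) = conv (poisson_kernel s) (k y)"
    using poisson_kernel_semigroup[OF s y] by (simp add: k_def)
  then have "conv (k (s + y)) f = conv (poisson_kernel s) (conv (k y) f)"
    using conv_conv[OF _ d f] by auto
  then show ?thesis unfolding poisson_diff_def k_def[symmetric]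
    using d f by (simp add: diff_op_conv_right[OF _ d(1)] tempered_conv)
qed

lemma lp_norm_delta_poisson_diff:
  assumes "1 \<le> p" "y > 0"
  shows "lp_norm p (delta_right (poisson_diff f l m y)) \<le> ennreal (4 / sqrt pi * y powr (0 - 1)) * lp_norm p (poisson_diff f l m (y / 2))"
proof -
  have "lp_norm p (delta_right (poisson_diff f l m y)) \<le> ennreal (2 / (sqrt pi * (y / 2))) * lp_norm p (poisson_diff f l m (y / 2))"
  proof (rule lp_norm_delta_semigroup_le[OF assms(1)])
    show "poisson_diff f l m y = conv (poisson_kernel (y / 2)) (poisson_diff f l m (y / 2))"
      using poisson_diff_semigroup[of "y / 2" "y / 2" l m] assms by simp
    show "(\<integral>\<^sup>+j. ennreal \<bar>delta_right (poisson_kernel (y / 2)) j\<bar> \<partial>count_space UNIV) \<le> ennreal (2 / (sqrt pi * (y / 2)))"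
      using assms by (intro l1_delta_poisson_kernel) simp
  qed (use assms decaying_poisson_kernel[of "y / 2"] tempered_poisson_diff[of "y / 2"] in auto)
  \<comment> \<open>A difference gains exactly 1/y, that is \<open>g = 0\<close>, so the power of
    \<open>y\<close> will not change.\<close>
  also have "2 / (sqrt pi * (y / 2)) = 4 / sqrt pi * y powr (0 - 1)"
    using assms by (simp add: powr_minus_divide)
  finally show ?thesis .
qed

lemma conv_poisson_kernel'_tendsto_0: "((\<lambda>y. conv (poisson_kernel' y) f n) \<longlongrightarrow> 0) at_top"
proof -
  obtain C where C: "\<And>s n. s > 0 \<Longrightarrow> \<bar>poisson_kernel' s n\<bar> \<le> C * weight 2 n"
    using poisson_kernel'_le_weight by auto
  show ?thesis
  proof (rule conv_tendsto_0[OF _ f, where T=1 and C=C])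
    fix j
    show "((\<lambda>s. poisson_kernel' s j) \<longlongrightarrow> 0) at_top"
    proof (rule Lim_null_comparison)
      show "\<forall>\<^sub>F s in at_top. norm (poisson_kernel' s j) \<le> 1 / s"
        using eventually_gt_at_top[of 0] by eventually_elim (simp add: abs_poisson_kernel'_le)
      show "((\<lambda>s::real. 1 / s) \<longlongrightarrow> 0) at_top"
        by (intro tendsto_divide_0[OF tendsto_const] filterlim_at_top_imp_at_infinity filterlim_ident)
    qed
  qed (use C in auto)
qed

lemma conv_delta_poisson_kernel_tendsto_0: "((\<lambda>y. conv (delta_right (poisson_kernel y)) f n) \<longlongrightarrow> 0) at_top"
proof -
  obtain C where C: "\<And>s n. s > 0 \<Longrightarrow> \<bar>delta_right (poisson_kernel s) n\<bar> \<le> C * weight 2 n"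
    using delta_poisson_kernel_le_weight by auto
  show ?thesis
  proof (rule conv_tendsto_0[OF _ f, where T=1 and C=C])
    fix j
    show "((\<lambda>s. delta_right (poisson_kernel s) j) \<longlongrightarrow> 0) at_top"
    proof (rule Lim_null_comparison)
      show "\<forall>\<^sub>F s in at_top. norm (delta_right (poisson_kernel s) j) \<le> 2 / sqrt pi / s"
        using eventually_gt_at_top[of 0] by eventually_elim (use abs_delta_poisson_kernel_le in simp)
      show "((\<lambda>s::real. 2 / sqrt pi / s) \<longlongrightarrow> 0) at_top"
        by (intro tendsto_divide_0[OF tendsto_const] filterlim_at_top_imp_at_infinity filterlim_ident)
    qed
  qed (use C in auto)
qed

text \<open>At least one derivative or difference must be present: the kernel has mass 1, so
  constants are preserved. Once one is present, the others are finite differences of functions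
  tending to 0.\<close>

lemma poisson_diff_tendsto_0:
  assumes "l + m \<ge> 1" shows "((\<lambda>y. poisson_diff f l m y n) \<longlongrightarrow> 0) at_top"
proof (cases "even l")
  case False
  then show ?thesis
    using diff_op_tendsto_0[where u="\<lambda>y. conv (poisson_kernel' y) f", OF conv_poisson_kernel'_tendsto_0]
    by (simp add: poisson_diff_def)
next
  case even: True
  have base: "((\<lambda>y. delta_right (conv (poisson_kernel y) f) n) \<longlongrightarrow> 0) at_top" for n
    by (rule Lim_transform_eventually[OF conv_delta_poisson_kernel_tendsto_0[of n]])
       (use eventually_gt_at_top[of 0] in \<open>eventually_elim; simp add: delta_right_conv_left[OF _ decaying_poisson_kernel f]\<close>)
  have S: "((\<lambda>y. diff_op (- 1) k (Suc m') (conv (poisson_kernel y) f) n) \<longlongrightarrow> 0) at_top" for k m' n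
  proof -
    have "diff_op (- 1) k (Suc m') g = diff_op (- 1) k m' (delta_right g)" for g
      by (simp add: diff_op_def funpow_swap1)
    then show ?thesis
      using diff_op_tendsto_0[where u="\<lambda>y. delta_right (conv (poisson_kernel y) f)", OF base] by simp
  qed
  show ?thesis
  proof (cases m)
    case (Suc m')
    then show ?thesis using S even by (simp add: poisson_diff_def)
  next
    case 0
    \<comment> \<open>Without differences and with \<open>l\<close> even there is at least one
      Laplacian, which supplies the required difference.\<close>
    have "l div 2 \<noteq> 0" using assms even 0 by presburger
    then obtain k where k: "l div 2 = Suc k" using not0_implies_Suc by blast
    have "((\<lambda>y. (- 1) * (diff_op (- 1) k (Suc 0) (conv (poisson_kernel y) f) (n - 1)
       - diff_op (- 1) k (Suc 0) (conv (poisson_kernel y) f) (n - 1 + 1))) \<longlongrightarrow> (- 1) * (0 - 0)) at_top"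
      by (intro tendsto_intros S)
    then show ?thesis using even 0 k
      by (simp add: poisson_diff_def diff_op_Suc_left_eq_delta_right delta_right_def)
  qed
qed

lemma poisson_deriv_continuous: "continuous_on {0<..} (\<lambda>y. poisson_deriv l m f y n)"
proof -
  have "continuous_on {0<..} (\<lambda>y. poisson_diff f l m y n)"
    by (intro continuous_at_imp_continuous_on) (auto intro: DERIV_isCont poisson_diff_deriv)
  then show ?thesis by (rule continuous_on_eq) (simp add: poisson_deriv_eq)
qed

text \<open>Both Poisson inequalities need Hardy: the equation is of second order, so only a further
  derivative of the left quantity is a difference of the right one. The hypothesis \<open>U\<close>
  covers the two ways in which this happens.\<close>

lemma poisson_hardy:
  assumes pq: "1 \<le> p" "1 \<le> q" and \<beta>: "\<beta> > 0" and lm: "l + m \<ge> 1"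
    and U: "\<And>y. y > 0 \<Longrightarrow> lp_norm p (poisson_diff f (Suc l) m y) = lp_norm p (delta_right (poisson_diff f l' m' y))"
  shows "mixed_norm p q (\<lambda>y n. y powr \<beta> * poisson_deriv l m f y n)
    \<le> ennreal (4 / sqrt pi * 2 powr \<beta> / \<beta>) * mixed_norm p q (\<lambda>y n. y powr \<beta> * poisson_deriv l' m' f y n)"
proof -
  have "mixed_norm p q (\<lambda>y n. y powr \<beta> * poisson_deriv l m f y n)
    \<le> ennreal (4 / sqrt pi * 2 powr (\<beta> + 0) / \<beta>) * mixed_norm p q (\<lambda>y n. y powr (\<beta> + 0) * poisson_deriv l' m' f y n)"
  proof (rule mixed_norm_hardy[OF pq _ \<beta>, where v'="poisson_deriv (Suc l) m f"])
    fix y :: real and n :: int assume y: "y > 0"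
    show "((\<lambda>s. poisson_deriv l m f s n) has_real_derivative poisson_deriv (Suc l) m f y n) (at y)"
      unfolding poisson_deriv_eq[OF y]
      by (rule has_field_derivative_transform_within_open[OF poisson_diff_deriv[OF y], of "{0<..}"])
         (use y in \<open>auto simp: poisson_deriv_eq\<close>)
  next
    fix n
    show "((\<lambda>y. poisson_deriv l m f y n) \<longlongrightarrow> 0) at_top"
      by (rule Lim_transform_eventually[OF poisson_diff_tendsto_0[OF lm, of n]])
         (use eventually_gt_at_top[of 0] in \<open>eventually_elim; simp add: poisson_deriv_eq\<close>)
  next
    fix y :: real assume y: "y > 0"
    show "lp_norm p (poisson_deriv (Suc l) m f y) \<le> ennreal (4 / sqrt pi * y powr (0 - 1)) * lp_norm p (poisson_deriv l' m' f (y / 2))"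
      using lp_norm_delta_poisson_diff[OF pq(1) y, of l' m'] U[OF y] y by (simp add: poisson_deriv_eq)
  qed (auto intro: poisson_deriv_continuous)
  then show ?thesis by simp
qed

lemma poisson_time_le_space:
  assumes pq: "1 \<le> p" "1 \<le> q" and \<beta>: "\<beta> > 0"
  shows "mixed_norm p q (\<lambda>y n. y powr \<beta> * poisson_deriv (Suc l) m f y n)
    \<le> ennreal (4 / sqrt pi * 2 powr \<beta> / \<beta>) * mixed_norm p q (\<lambda>y n. y powr \<beta> * poisson_deriv l (m + 1) f y n)"
proof (rule poisson_hardy[OF pq \<beta>])
  fix y :: real
  \<comment> \<open>Two derivatives in \<open>y\<close> form minus the Laplacian; sign and shift
    leave the norm unchanged.\<close>
  have "poisson_diff f (Suc (Suc l)) m y = (\<lambda>n. - (delta_right (poisson_diff f l (Suc m) y) (n + - 1)))"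
    by (simp add: poisson_diff_def fun_eq_iff diff_op_Suc_left_eq_delta_right)
  then show "lp_norm p (poisson_diff f (Suc (Suc l)) m y) = lp_norm p (delta_right (poisson_diff f l (m + 1) y))"
    by (simp only: lp_norm_minus lp_norm_shift Suc_eq_plus1)
qed simp

lemma poisson_space_le_time:
  assumes pq: "1 \<le> p" "1 \<le> q" and \<beta>: "\<beta> > 0"
  shows "mixed_norm p q (\<lambda>y n. y powr \<beta> * poisson_deriv l (Suc m) f y n)
    \<le> ennreal (4 / sqrt pi * 2 powr \<beta> / \<beta>) * mixed_norm p q (\<lambda>y n. y powr \<beta> * poisson_deriv (l + 1) m f y n)"
  by (rule poisson_hardy[OF pq \<beta>]) (simp_all add: poisson_diff_def diff_op_Suc_right)

end

text \<open>For \<open>q < \<infinity>\<close> the bound \<open>x \<le> 1 + x\<^sup>q\<close> replaces Hoelder's inequality.\<close>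

lemma in_lq_mu_imp_tempered:
  assumes q: "1 \<le> q" and \<alpha>: "\<alpha> > 0" and a: "a > \<alpha> + 1"
    and f: "in_lq_mu q (\<lambda>n. f n / (1 + \<bar>real_of_int n\<bar> powr \<alpha>))"
  shows "tempered a f"
proof -
  define g where "g n = \<bar>f n / (1 + \<bar>real_of_int n\<bar> powr \<alpha>)\<bar>" for n
  have g0: "g n \<ge> 0" for n by (simp add: g_def)
  \<comment> \<open>The factor 2 comes from 1 + |n|^\<alpha> <= 2 (1 + |n|)^\<alpha>, which lowers
    the exponent of the weight from \<open>a\<close> to \<open>a - \<alpha>\<close>.\<close>
  have fg: "\<bar>f n * weight a n\<bar> \<le> 2 * (g n * weight (a - \<alpha>) n)" for n
  proof -
    define x where "x = 1 + \<bar>real_of_int n\<bar>"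
    have x: "x \<ge> 1" by (simp add: x_def)
    have pos: "1 + \<bar>real_of_int n\<bar> powr \<alpha> > 0" by (simp add: add_pos_nonneg)
    have "\<bar>real_of_int n\<bar> powr \<alpha> \<le> x powr \<alpha>" using \<alpha> by (intro powr_mono2) (auto simp: x_def)
    moreover have "1 \<le> x powr \<alpha>" using x \<alpha> by (simp add: ge_one_powr_ge_zero)
    ultimately have le: "1 + \<bar>real_of_int n\<bar> powr \<alpha> \<le> 2 * x powr \<alpha>" by linarith
    have "\<bar>f n\<bar> = g n * (1 + \<bar>real_of_int n\<bar> powr \<alpha>)"
      using pos by (simp add: g_def abs_mult)
    also have "\<dots> \<le> g n * (2 * x powr \<alpha>)" using le g0 by (rule mult_left_mono)
    finally have "\<bar>f n\<bar> * x powr (- a) \<le> g n * (2 * x powr \<alpha>) * x powr (- a)" by (rule mult_right_mono) simp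
    also have "\<dots> = 2 * (g n * x powr (- (a - \<alpha>)))"
      using powr_add[of x \<alpha> "- a"] by (simp add: mult_ac)
    finally show ?thesis by (simp add: weight_def x_def abs_mult)
  qed
  have ws: "weight (a - \<alpha>) summable_on UNIV" using a by (intro weight_summable) simp
  have "(\<lambda>n. g n * weight (a - \<alpha>) n) summable_on UNIV"
  proof (cases "q = \<infinity>")
    case True
    then have "bounded (range (\<lambda>n. f n / (1 + \<bar>real_of_int n\<bar> powr \<alpha>)))"
      using f by (simp add: in_lq_mu_def)
    then obtain B where "\<And>n. \<bar>g n\<bar> \<le> B" by (auto simp: bounded_iff g_def)
    then show ?thesis using ws by (rule summable_on_bounded_mult)
  next
    case False
    define r where "r = enn2real q"
    have r: "r \<ge> 1" using enn2real_ge_1[OF q False] by (simp add: r_def)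
    have s: "(\<lambda>n. g n powr r * (1 / (1 + \<bar>real_of_int n\<bar>))) summable_on UNIV"
      using f False by (simp add: in_lq_mu_def g_def r_def)
    show ?thesis
    proof (rule summable_on_real_comparison[OF summable_on_add[OF ws s]])
      fix n
      have "g n \<le> 1 + g n powr r"
      proof (cases "g n \<le> 1")
        case False
        then have "g n powr 1 \<le> g n powr r" using r by (intro powr_mono) auto
        then show ?thesis using False by simp
      qed (use powr_ge_zero[of "g n" r] in linarith)
      then have "g n * weight (a - \<alpha>) n \<le> (1 + g n powr r) * weight (a - \<alpha>) n"
        by (rule mult_right_mono) simp
      also have "\<dots> \<le> weight (a - \<alpha>) n + g n powr r * (1 / (1 + \<bar>real_of_int n\<bar>))"
      proof -
        \<comment> \<open>Since a - \<alpha> > 1, the weight lies below the density of the measure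
          \<mu>, and it is summable against the constant 1.\<close>
        have "weight (a - \<alpha>) n \<le> (1 + \<bar>real_of_int n\<bar>) powr (- 1)"
          unfolding weight_def using a by (intro powr_mono) auto
        also have "\<dots> = 1 / (1 + \<bar>real_of_int n\<bar>)" by (simp add: powr_minus_divide add_pos_nonneg)
        finally have "g n powr r * weight (a - \<alpha>) n \<le> g n powr r * (1 / (1 + \<bar>real_of_int n\<bar>))"
          by (rule mult_left_mono) simp
        then show ?thesis by (simp add: algebra_simps)
      qed
      finally show "\<bar>g n * weight (a - \<alpha>) n\<bar> \<le> weight (a - \<alpha>) n + g n powr r * (1 / (1 + \<bar>real_of_int n\<bar>))"
        using g0 by simp
    qed
  qed
  from summable_on_cmult_right[OF this, of 2] show ?thesis
    unfolding tempered_def by (rule summable_on_real_comparison) (rule fg)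
qed

lemma summable_imp_tempered_2:
  assumes "(\<lambda>j::int. \<bar>f j\<bar> / (1 + \<bar>real_of_int j\<bar>\<^sup>2)) summable_on UNIV" shows "tempered 2 f"
  unfolding tempered_def
proof (rule summable_on_real_comparison[OF assms])
  fix j
  have "1 + \<bar>real_of_int j\<bar>\<^sup>2 \<le> (1 + \<bar>real_of_int j\<bar>)\<^sup>2" by (simp add: power2_eq_square algebra_simps)
  moreover have "weight 2 j = 1 / (1 + \<bar>real_of_int j\<bar>)\<^sup>2"
    by (simp add: weight_def powr_minus_divide add_pos_nonneg)
  moreover have "0 < 1 + \<bar>real_of_int j\<bar>\<^sup>2" by (simp add: add_pos_nonneg)
  ultimately have "weight 2 j \<le> 1 / (1 + \<bar>real_of_int j\<bar>\<^sup>2)"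
    by (metis frac_le order_refl zero_le_one)
  then have "\<bar>f j\<bar> * weight 2 j \<le> \<bar>f j\<bar> * (1 / (1 + \<bar>real_of_int j\<bar>\<^sup>2))" by (intro mult_left_mono) auto
  then show "\<bar>f j * weight 2 j\<bar> \<le> \<bar>f j\<bar> / (1 + \<bar>real_of_int j\<bar>\<^sup>2)"
    unfolding abs_mult by simp
qed

theorem lemma2p9:
  fixes \<beta> :: real and p q :: ennreal
  assumes "\<beta> > 0" and "1 \<le> p" and "1 \<le> q"
  shows
    "(\<forall>\<alpha>::real. \<forall>m l::nat. \<alpha> > 0 \<and> real m / 2 + real l > \<alpha> / 2 \<longrightarrow>
        (l \<ge> 1 \<longrightarrow> (\<exists>C::real. C > 0 \<and> (\<forall>f::int \<Rightarrow> real.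
           in_lq_mu q (\<lambda>n. f n / (1 + \<bar>real_of_int n\<bar> powr \<alpha>)) \<longrightarrow>
           mixed_norm p q (\<lambda>t n. t powr (\<beta> + 1 / 2) * heat_deriv l m f t n)
           \<le> ennreal C * mixed_norm p q (\<lambda>t n. t powr \<beta> * heat_deriv (l - 1) (m + 1) f t n)))) \<and>
        (m \<ge> 1 \<longrightarrow> (\<exists>C::real. C > 0 \<and> (\<forall>f::int \<Rightarrow> real.
           in_lq_mu q (\<lambda>n. f n / (1 + \<bar>real_of_int n\<bar> powr \<alpha>)) \<longrightarrow>
           mixed_norm p q (\<lambda>t n. t powr \<beta> * heat_deriv l m f t n)
           \<le> ennreal C * mixed_norm p q (\<lambda>t n. t powr (\<beta> + 1 / 2) * heat_deriv (l + 1) (m - 1) f t n)))))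
     \<and>
     (\<forall>m l::nat.
        (l \<ge> 1 \<longrightarrow> (\<exists>C::real. C > 0 \<and> (\<forall>f::int \<Rightarrow> real.
           (\<lambda>j::int. \<bar>f j\<bar> / (1 + \<bar>real_of_int j\<bar>\<^sup>2)) summable_on UNIV \<longrightarrow>
           mixed_norm p q (\<lambda>y n. y powr \<beta> * poisson_deriv l m f y n)
           \<le> ennreal C * mixed_norm p q (\<lambda>y n. y powr \<beta> * poisson_deriv (l - 1) (m + 1) f y n)))) \<and>
        (m \<ge> 1 \<longrightarrow> (\<exists>C::real. C > 0 \<and> (\<forall>f::int \<Rightarrow> real.
           (\<lambda>j::int. \<bar>f j\<bar> / (1 + \<bar>real_of_int j\<bar>\<^sup>2)) summable_on UNIV \<longrightarrow>
           mixed_norm p q (\<lambda>y n. y powr \<beta> * poisson_deriv l m f y n)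
           \<le> ennreal C * mixed_norm p q (\<lambda>y n. y powr \<beta> * poisson_deriv (l + 1) (m - 1) f y n)))))"
proof (intro conjI allI impI)
  fix \<alpha> :: real and m l :: nat
  assume A: "\<alpha> > 0 \<and> real m / 2 + real l > \<alpha> / 2"
  \<comment> \<open>The midpoint of \<alpha> + 1 and m + 2l + 1; the hypothesis on \<open>m\<close>
    and \<open>l\<close> makes this interval nonempty.\<close>
  define a where "a = (\<alpha> + 1 + (real m + 2 * real l + 1)) / 2"
  have a: "a > \<alpha> + 1" "a > 1" "a < real m + 2 * real l + 1" using A by (auto simp: a_def field_simps)
  have tempered: "tempered a f" if "in_lq_mu q (\<lambda>n. f n / (1 + \<bar>real_of_int n\<bar> powr \<alpha>))" for f
    using in_lq_mu_imp_tempered[OF assms(3) _ a(1) that] A by simp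
  {
    assume "l \<ge> 1"
    then obtain l' where l: "l = Suc l'" by (cases l) auto
    show "\<exists>C::real. C > 0 \<and> (\<forall>f::int \<Rightarrow> real.
           in_lq_mu q (\<lambda>n. f n / (1 + \<bar>real_of_int n\<bar> powr \<alpha>)) \<longrightarrow>
           mixed_norm p q (\<lambda>t n. t powr (\<beta> + 1 / 2) * heat_deriv l m f t n)
           \<le> ennreal C * mixed_norm p q (\<lambda>t n. t powr \<beta> * heat_deriv (l - 1) (m + 1) f t n))"
      using heat_time_le_space[OF a(2) tempered assms(2,3), of _ \<beta> l' m]
      by (intro exI[of _ "sqrt 2 * 2 powr \<beta>"]) (simp add: l)
  }
  {
    assume "m \<ge> 1"
    then obtain m' where m: "m = Suc m'" by (cases m) auto
    show "\<exists>C::real. C > 0 \<and> (\<forall>f::int \<Rightarrow> real.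
           in_lq_mu q (\<lambda>n. f n / (1 + \<bar>real_of_int n\<bar> powr \<alpha>)) \<longrightarrow>
           mixed_norm p q (\<lambda>t n. t powr \<beta> * heat_deriv l m f t n)
           \<le> ennreal C * mixed_norm p q (\<lambda>t n. t powr (\<beta> + 1 / 2) * heat_deriv (l + 1) (m - 1) f t n))"
      using heat_space_le_time[OF a(2) tempered assms(2,3,1), of _ m' l] a(3) assms(1)
      by (intro exI[of _ "sqrt 2 * 2 powr (\<beta> + 1 / 2) / \<beta>"]) (simp add: m)
  }
next
  fix m l :: nat
  assume "l \<ge> 1"
  then obtain l' where l: "l = Suc l'" by (cases l) auto
  show "\<exists>C::real. C > 0 \<and> (\<forall>f::int \<Rightarrow> real.
           (\<lambda>j::int. \<bar>f j\<bar> / (1 + \<bar>real_of_int j\<bar>\<^sup>2)) summable_on UNIV \<longrightarrow>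
           mixed_norm p q (\<lambda>y n. y powr \<beta> * poisson_deriv l m f y n)
           \<le> ennreal C * mixed_norm p q (\<lambda>y n. y powr \<beta> * poisson_deriv (l - 1) (m + 1) f y n))"
    using poisson_time_le_space[OF summable_imp_tempered_2 assms(2,3,1), of _ l' m] assms(1)
    by (intro exI[of _ "4 / sqrt pi * 2 powr \<beta> / \<beta>"]) (simp add: l)
next
  fix m l :: nat
  assume "m \<ge> 1"
  then obtain m' where m: "m = Suc m'" by (cases m) auto
  show "\<exists>C::real. C > 0 \<and> (\<forall>f::int \<Rightarrow> real.
           (\<lambda>j::int. \<bar>f j\<bar> / (1 + \<bar>real_of_int j\<bar>\<^sup>2)) summable_on UNIV \<longrightarrow>
           mixed_norm p q (\<lambda>y n. y powr \<beta> * poisson_deriv l m f y n)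
           \<le> ennreal C * mixed_norm p q (\<lambda>y n. y powr \<beta> * poisson_deriv (l + 1) (m - 1) f y n))"
    using poisson_space_le_time[OF summable_imp_tempered_2 assms(2,3,1), of _ l m'] assms(1)
    by (intro exI[of _ "4 / sqrt pi * 2 powr \<beta> / \<beta>"]) (simp add: m)
qed

end
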